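(* Let $V$ be a real vector space of dimension $d\ge 1$ and let $\mu$ be a Borel probability measure on $\mathrm{GL}(V)$ such that $\mu$ has a moment of order one and $\Gamma_\mu$ is strongly irreducible. Let $L_n=X_n\cdots X_1$, where $(X_i)_{i\ge1}$ are independent random variables with law $\mu$, defined on a probability space $(\Omega,\mathcal F,\mathbb P)$. Then $$\limsup_{n\to+\infty}\ \mathbb P\left(\frac{\rho(L_n)}{\|L_n\|}\le\epsilon\right)$$ decreases to $0$ as $\epsilon>0$ decreases to $0$. Equivalently, for every sequence of real numbers $(\epsilon_n)_{n\ge1}$ that tends to zero, $$\mathbb P\left(\frac{\rho(L_n)}{\|L_n\|}\le\epsilon_n\right)\underset{n\to+\infty}{\longrightarrow}0.$$
   Context: Fix a norm $\|\cdot\|$ on $V$, and denote also by $\|\cdot\|$ the operator norm on $\mathrm{End}(V)$. For $g\in\mathrm{GL}(V)$, $\rho(g)$ is the spectral radius of $g$ (largest modulus of its complex eigenvalues) and $l(g)=\max\{\ln^+\|g\|,\ln^+\|g^{-1}\|\}$, where $\ln^+ x=\max\{\ln x,0\}$. The measure $\mu$ has a moment of order $i\in\mathbb N$ if $\int l(g)^i\,d\mu(g)<+\infty$. $\Gamma_\mu$ denotes the semigroup generated by the support of $\mu$. $\Gamma_\mu$ is strongly irreducible if it does not stabilize a finite union of non-trivial (i.e. nonzero proper) subspaces of $V$. *)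

theory Defs
  imports "HOL-Probability.Probability"
begin

text \<open>
  The vector space \<open>V\<close> is a type of class \<open>euclidean_space\<close>, so \<open>V\<close> has arbitrary
  finite dimension at least one. The Euclidean norm of the class only supplies the canonical
  topologies of \<open>V\<close> and of \<open>End(V)\<close>; the norm of the statement is an arbitrary
  norm \<open>N\<close> on \<open>V\<close>. Every linear endomorphism of \<open>V\<close> is bounded, so \<open>End(V)\<close> is
  the type of bounded linear functions.
\<close>

definition vector_norm :: "('v::real_vector \<Rightarrow> real) \<Rightarrow> bool" where
  "vector_norm N \<longleftrightarrow>
     (\<forall>x. N x = 0 \<longleftrightarrow> x = 0) \<and>
     (\<forall>r x. N (r *\<^sub>R x) = \<bar>r\<bar> * N x) \<and>
     (\<forall>x y. N (x + y) \<le> N x + N y)"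

text \<open>Like \<^const>\<open>onorm\<close>, but for the norm \<open>N\<close>; the point \<open>x = 0\<close> contributes \<open>0 / 0 = 0\<close>.\<close>

definition op_norm :: "('v::real_vector \<Rightarrow> real) \<Rightarrow> ('v \<Rightarrow> 'v) \<Rightarrow> real" where
  "op_norm N f = (SUP x. N (f x) / N x)"

text \<open>
  \<open>c\<close> is an eigenvalue of the complexification of \<open>f\<close>: the two equations are the real and
  imaginary parts of \<open>f (x + \<i> y) = c (x + \<i> y)\<close>.
\<close>

definition complex_eigenvalue :: "('v::real_vector \<Rightarrow> 'v) \<Rightarrow> complex \<Rightarrow> bool" where
  "complex_eigenvalue f c \<longleftrightarrow>
     (\<exists>x y. (x \<noteq> 0 \<or> y \<noteq> 0) \<and>
        f x = Re c *\<^sub>R x - Im c *\<^sub>R y \<and>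
        f y = Im c *\<^sub>R x + Re c *\<^sub>R y)"

definition spectral_radius :: "('v::real_vector \<Rightarrow> 'v) \<Rightarrow> real" where
  "spectral_radius f = Max {cmod c |c. complex_eigenvalue f c}"

definition GL :: "('v::euclidean_space \<Rightarrow>\<^sub>L 'v) set" where
  "GL = {g. bij (blinfun_apply g)}"

definition borel_GL :: "('v::euclidean_space \<Rightarrow>\<^sub>L 'v) measure" where
  "borel_GL = restrict_space borel GL"

definition ln_plus :: "real \<Rightarrow> real" where
  "ln_plus x = max (ln x) 0"

definition log_size :: "('v::euclidean_space \<Rightarrow> real) \<Rightarrow> ('v \<Rightarrow>\<^sub>L 'v) \<Rightarrow> real" where
  "log_size N g =
     max (ln_plus (op_norm N (blinfun_apply g))) (ln_plus (op_norm N (inv (blinfun_apply g))))"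

definition has_moment ::
  "('v::euclidean_space \<Rightarrow> real) \<Rightarrow> ('v \<Rightarrow>\<^sub>L 'v) measure \<Rightarrow> nat \<Rightarrow> bool" where
  "has_moment N \<mu> i \<longleftrightarrow> (\<integral>\<^sup>+ g. ennreal (log_size N g ^ i) \<partial>\<mu>) < \<infinity>"

text \<open>The topological support, inside \<open>GL\<close>, of a measure on \<open>GL\<close>.\<close>

definition support_GL :: "('v::euclidean_space \<Rightarrow>\<^sub>L 'v) measure \<Rightarrow> ('v \<Rightarrow>\<^sub>L 'v) set" where
  "support_GL \<mu> = {g \<in> GL. \<forall>U. open U \<and> g \<in> U \<longrightarrow> 0 < emeasure \<mu> (U \<inter> GL)}"

inductive_set generated_semigroup ::
  "('v::euclidean_space \<Rightarrow>\<^sub>L 'v) set \<Rightarrow> ('v \<Rightarrow>\<^sub>L 'v) set"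
  for S :: "('v \<Rightarrow>\<^sub>L 'v) set" where
  base: "g \<in> S \<Longrightarrow> g \<in> generated_semigroup S"
| comp: "g \<in> generated_semigroup S \<Longrightarrow> h \<in> generated_semigroup S \<Longrightarrow>
    g o\<^sub>L h \<in> generated_semigroup S"

text \<open>
  The family \<open>F\<close> must be nonempty, since the empty union is trivially stable. For invertible
  \<open>g\<close>, a finite union of subspaces that \<open>g\<close> maps into itself is mapped onto itself.
\<close>

definition strongly_irreducible :: "('v::euclidean_space \<Rightarrow>\<^sub>L 'v) set \<Rightarrow> bool" where
  "strongly_irreducible \<Gamma> \<longleftrightarrow>
     \<not> (\<exists>F. finite F \<and> F \<noteq> {} \<and>
          (\<forall>W\<in>F. subspace W \<and> W \<noteq> {0} \<and> W \<noteq> UNIV) \<and>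
          (\<forall>g\<in>\<Gamma>. blinfun_apply g ` (\<Union>F) \<subseteq> \<Union>F))"

text \<open>\<open>left_walk X n \<omega> = X n \<omega> \<circ> \<dots> \<circ> X 1 \<omega>\<close>; the value \<open>X 0\<close> is not used.\<close>

fun left_walk ::
  "(nat \<Rightarrow> 'w \<Rightarrow> 'v::euclidean_space \<Rightarrow>\<^sub>L 'v) \<Rightarrow> nat \<Rightarrow> 'w \<Rightarrow> 'v \<Rightarrow>\<^sub>L 'v" where
  "left_walk X 0 \<omega> = id_blinfun"
| "left_walk X (Suc n) \<omega> = X (Suc n) \<omega> o\<^sub>L left_walk X n \<omega>"

definition spectral_ratio :: "('v::euclidean_space \<Rightarrow> real) \<Rightarrow> ('v \<Rightarrow>\<^sub>L 'v) \<Rightarrow> real" where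
  "spectral_ratio N g = spectral_radius (blinfun_apply g) / op_norm N (blinfun_apply g)"

end

theory Submission
  imports Defs "HOL-Computational_Algebra.Fundamental_Theorem_Algebra"
begin

text \<open>
  Let \<open>\<nu>\<close> be a \<open>\<mu>\<close>-stationary measure on the unit sphere. By strong irreducibility it does not charge
  proper subspaces, and stationarity turns this into a bound for products: for fixed \<open>b \<noteq> 0\<close>, a
  random product \<open>g\<close> satisfies \<open>norm (b g) \<ge> c * norm b * norm g\<close> with probability close to one,
  uniformly in \<open>b\<close> and the length of \<open>g\<close>. Split \<open>L\<^sub>n = A B\<close> into independent halves with
  normalisations \<open>a\<close> and \<open>b\<close>; then \<open>norm (a b)\<close> and \<open>norm (b a)\<close> are bounded below with high
  probability.

  For a matrix \<open>h\<close> the mean of \<open>(norm (h (g x)) / norm (g x))\<^sup>2\<close> over \<open>\<nu>\<close> is a bounded martingale along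
  the products \<open>g = X\<^sub>1 \<dots> X\<^sub>n\<close>, so with high probability \<open>a\<close> is close to the set of limits at which
  it no longer changes under multiplication by further factors. Such a rigid limit has the same range
  as each of its nonzero products with factors from the closed cone of the semigroup. Therefore, if
  \<open>a\<close>, \<open>b\<close> are rigid and \<open>a b\<close>, \<open>b a\<close> are nonzero, no alternating product of \<open>a\<close> and \<open>b\<close>
  vanishes; in particular \<open>(a b)\<^sup>d \<noteq> 0\<close> for \<open>d = dim V\<close>. By compactness \<open>norm ((a b)\<^sup>d)\<close> is bounded
  below with high probability. On the other hand, a contraction all of whose eigenvalues have modulus
  at most \<open>\<epsilon> \<le> 1\<close> satisfies \<open>norm (g\<^sup>d) \<le> 2\<^sup>d * \<epsilon>\<close>.
\<close>

section \<open>Eigenvalues and small powers\<close>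

text \<open>The obstacle is that limits of normalised products may have any rank. If
  \<open>a\<close> and \<open>b\<close> have rank one, then \<open>a b \<noteq> 0\<close> and
  \<open>b a \<noteq> 0\<close> already give \<open>a b\<close> a nonzero eigenvalue; in higher rank
  \<open>a b\<close> and \<open>b a\<close> can both be nonzero and yet nilpotent, and rigidity is
  what rules this out. The test maps \<open>h\<close> serve to record the range of \<open>a\<close>:
  for \<open>a \<noteq> 0\<close> the mean vanishes exactly when \<open>h a = 0\<close>, and it is
  continuous in \<open>a\<close> away from \<open>0\<close> because \<open>\<nu>\<close> does not
  charge kernels, so that it still makes sense at singular limits. The martingale appends factors on
  the right, whereas \<open>L\<^sub>n\<close> grows on the left. Only the law of one product at a
  time enters, and that law does not depend on the order of numbering. Independence of the two
  halves lets either of them be held fixed while the other is random, as the bounds for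
  \<open>a b\<close> and for \<open>b a\<close> require. The product \<open>A B\<close> is divided
  by \<open>norm A * norm B\<close> and not by its own norm, so that the pair \<open>(a, b)\<close>
  stays in a compact product of unit spheres.\<close>

text \<open>The complexification of \<open>V\<close> is \<open>V \<times> V\<close>, a pair \<open>(x, y)\<close> standing for \<open>x + \<i> y\<close>.\<close>

definition cmul :: "complex \<Rightarrow> 'v::real_vector \<times> 'v \<Rightarrow> 'v \<times> 'v" where
  "cmul c z = (Re c *\<^sub>R fst z - Im c *\<^sub>R snd z, Im c *\<^sub>R fst z + Re c *\<^sub>R snd z)"

definition cext :: "('v \<Rightarrow> 'v) \<Rightarrow> 'v \<times> 'v \<Rightarrow> 'v \<times> 'v" where
  "cext f z = (f (fst z), f (snd z))"

definition lin_factor :: "('v::real_vector \<Rightarrow> 'v) \<Rightarrow> complex \<Rightarrow> 'v \<times> 'v \<Rightarrow> 'v \<times> 'v" where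
  "lin_factor f c z = cext f z - cmul c z"

text \<open>The operator \<open>p(f)\<close> on the complexification, by Horner's scheme, which
  unfolds along \<open>pCons\<close>.\<close>

definition poly_act :: "('v::real_vector \<Rightarrow> 'v) \<Rightarrow> complex poly \<Rightarrow> 'v \<times> 'v \<Rightarrow> 'v \<times> 'v" where
  "poly_act f p z = fold_coeffs (\<lambda>a w. cmul a z + cext f w) p 0"

lemma complex_eigenvalue_iff_cext:
  "complex_eigenvalue f c \<longleftrightarrow> (\<exists>z. z \<noteq> 0 \<and> cext f z = cmul c z)"
  by (auto simp: complex_eigenvalue_def cext_def cmul_def prod_eq_iff zero_prod_def)

lemma cmul_add: "cmul c (z + w) = cmul c z + cmul c w"
  and cmul_diff: "cmul c (z - w) = cmul c z - cmul c w"
  and cmul_add_left: "cmul (c + d) z = cmul c z + cmul d z"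
  and cmul_diff_left: "cmul (c - d) z = cmul c z - cmul d z"
  and cmul_uminus_left: "cmul (- c) z = - cmul c z"
  and cmul_cmul: "cmul c (cmul d z) = cmul (c * d) z"
  and cmul_0_left [simp]: "cmul 0 z = 0"
  and cmul_0_right [simp]: "cmul c 0 = 0"
  and cmul_1 [simp]: "cmul 1 z = z"
  by (auto simp: cmul_def prod_eq_iff algebra_simps)

lemma norm_cmul: "norm (cmul c z) = cmod c * norm (z :: 'v::real_inner \<times> 'v)"
proof -
  obtain x y where z: "z = (x, y)" by force
  have "(norm (cmul c z))\<^sup>2 = (cmod c * norm z)\<^sup>2"
    unfolding z cmul_def norm_Pair power_mult_distrib cmod_power2 real_sqrt_pow2[OF sum_power2_ge_zero]
    by (simp only: power2_norm_eq_inner inner_simps fst_conv snd_conv)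
      (simp add: inner_commute[of y x] power2_eq_square algebra_simps)
  then show ?thesis by simp
qed

lemma cmul_eq_0_iff: "cmul c z = 0 \<longleftrightarrow> c = 0 \<or> z = (0 :: 'v::real_inner \<times> 'v)"
  by (metis norm_cmul mult_eq_0_iff norm_eq_zero)

context
  fixes f :: "'v::euclidean_space \<Rightarrow> 'v"
  assumes f: "linear f"
begin

interpretation f: linear f by (rule f)

lemma cext_add: "cext f (z + w) = cext f z + cext f w"
  and cext_diff: "cext f (z - w) = cext f z - cext f w"
  and cext_0: "cext f 0 = 0"
  and cext_cmul: "cext f (cmul c z) = cmul c (cext f z)"
  by (auto simp: cext_def cmul_def f.add f.diff f.scaleR f.zero zero_prod_def)

lemma poly_act_0: "poly_act f 0 z = 0"
  by (simp add: poly_act_def)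

lemma poly_act_pCons: "poly_act f (pCons a p) z = cmul a z + cext f (poly_act f p z)"
  by (cases "p = 0 \<and> a = 0") (auto simp: poly_act_def cext_0)

lemma poly_act_add: "poly_act f (p + q) z = poly_act f p z + poly_act f q z"
  by (induction p q rule: poly_induct2) (simp_all add: poly_act_0 poly_act_pCons cext_add cmul_add_left)

lemma poly_act_smult: "poly_act f (smult c p) z = cmul c (poly_act f p z)"
  by (induction p) (simp_all add: poly_act_0 poly_act_pCons cmul_add cext_cmul cmul_cmul)

lemma poly_act_sum: "poly_act f (\<Sum>i\<in>I. p i) z = (\<Sum>i\<in>I. poly_act f (p i) z)"
  by (induction I rule: infinite_finite_induct) (simp_all add: poly_act_0 poly_act_add)

lemma poly_act_monom: "poly_act f (monom a i) z = cmul a ((cext f ^^ i) z)"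
  by (induction i) (simp_all add: monom_0 monom_Suc poly_act_pCons poly_act_0 cext_0 cext_cmul)

lemma poly_act_lin_factor: "poly_act f ([:-c, 1:] * q) z = lin_factor f c (poly_act f q z)"
  using poly_act_add[of "smult (- c) q" "pCons 0 q" z]
  by (simp add: poly_act_smult poly_act_pCons lin_factor_def cmul_uminus_left
      del: smult_minus_left add_uminus_conv_diff)

lemma lin_factor_cmul: "lin_factor f c (cmul a z) = cmul a (lin_factor f c z)"
  by (simp add: lin_factor_def cext_cmul cmul_diff cmul_cmul mult.commute)

lemma lin_factor_0: "lin_factor f c 0 = 0"
  by (simp add: lin_factor_def cext_0)

lemma lin_factor_commute: "lin_factor f c (lin_factor f d z) = lin_factor f d (lin_factor f c z)"
  by (simp add: lin_factor_def cext_diff cext_cmul cmul_diff cmul_cmul mult.commute)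

lemma foldr_lin_factor_cmul:
  "foldr (lin_factor f) cs (cmul a z) = cmul a (foldr (lin_factor f) cs z)"
  by (induction cs) (simp_all add: lin_factor_cmul)

lemma foldr_lin_factor_commute:
  "foldr (lin_factor f) cs (lin_factor f c z) = lin_factor f c (foldr (lin_factor f) cs z)"
  by (induction cs) (simp_all add: lin_factor_commute)

lemma foldr_lin_factor_swap:
  "foldr (lin_factor f) cs (foldr (lin_factor f) ds z) = foldr (lin_factor f) ds (foldr (lin_factor f) cs z)"
  by (induction ds) (simp_all add: foldr_lin_factor_commute)

lemma foldr_lin_factor_0: "foldr (lin_factor f) cs 0 = 0"
  by (induction cs) (simp_all add: lin_factor_0)

text \<open>The fundamental theorem of algebra splits off one root at a time. The leading
  coefficient remains as the scalar \<open>a\<close>; being nonzero, it can be cancelled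
  later.\<close>

lemma poly_act_factorization:
  assumes "p \<noteq> 0"
  obtains cs a where "length cs = degree p" "a \<noteq> 0"
    "\<And>z. poly_act f p z = foldr (lin_factor f) cs (cmul a z)"
proof -
  have "\<exists>cs a. length cs = degree p \<and> a \<noteq> 0 \<and>
      (\<forall>z. poly_act f p z = foldr (lin_factor f) cs (cmul a z))"
    using assms
  proof (induction "degree p" arbitrary: p)
    case 0
    then obtain a where "p = [:a:]" "a \<noteq> 0" by (metis degree_eq_zeroE pCons_0_0)
    then show ?case
      by (intro exI[of _ "[]"] exI[of _ a]) (simp add: poly_act_pCons poly_act_0 cext_0)
  next
    case (Suc n)
    obtain c where "poly p c = 0"
      using fundamental_theorem_of_algebra Suc.hyps(2)
      by (metis constant_degree nat.distinct(1))
    then obtain q where q: "p = [:-c, 1:] * q" by (metis poly_eq_0_iff_dvd dvdE)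
    have "q \<noteq> 0" using q Suc.prems by auto
    then have deg: "degree p = Suc (degree q)" unfolding q by (subst degree_mult_eq) auto
    obtain cs a where "length cs = degree q" "a \<noteq> 0"
      "\<forall>z. poly_act f q z = foldr (lin_factor f) cs (cmul a z)"
      using Suc.hyps(1)[of q] Suc.hyps(2) deg \<open>q \<noteq> 0\<close> by auto
    then show ?case
      by (intro exI[of _ "c # cs"] exI[of _ a]) (use deg in \<open>simp add: q poly_act_lin_factor del: mult_pCons_left\<close>)
  qed
  then show ?thesis using that by blast
qed

section \<open>Annihilating products along an orbit, and the set of eigenvalues\<close>

lemma cext_power: "(cext f ^^ i) z = ((f ^^ i) (fst z), (f ^^ i) (snd z))"
  by (induction i) (simp_all add: cext_def)

text \<open>If the points of the orbit are distinct, there are more of them than the dimension. If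
  they are not, counting the set of points fails, but a coincidence
  \<open>(f ^^ i) x = (f ^^ j) x\<close> is itself a relation.\<close>

lemma orbit_relation:
  obtains a :: "nat \<Rightarrow> real" where "\<exists>i\<le>DIM('v). a i \<noteq> 0"
    "(\<Sum>i\<le>DIM('v). a i *\<^sub>R (f ^^ i) x) = 0"
proof (cases "inj_on (\<lambda>i. (f ^^ i) x) {..DIM('v)}")
  case True
  define B where "B = (\<lambda>i. (f ^^ i) x) ` {..DIM('v)}"
  have fin: "finite B" and "card B = Suc (DIM('v))"
    by (simp_all add: B_def card_image[OF True])
  then have "dependent B" by (intro dependent_biggerset) auto
  then obtain u v where u: "v \<in> B" "u v \<noteq> 0" "(\<Sum>v\<in>B. u v *\<^sub>R v) = 0"
    using dependent_finite[OF fin] by auto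
  show ?thesis
  proof (rule that[of "\<lambda>i. u ((f ^^ i) x)"])
    show "\<exists>i\<le>DIM('v). u ((f ^^ i) x) \<noteq> 0" using u by (auto simp: B_def)
    show "(\<Sum>i\<le>DIM('v). u ((f ^^ i) x) *\<^sub>R (f ^^ i) x) = 0"
      using u(3) unfolding B_def by (subst (asm) sum.reindex[OF True]) simp
  qed
next
  case False
  then obtain i j where ij: "i \<le> DIM('v)" "j \<le> DIM('v)" "i \<noteq> j" "(f ^^ i) x = (f ^^ j) x"
    by (auto simp: inj_on_def)
  define a where "a k = (if k = i then 1 else if k = j then -1 else 0 :: real)" for k
  have "(\<Sum>k\<le>DIM('v). a k *\<^sub>R (f ^^ k) x) = (\<Sum>k\<in>{i, j}. a k *\<^sub>R (f ^^ k) x)"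
    by (rule sum.mono_neutral_right) (use ij in \<open>auto simp: a_def\<close>)
  also have "\<dots> = 0" using ij by (simp add: a_def)
  finally have "(\<Sum>k\<le>DIM('v). a k *\<^sub>R (f ^^ k) x) = 0" .
  moreover have "\<exists>k\<le>DIM('v). a k \<noteq> 0" using ij(1) by (intro exI[of _ i]) (simp add: a_def)
  ultimately show ?thesis using that by blast
qed

text \<open>The relation is a real one between vectors of \<open>V\<close>. Starting from the real
  vector \<open>(x, 0)\<close> therefore keeps the number of factors at most \<open>DIM('v)\<close>,
  although \<open>V \<times> V\<close> has twice this real dimension.\<close>

lemma orbit_killed:
  obtains cs where "length cs \<le> DIM('v)" "foldr (lin_factor f) cs (x, 0) = 0"
proof -
  obtain a :: "nat \<Rightarrow> real" where a: "\<exists>i\<le>DIM('v). a i \<noteq> 0" "(\<Sum>i\<le>DIM('v). a i *\<^sub>R (f ^^ i) x) = 0"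
    by (rule orbit_relation)
  define p where "p = (\<Sum>i\<le>DIM('v). monom (complex_of_real (a i)) i)"
  have coeff: "coeff p i = (if i \<le> DIM('v) then complex_of_real (a i) else 0)" for i
    by (simp add: p_def coeff_sum)
  have "p \<noteq> 0" using a(1) coeff by (metis coeff_0 of_real_eq_0_iff)
  have deg: "degree p \<le> DIM('v)" by (intro degree_le) (simp add: coeff)
  have zero: "(f ^^ i) 0 = 0" for i by (induction i) (simp_all add: f.zero)
  have "poly_act f p (x, 0) = (\<Sum>i\<le>DIM('v). (a i *\<^sub>R (f ^^ i) x, 0))"
    by (simp add: p_def poly_act_sum poly_act_monom cext_power zero cmul_def)
  also have "\<dots> = 0" using a(2) by (simp add: prod_eq_iff fst_sum snd_sum)
  finally have 0: "poly_act f p (x, 0) = 0" .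
  obtain cs b where cs: "length cs = degree p" "b \<noteq> 0"
    "\<And>z. poly_act f p z = foldr (lin_factor f) cs (cmul b z)"
    using poly_act_factorization[OF \<open>p \<noteq> 0\<close>] by metis
  have "cmul b (foldr (lin_factor f) cs (x, 0)) = 0"
    using 0 cs(3) foldr_lin_factor_cmul by metis
  then have "foldr (lin_factor f) cs (x, 0) = 0" using cs(2) by (simp add: cmul_eq_0_iff)
  then show ?thesis using that[of cs] cs(1) deg by simp
qed

text \<open>Every factor of a shortest annihilating product contributes an eigenvalue.\<close>

lemma orbit_killed_eigenvalues:
  obtains cs where "length cs \<le> DIM('v)" "foldr (lin_factor f) cs (x, 0) = 0"
    "\<And>c. c \<in> set cs \<Longrightarrow> complex_eigenvalue f c"
proof -
  define Q where "Q n \<longleftrightarrow> (\<exists>cs. length cs = n \<and> foldr (lin_factor f) cs (x, 0) = 0)" for n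
  obtain cs0 where cs0: "length cs0 \<le> DIM('v)" "foldr (lin_factor f) cs0 (x, 0) = 0"
    by (rule orbit_killed)
  then have Q: "Q (length cs0)" by (auto simp: Q_def)
  obtain cs where cs: "length cs = (LEAST n. Q n)" "foldr (lin_factor f) cs (x, 0) = 0"
    using LeastI[of Q, OF Q] by (auto simp: Q_def)
  have "length cs \<le> DIM('v)" using Least_le[of Q, OF Q] cs0 cs by simp
  moreover have "complex_eigenvalue f c" if c: "c \<in> set cs" for c
  proof -
    obtain us vs where split: "cs = us @ c # vs" using split_list[OF c] by metis
    \<comment> \<open>By minimality the other factors alone do not annihilate \<open>(x, 0)\<close>;
      since all factors commute, the omitted one kills \<open>w\<close>, which is thus an
      eigenvector for \<open>c\<close>.\<close>
    define w where "w = foldr (lin_factor f) (us @ vs) (x, 0)"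
    have "w \<noteq> 0"
    proof
      assume "w = 0"
      then have "Q (length (us @ vs))" by (metis Q_def w_def)
      then show False using Least_le[of Q] cs(1) split by fastforce
    qed
    moreover have "lin_factor f c w = 0"
      using cs(2) by (simp add: split w_def foldr_lin_factor_commute)
    ultimately show ?thesis unfolding complex_eigenvalue_iff_cext lin_factor_def by (metis eq_iff_diff_eq_0)
  qed
  ultimately show ?thesis using that cs(2) by blast
qed

text \<open>A product that annihilates a nonzero vector has at least one factor. With finiteness of
  the set of eigenvalues, this makes the \<open>Max\<close> in \<open>spectral_radius\<close>
  meaningful.\<close>

lemma complex_eigenvalue_exists: "\<exists>c. complex_eigenvalue f c"
proof -
  obtain x :: 'v where "x \<noteq> 0" using nonempty_Basis nonzero_Basis by blast
  obtain cs where cs: "length cs \<le> DIM('v)" "foldr (lin_factor f) cs (x, 0) = 0"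
    "\<And>c. c \<in> set cs \<Longrightarrow> complex_eigenvalue f c"
    using orbit_killed_eigenvalues[of x] by metis
  have "cs \<noteq> []" using cs(2) \<open>x \<noteq> 0\<close> by (auto simp: zero_prod_def)
  then show ?thesis using cs(3) by (meson last_in_set)
qed

text \<open>The annihilating lists of all basis vectors, concatenated, annihilate the whole
  complexification. On an eigenvector for \<open>c\<close> the product acts as the scalar
  \<open>\<Prod>d\<leftarrow>cs. c - d\<close>, so \<open>c\<close> must occur in the list.\<close>

lemma finite_complex_eigenvalues: "finite {c. complex_eigenvalue f c}"
proof -
  have "\<exists>cs. foldr (lin_factor f) cs (b, 0) = 0" for b
    using orbit_killed[of b] by metis
  then have "\<exists>C. \<forall>b. foldr (lin_factor f) (C b) (b, 0) = 0" by (intro choice allI)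
  then obtain C where C: "\<And>b. foldr (lin_factor f) (C b) (b, 0) = 0" by blast
  obtain bs :: "'v list" where bs: "set bs = Basis" using finite_list[OF finite_Basis] by blast
  define cs where "cs = concat (map C bs)"
  have kill: "foldr (lin_factor f) cs (b, 0) = 0" if b: "b \<in> Basis" for b
  proof -
    obtain us vs where "bs = us @ b # vs" using split_list[of b bs] b bs by metis
    then have "foldr (lin_factor f) cs (b, 0) = foldr (lin_factor f) (concat (map C us))
        (foldr (lin_factor f) (C b) (foldr (lin_factor f) (concat (map C vs)) (b, 0)))"
      by (simp add: cs_def)
    also have "\<dots> = 0"
      by (subst foldr_lin_factor_swap) (simp add: C foldr_lin_factor_0)
    finally show ?thesis .
  qed
  have add: "foldr (lin_factor f) cs (z + w) = foldr (lin_factor f) cs z + foldr (lin_factor f) cs w" for z w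
    by (induction cs) (simp_all add: lin_factor_def cext_add cmul_add)
  have kill_sum: "foldr (lin_factor f) cs (\<Sum>b\<in>B. cmul (h b) (b, 0)) = 0" if "B \<subseteq> Basis" for h B
    using finite_subset[OF that finite_Basis] that
    by (induction B rule: finite_induct) (simp_all add: foldr_lin_factor_0 add foldr_lin_factor_cmul kill)
  have decomp: "z = (\<Sum>b\<in>Basis. cmul (Complex (fst z \<bullet> b) (snd z \<bullet> b)) (b, 0))" for z :: "'v \<times> 'v"
    by (rule prod_eqI) (simp_all add: fst_sum snd_sum cmul_def euclidean_representation)
  have kill_all: "foldr (lin_factor f) cs z = 0" for z
    using kill_sum[OF subset_refl, of "\<lambda>b. Complex (fst z \<bullet> b) (snd z \<bullet> b)"]
    unfolding decomp[of z, symmetric] .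
  have "c \<in> set cs" if ev: "complex_eigenvalue f c" for c
  proof -
    obtain z where z: "z \<noteq> 0" "cext f z = cmul c z" using ev complex_eigenvalue_iff_cext by blast
    have "foldr (lin_factor f) ds z = cmul (\<Prod>d\<leftarrow>ds. c - d) z" for ds
    proof (induction ds)
      case (Cons d ds)
      have "lin_factor f d z = cmul (c - d) z" by (simp add: lin_factor_def z cmul_diff_left)
      with Cons show ?case by (simp add: lin_factor_cmul cmul_cmul mult.commute)
    qed simp
    then have "cmul (\<Prod>d\<leftarrow>cs. c - d) z = 0" using kill_all[of z] by simp
    then have "(\<Prod>d\<leftarrow>cs. c - d) = 0" using z by (simp add: cmul_eq_0_iff)
    then show ?thesis by (auto simp: prod_list_zero_iff)
  qed
  then have "{c. complex_eigenvalue f c} \<subseteq> set cs" by blast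
  then show ?thesis by (rule finite_subset) simp
qed

lemma spectral_radius_ge_iff: "r \<le> spectral_radius f \<longleftrightarrow> (\<exists>c. complex_eigenvalue f c \<and> r \<le> cmod c)"
proof -
  have "finite {cmod c |c. complex_eigenvalue f c}" "{cmod c |c. complex_eigenvalue f c} \<noteq> {}"
    using finite_complex_eigenvalues complex_eigenvalue_exists by auto
  then show ?thesis unfolding spectral_radius_def by (subst Max_ge_iff) auto
qed

text \<open>Expanding the product of the factors \<open>f - c\<close> gives
  \<open>2 ^ length cs\<close> terms. Apart from the pure power of \<open>f\<close>, each contains
  some \<open>c\<close> of modulus at most \<open>\<epsilon>\<close>, and everything else in it is a
  contraction because \<open>\<epsilon> \<le> 1\<close>.\<close>

lemma norm_foldr_lin_factor:
  assumes contr: "\<And>x. norm (f x) \<le> norm x" and \<epsilon>: "\<epsilon> \<le> 1" "\<And>c. c \<in> set cs \<Longrightarrow> cmod c \<le> \<epsilon>"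
    and "0 \<le> \<epsilon>"
  shows "norm (foldr (lin_factor f) cs z - (cext f ^^ length cs) z) \<le> (2 ^ length cs - 1) * \<epsilon> * norm z"
  using \<epsilon>(2)
proof (induction cs)
  case Nil
  then show ?case by simp
next
  case (Cons c cs)
  have contr2: "norm (cext f w) \<le> norm w" for w
    by (cases w) (auto simp: cext_def norm_Pair intro!: add_mono power_mono contr)
  define w where "w = foldr (lin_factor f) cs z"
  define v where "v = (cext f ^^ length cs) z"
  define k :: real where "k = 2 ^ length cs"
  have v: "norm v \<le> norm z"
  proof -
    have "norm ((cext f ^^ k) z) \<le> norm z" for k
      by (induction k) (auto intro: order_trans[OF contr2])
    then show ?thesis by (simp add: v_def)
  qed
  have IH: "norm (w - v) \<le> (k - 1) * \<epsilon> * norm z"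
    using Cons by (simp add: w_def v_def k_def)
  have "k \<ge> 1" by (simp add: k_def)
  have "norm w \<le> norm (w - v) + norm v" by (metis norm_triangle_sub add.commute)
  also have "\<dots> \<le> (k - 1) * \<epsilon> * norm z + norm z" using IH v by simp
  also have "\<dots> \<le> (k - 1) * 1 * norm z + norm z"
    using \<open>k \<ge> 1\<close> \<epsilon>(1) by (intro add_mono mult_right_mono mult_left_mono) auto
  finally have w: "norm w \<le> k * norm z" by (simp add: algebra_simps)
  have "norm (foldr (lin_factor f) (c # cs) z - (cext f ^^ length (c # cs)) z)
      = norm (cext f (w - v) - cmul c w)"
    by (simp add: lin_factor_def w_def v_def cext_diff algebra_simps)
  also have "\<dots> \<le> norm (w - v) + cmod c * norm w"
    using norm_triangle_ineq4[of "cext f (w - v)" "cmul c w"] contr2[of "w - v"] by (simp add: norm_cmul)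
  also have "\<dots> \<le> (k - 1) * \<epsilon> * norm z + \<epsilon> * (k * norm z)"
    using IH w Cons.prems[of c] \<open>0 \<le> \<epsilon>\<close> by (intro add_mono mult_mono) auto
  also have "\<dots> = (2 ^ length (c # cs) - 1) * \<epsilon> * norm z" by (simp add: k_def algebra_simps)
  finally show ?case .
qed

text \<open>For a product of eigenvalue factors that annihilates \<open>x\<close>, the preceding
  estimate bounds the power of \<open>f\<close> itself. The list may be shorter than
  \<open>DIM('v)\<close>; the missing applications of \<open>f\<close> only contract.\<close>

lemma norm_power_le_of_small_eigenvalues:
  assumes contr: "\<And>x. norm (f x) \<le> norm x" and "\<epsilon> \<le> 1" "0 \<le> \<epsilon>"
    and ev: "\<And>c. complex_eigenvalue f c \<Longrightarrow> cmod c \<le> \<epsilon>"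
  shows "norm ((f ^^ DIM('v)) x) \<le> 2 ^ DIM('v) * \<epsilon> * norm x"
proof -
  obtain cs where cs: "length cs \<le> DIM('v)" "foldr (lin_factor f) cs (x, 0) = 0"
    "\<And>c. c \<in> set cs \<Longrightarrow> complex_eigenvalue f c"
    using orbit_killed_eigenvalues[of x] by metis
  have zero: "(f ^^ i) 0 = 0" for i by (induction i) (simp_all add: f.zero)
  have "norm ((f ^^ length cs) x) \<le> (2 ^ length cs - 1) * \<epsilon> * norm x"
    using norm_foldr_lin_factor[OF contr \<open>\<epsilon> \<le> 1\<close> _ \<open>0 \<le> \<epsilon>\<close>, of cs "(x, 0)"] cs ev
    by (simp add: cext_power zero norm_Pair)
  also have "\<dots> \<le> 2 ^ DIM('v) * \<epsilon> * norm x"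
  proof (intro mult_right_mono \<open>0 \<le> \<epsilon>\<close> norm_ge_zero)
    show "(2::real) ^ length cs - 1 \<le> 2 ^ DIM('v)"
      using power_increasing[OF cs(1), of "2::real"] by linarith
  qed
  finally have *: "norm ((f ^^ length cs) x) \<le> 2 ^ DIM('v) * \<epsilon> * norm x" .
  have "norm ((f ^^ k) y) \<le> norm y" for k y
    by (induction k) (auto intro: order_trans[OF contr])
  from this[of "DIM('v) - length cs" "(f ^^ length cs) x"] * cs(1)
  show ?thesis by (metis funpow_add le_add_diff_inverse2 o_apply order_trans)
qed

end

section \<open>Scaling and semicontinuity of the spectral radius\<close>

lemma complex_eigenvalue_scale:
  assumes "complex_eigenvalue (\<lambda>x. t *\<^sub>R f x) c" "t \<noteq> 0"
  shows "complex_eigenvalue f (c / of_real t)"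
proof -
  obtain z where z: "z \<noteq> 0" "cext (\<lambda>x. t *\<^sub>R f x) z = cmul c z"
    using assms complex_eigenvalue_iff_cext by blast
  have "cext f z = cmul (of_real (1 / t)) (cext (\<lambda>x. t *\<^sub>R f x) z)"
    using \<open>t \<noteq> 0\<close> by (simp add: cext_def cmul_def)
  also have "\<dots> = cmul (c / of_real t) z" by (simp add: z cmul_cmul)
  finally show ?thesis using z complex_eigenvalue_iff_cext by blast
qed

text \<open>Unit eigenvectors with eigenvalues of modulus at least \<open>r\<close> have a
  convergent subsequence, the eigenvalues being bounded by the norms of the maps. The limit is an
  eigenvector of the limit map. This upper semicontinuity is what makes the spectral radius Borel
  measurable.\<close>

lemma closed_spectral_radius_ge:
  "closed {g :: 'v::euclidean_space \<Rightarrow>\<^sub>L 'v. r \<le> spectral_radius (blinfun_apply g)}"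
  unfolding closed_sequential_limits
proof (intro allI impI, elim conjE)
  fix g :: "nat \<Rightarrow> 'v \<Rightarrow>\<^sub>L 'v" and l
  assume ge: "\<forall>n. g n \<in> {g. r \<le> spectral_radius (blinfun_apply g)}" and lim: "g \<longlonglongrightarrow> l"
  have lin: "linear (blinfun_apply h)" for h :: "'v \<Rightarrow>\<^sub>L 'v"
    by (simp add: blinfun.bounded_linear_right bounded_linear.linear)
  have "\<exists>c z. norm z = 1 \<and> cext (g n) z = cmul c z \<and> r \<le> cmod c" for n
  proof -
    obtain c where c: "complex_eigenvalue (g n) c" "r \<le> cmod c"
      using ge spectral_radius_ge_iff[OF lin, of r "g n"] by blast
    then obtain w where w: "w \<noteq> 0" "cext (g n) w = cmul c w"
      unfolding complex_eigenvalue_iff_cext by blast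
    define z where "z = cmul (of_real (1 / norm w)) w"
    have "norm z = 1" using w by (simp add: z_def norm_cmul norm_divide)
    moreover have "cext (g n) z = cmul c z"
      unfolding z_def cext_cmul[OF lin] w by (simp add: cmul_cmul mult.commute)
    ultimately show ?thesis using c by blast
  qed
  then obtain c z where cz: "\<And>n. norm (z n) = 1" "\<And>n. cext (g n) (z n) = cmul (c n) (z n)" "\<And>n. r \<le> cmod (c n)"
    by metis
  obtain R where R: "\<And>n. norm (g n) \<le> R"
    using convergent_imp_bounded[OF lim] by (auto simp: bounded_iff)
  have "cmod (c n) \<le> R" for n
  proof -
    have "cmod (c n) = norm (cext (g n) (z n))" by (simp add: cz norm_cmul)
    also have "\<dots> \<le> norm (g n) * norm (z n)"
    proof -
      have "(norm (cext (g n) (z n)))\<^sup>2 \<le> (norm (g n) * norm (fst (z n)))\<^sup>2 + (norm (g n) * norm (snd (z n)))\<^sup>2"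
        unfolding cext_def norm_Pair by (simp add: add_mono power_mono norm_blinfun)
      also have "\<dots> = (norm (g n) * norm (z n))\<^sup>2"
        by (cases "z n") (simp add: norm_Pair power_mult_distrib algebra_simps)
      finally show ?thesis by (rule power2_le_imp_le) simp
    qed
    finally show ?thesis using cz(1) R[of n] by simp
  qed
  then have "\<forall>n. (c n, z n) \<in> cball 0 R \<times> sphere 0 1" using cz(1) by simp
  moreover have "compact (cball 0 R \<times> sphere 0 1 :: (complex \<times> 'v \<times> 'v) set)" by (intro compact_Times) auto
  ultimately obtain p s where ps: "p \<in> cball 0 R \<times> sphere 0 1" "strict_mono s"
    "((\<lambda>n. (c n, z n)) \<circ> s) \<longlonglongrightarrow> p"
    by (meson compact_def)
  obtain c0 z0 where p: "p = (c0, z0)" by (cases p)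
  have s: "strict_mono s" "(\<lambda>n. (c (s n), z (s n))) \<longlonglongrightarrow> (c0, z0)" "norm z0 = 1"
    using ps by (simp_all add: p o_def)
  have cl: "(\<lambda>n. c (s n)) \<longlonglongrightarrow> c0" and zl: "(\<lambda>n. z (s n)) \<longlonglongrightarrow> z0"
    using tendsto_fst[OF s(2)] tendsto_snd[OF s(2)] by simp_all
  have gl: "(\<lambda>n. g (s n)) \<longlonglongrightarrow> l" using LIMSEQ_subseq_LIMSEQ[OF lim s(1)] by (simp add: o_def)
  have "(\<lambda>n. cext (g (s n)) (z (s n))) \<longlonglongrightarrow> cext l z0"
    unfolding cext_def by (intro tendsto_intros gl zl blinfun.tendsto)
  moreover have "(\<lambda>n. cmul (c (s n)) (z (s n))) \<longlonglongrightarrow> cmul c0 z0"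
    unfolding cmul_def by (intro tendsto_intros cl zl)
  ultimately have "cext l z0 = cmul c0 z0" unfolding cz(2) by (rule LIMSEQ_unique)
  moreover have "r \<le> cmod c0" by (rule LIMSEQ_le_const[OF tendsto_norm[OF cl]]) (use cz(3) in auto)
  moreover have "z0 \<noteq> 0" using s(3) by auto
  ultimately show "l \<in> {g. r \<le> spectral_radius (blinfun_apply g)}"
    using spectral_radius_ge_iff[OF lin, of r l] complex_eigenvalue_iff_cext[of l c0] by blast
qed

section \<open>Weak sequential compactness on compact sets\<close>

text \<open>Schoenberg's space-filling curve: on a number whose base-3 digits are all \<open>0\<close> or \<open>2\<close>, the
  wave applied to \<open>3 ^ k * t\<close> reads off digit \<open>k\<close>, and the coordinates use interleaved digits.\<close>

definition schoenberg_wave :: "real \<Rightarrow> real" where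
  "schoenberg_wave u = max 0 (min 1 (1 / 2 - cos (pi * u)))"

lemma continuous_schoenberg_wave: "continuous_on A schoenberg_wave"
  unfolding schoenberg_wave_def by (intro continuous_intros)

lemma schoenberg_wave_bounds: "0 \<le> schoenberg_wave u" "schoenberg_wave u \<le> 1"
  by (auto simp: schoenberg_wave_def)

lemma schoenberg_wave_periodic: "schoenberg_wave (2 * real n + u) = schoenberg_wave u"
proof -
  have "pi * (2 * real n + u) = 2 * real n * pi + pi * u" by (simp add: algebra_simps)
  then have "cos (pi * (2 * real n + u)) = cos (pi * u)"
    by (simp only: cos_add cos_2npi sin_2npi)
  then show ?thesis by (simp add: schoenberg_wave_def)
qed

definition ternary :: "(nat \<Rightarrow> nat) \<Rightarrow> real" where
  "ternary A = (\<Sum>m. 2 * real (A m) / 3 ^ Suc m)"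

context
  fixes A :: "nat \<Rightarrow> nat"
  assumes digits: "\<And>m. A m \<le> 1"
begin

lemma sums_two_thirds: "(\<lambda>m. 2 / 3 ^ Suc m :: real) sums 1"
proof -
  have "(\<lambda>m. (2 / 3) * (1 / 3) ^ m :: real) sums ((2 / 3) * (1 / (1 - 1 / 3)))"
    by (intro sums_mult geometric_sums) auto
  then show ?thesis by (simp add: power_one_over)
qed

lemma ternary_term_le: "2 * real (A m) / 3 ^ Suc m \<le> 2 / 3 ^ Suc m"
  using digits[of m] by (simp add: divide_right_mono)

lemma summable_ternary: "summable (\<lambda>m. 2 * real (A m) / 3 ^ Suc m)"
  by (rule summable_comparison_test'[OF sums_summable[OF sums_two_thirds], of 0])
    (use ternary_term_le in auto)

lemma ternary_bounds: "0 \<le> ternary A" "ternary A \<le> 1"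
proof -
  show "0 \<le> ternary A" unfolding ternary_def by (rule suminf_nonneg[OF summable_ternary]) simp
  have "ternary A \<le> (\<Sum>m. 2 / 3 ^ Suc m)" unfolding ternary_def
    by (rule suminf_le[OF ternary_term_le summable_ternary sums_summable[OF sums_two_thirds]])
  then show "ternary A \<le> 1" using sums_unique[OF sums_two_thirds] by simp
qed

lemma ternary_step: "3 * ternary A = 2 * real (A 0) + ternary (\<lambda>m. A (Suc m))"
proof -
  have "ternary A = 2 * real (A 0) / 3 + (\<Sum>m. 2 * real (A (Suc m)) / 3 ^ Suc (Suc m))"
    unfolding ternary_def using suminf_split_head[OF summable_ternary] by simp
  also have "(\<Sum>m. 2 * real (A (Suc m)) / 3 ^ Suc (Suc m)) = (\<Sum>m. 1 / 3 * (2 * real (A (Suc m)) / 3 ^ Suc m))"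
    by simp
  also have "\<dots> = 1 / 3 * ternary (\<lambda>m. A (Suc m))" unfolding ternary_def
  proof (rule suminf_mult)
    have "summable (\<lambda>m. 3 * (2 * real (A (Suc m)) / 3 ^ Suc (Suc m)))"
      using summable_ternary by (intro summable_mult) (subst summable_Suc_iff)
    then show "summable (\<lambda>m. 2 * real (A (Suc m)) / 3 ^ Suc m)" by simp
  qed
  finally show ?thesis by simp
qed

end

text \<open>The tail of the expansion lies in \<open>[0, 1]\<close>, so a leading digit
  \<open>0\<close> puts the number into \<open>[0, 1/3]\<close>, where the wave is \<open>0\<close>,
  and a leading digit \<open>2\<close> into \<open>[2/3, 1]\<close>, where it is \<open>1\<close>.
  Multiplication by a power of 3 turns the earlier digits into an even integer, which the period 2
  of the wave removes.\<close>

lemma schoenberg_wave_ternary: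
  assumes "\<And>m. A m \<le> (1::nat)"
  shows "schoenberg_wave (3 ^ k * ternary A) = real (A k)"
  using assms
proof (induction k arbitrary: A)
  case 0
  define r where "r = ternary A"
  define r' where "r' = ternary (\<lambda>m. A (Suc m))"
  have r: "3 * r = 2 * real (A 0) + r'" "0 \<le> r'" "r' \<le> 1"
    using ternary_step[of A] ternary_bounds[of "\<lambda>m. A (Suc m)"] 0 by (auto simp: r_def r'_def)
  consider "A 0 = 0" | "A 0 = 1" using 0[of 0] by linarith
  then have "schoenberg_wave r = real (A 0)"
  proof cases
    case 1
    then have "0 \<le> r" "r \<le> 1 / 3" using r by auto
    then have "cos (pi / 3) \<le> cos (pi * r)"
      by (intro cos_monotone_0_pi_le) (auto simp: field_simps)
    then show ?thesis using 1 by (simp add: schoenberg_wave_def cos_60)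
  next
    case 2
    then have "2 / 3 \<le> r" "r \<le> 1" using r by auto
    then have "cos (pi * r) \<le> cos (2 * pi / 3)"
      by (intro cos_monotone_0_pi_le) (auto simp: field_simps)
    then show ?thesis using 2 by (simp add: schoenberg_wave_def cos_120)
  qed
  then show ?case by (simp add: r_def)
next
  case (Suc k)
  have "3 ^ Suc k * ternary A = 3 ^ k * (3 * ternary A)" by simp
  also have "\<dots> = 2 * real (3 ^ k * A 0) + 3 ^ k * ternary (\<lambda>m. A (Suc m))"
    unfolding ternary_step[of A, OF Suc.prems] by (simp add: algebra_simps)
  finally show ?case using Suc by (simp only: schoenberg_wave_periodic)
qed

lemma binary_expansion:
  fixes y :: real
  assumes "0 \<le> y" "y < 1"
  obtains d :: "nat \<Rightarrow> nat" where "\<And>k. d k \<le> 1" "(\<lambda>k. real (d k) / 2 ^ Suc k) sums y"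
proof -
  define z where "z n = \<lfloor>2 ^ n * y\<rfloor>" for n :: nat
  define d where "d k = nat (z (Suc k) - 2 * z k)" for k
  have z: "2 * z k \<le> z (Suc k)" "z (Suc k) \<le> 2 * z k + 1" for k
    unfolding z_def power_Suc by linarith+
  have z0: "z 0 = 0" using assms by (simp add: z_def floor_eq_iff)
  \<comment> \<open>Telescoping, since \<open>z (Suc n) = 2 * z n + d n\<close>; it starts at
    \<open>z 0 = 0\<close> because \<open>y < 1\<close>.\<close>
  have part: "(\<Sum>k<n. real (d k) / 2 ^ Suc k) = real_of_int (z n) / 2 ^ n" for n
    by (induction n) (use z in \<open>auto simp: z0 d_def field_simps\<close>)
  have "(\<lambda>n. real_of_int (z n) / 2 ^ n) \<longlonglongrightarrow> y"
  proof (rule tendsto_sandwich[of "\<lambda>n. y - (1 / 2) ^ n" _ _ "\<lambda>n. y"])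
    show "\<forall>\<^sub>F n in sequentially. y - (1 / 2) ^ n \<le> real_of_int (z n) / 2 ^ n"
    proof (intro always_eventually allI)
      fix n
      have "2 ^ n * y - 1 \<le> real_of_int (z n)" unfolding z_def by linarith
      then have "(2 ^ n * y - 1) / 2 ^ n \<le> real_of_int (z n) / 2 ^ n" by (rule divide_right_mono) simp
      then show "y - (1 / 2) ^ n \<le> real_of_int (z n) / 2 ^ n" by (simp add: diff_divide_distrib power_one_over)
    qed
    show "\<forall>\<^sub>F n in sequentially. real_of_int (z n) / 2 ^ n \<le> y"
    proof (intro always_eventually allI)
      fix n
      have "real_of_int (z n) \<le> 2 ^ n * y" unfolding z_def by linarith
      then show "real_of_int (z n) / 2 ^ n \<le> y" by (simp add: field_simps)
    qed
    show "(\<lambda>n. y - (1 / 2) ^ n) \<longlonglongrightarrow> y"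
      using tendsto_diff[OF tendsto_const LIMSEQ_power_zero[of "1/2 :: real"]] by simp
  qed simp
  then have "(\<lambda>k. real (d k) / 2 ^ Suc k) sums y" unfolding sums_def part .
  moreover have "d k \<le> 1" for k using z(2)[of k] by (simp add: d_def)
  ultimately show ?thesis using that by blast
qed

definition schoenberg_coord :: "nat \<Rightarrow> nat \<Rightarrow> real \<Rightarrow> real" where
  "schoenberg_coord D i t = (\<Sum>k. schoenberg_wave (3 ^ (k * D + i) * t) / 2 ^ Suc k)"

lemma continuous_schoenberg_coord: "continuous_on UNIV (schoenberg_coord D i)"
proof -
  have sums: "(\<lambda>k. 1 / 2 ^ Suc k :: real) sums 1" using power_half_series by (simp add: power_one_over)
  have "uniform_limit UNIV (\<lambda>n t. \<Sum>k<n. schoenberg_wave (3 ^ (k * D + i) * t) / 2 ^ Suc k) (schoenberg_coord D i) sequentially"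
    unfolding schoenberg_coord_def
    by (rule Weierstrass_m_test[OF _ sums_summable[OF sums]])
      (use schoenberg_wave_bounds in \<open>simp add: divide_right_mono\<close>)
  moreover have "continuous_on UNIV (\<lambda>t. \<Sum>k<n. schoenberg_wave (3 ^ (k * D + i) * t) / 2 ^ Suc k)" for n
    by (intro continuous_on_sum continuous_on_divide continuous_on_const
        continuous_on_compose2[OF continuous_schoenberg_wave[of UNIV]] continuous_on_mult_left continuous_on_id) auto
  ultimately show ?thesis
    by (intro uniform_limit_theorem[where F=sequentially]) (auto intro: always_eventually)
qed

lemma schoenberg_coord_surj:
  fixes y :: "nat \<Rightarrow> real"
  assumes y: "\<And>i. i < D \<Longrightarrow> 0 \<le> y i \<and> y i < 1" and "0 < D"
  obtains t where "0 \<le> t" "t \<le> 1" "\<And>i. i < D \<Longrightarrow> schoenberg_coord D i t = y i"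
proof -
  have "\<exists>d :: nat \<Rightarrow> nat. i < D \<longrightarrow> (\<forall>k. d k \<le> 1) \<and> (\<lambda>k. real (d k) / 2 ^ Suc k) sums y i" for i
    using y binary_expansion[of "y i"] by metis
  then have "\<exists>d :: nat \<Rightarrow> nat \<Rightarrow> nat. \<forall>i. i < D \<longrightarrow> (\<forall>k. d i k \<le> 1) \<and> (\<lambda>k. real (d i k) / 2 ^ Suc k) sums y i"
    by (intro choice allI)
  then obtain d :: "nat \<Rightarrow> nat \<Rightarrow> nat" where d:
    "\<And>i k. i < D \<Longrightarrow> d i k \<le> 1" "\<And>i. i < D \<Longrightarrow> (\<lambda>k. real (d i k) / 2 ^ Suc k) sums y i"
    by blast
  \<comment> \<open>Interleaving: position \<open>k * D + i\<close> holds digit \<open>k\<close> of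
    coordinate \<open>i\<close>.\<close>
  define A where "A m = d (m mod D) (m div D)" for m
  have A: "A m \<le> 1" for m using d(1) \<open>0 < D\<close> by (simp add: A_def)
  have coord: "schoenberg_coord D i (ternary A) = y i" if "i < D" for i
    using d(2)[OF that] that by (simp add: schoenberg_coord_def schoenberg_wave_ternary[OF A] A_def sums_iff)
  show ?thesis by (rule that[OF ternary_bounds[OF A] coord])
qed

text \<open>An affine map carries the unit cube to the cube of side \<open>2 * R\<close> around the
  origin. Coordinates in the half-open interval \<open>[0, 1)\<close> are known to be reached, which
  covers the open ball.\<close>

lemma space_filling_curve:
  assumes "0 < R"
  obtains c :: "real \<Rightarrow> 'v::euclidean_space" where "continuous_on UNIV c" "ball 0 R \<subseteq> c ` {0..1}"
proof -
  obtain e :: "'v \<Rightarrow> nat" where e: "bij_betw e Basis {0..<DIM('v)}"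
    using ex_bij_betw_finite_nat[OF finite_Basis] by blast
  define c :: "real \<Rightarrow> 'v" where
    "c t = (\<Sum>b\<in>Basis. (2 * R * schoenberg_coord DIM('v) (e b) t - R) *\<^sub>R b)" for t
  have "continuous_on UNIV c" unfolding c_def
    by (intro continuous_intros continuous_schoenberg_coord)
  moreover have "x \<in> c ` {0..1}" if x: "x \<in> ball 0 R" for x
  proof -
    define y where "y i = (x \<bullet> inv_into Basis e i + R) / (2 * R)" for i
    have y_e: "y (e b) = (x \<bullet> b + R) / (2 * R)" if "b \<in> Basis" for b
      using e that by (simp add: y_def bij_betw_inv_into_left)
    have "0 \<le> y i \<and> y i < 1" if "i < DIM('v)" for i
    proof -
      have "i \<in> e ` Basis" using e that by (simp add: bij_betw_def)
      then obtain b where b: "b \<in> Basis" "i = e b" by blast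
      have "\<bar>x \<bullet> b\<bar> \<le> norm x" using b by (simp add: Basis_le_norm)
      then show ?thesis using x \<open>0 < R\<close> unfolding b y_e[OF b(1)] by (auto simp: field_simps)
    qed
    then obtain t where t: "0 \<le> t" "t \<le> 1" "\<And>i. i < DIM('v) \<Longrightarrow> schoenberg_coord DIM('v) i t = y i"
      using schoenberg_coord_surj[of "DIM('v)" y] by auto
    have "c t = (\<Sum>b\<in>Basis. (x \<bullet> b) *\<^sub>R b)" unfolding c_def
    proof (rule sum.cong)
      fix b :: 'v assume b: "b \<in> Basis"
      then have "e b < DIM('v)" using e by (auto simp: bij_betw_def)
      then have "schoenberg_coord DIM('v) (e b) t = (x \<bullet> b + R) / (2 * R)" using t(3) y_e[OF b] by simp
      then show "(2 * R * schoenberg_coord DIM('v) (e b) t - R) *\<^sub>R b = (x \<bullet> b) *\<^sub>R b"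
        using \<open>0 < R\<close> by simp
    qed simp
    then have "c t = x" by (simp add: euclidean_representation)
    then show ?thesis using t by force
  qed
  ultimately show ?thesis using that by blast
qed

lemma borel_right_inverse:
  fixes c :: "real \<Rightarrow> 'v::metric_space"
  assumes c: "continuous_on UNIV c" and K: "compact K" "K \<subseteq> c ` {0..1}"
  obtains s where "s \<in> borel_measurable borel" "\<And>x. 0 \<le> s x" "\<And>x. s x \<le> 1"
    "\<And>x. x \<in> K \<Longrightarrow> c (s x) = x"
proof -
  define F where "F x = {0..1} \<inter> c -` {x}" for x
  define s where "s x = (if x \<in> K then Inf (F x) else 0)" for x
  have F: "Inf (F x) \<in> F x" if "x \<in> K" for x
  proof (rule closed_contains_Inf)
    show "F x \<noteq> {}" using K that by (auto simp: F_def)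
    show "bdd_below (F x)" by (rule bdd_belowI[of _ 0]) (auto simp: F_def)
    show "closed (F x)" unfolding F_def
      by (intro closed_Int closed_vimage c) (auto simp: continuous_on_eq_continuous_at)
  qed
  have le: "Inf (F x) \<le> t" if "t \<in> F x" for x t
    by (rule cInf_lower[OF that]) (auto intro: bdd_belowI[of _ 0] simp: F_def)
  have s01: "0 \<le> s x \<and> s x \<le> 1" for x
    using F[of x] by (auto simp: s_def F_def)
  have "s \<in> borel_measurable borel"
  proof (rule borel_measurableI_le)
    fix u :: real
    have eq: "{x. s x \<le> u} = (- K) \<union> (c ` {0..u} \<inter> K)" if "0 \<le> u" "u < 1"
    proof (intro equalityI subsetI)
      fix x assume x: "x \<in> {x. s x \<le> u}"
      show "x \<in> (- K) \<union> (c ` {0..u} \<inter> K)"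
      proof (cases "x \<in> K")
        case True
        then have "Inf (F x) \<in> {0..u}" "c (Inf (F x)) = x" using F[OF True] x by (auto simp: F_def s_def)
        then have "x \<in> c ` {0..u}" by (metis image_eqI)
        then show ?thesis using True by blast
      qed simp
    next
      fix x assume x: "x \<in> (- K) \<union> (c ` {0..u} \<inter> K)"
      show "x \<in> {x. s x \<le> u}"
      proof (cases "x \<in> K")
        case True
        then obtain t where "t \<in> {0..u}" "c t = x" using x by auto
        then have "Inf (F x) \<le> t" using that by (intro le) (auto simp: F_def)
        then show ?thesis using \<open>t \<in> {0..u}\<close> True by (simp add: s_def)
      qed (use that in \<open>simp add: s_def\<close>)
    qed
    have "compact (c ` {0..u})" by (rule compact_continuous_image) (auto intro: continuous_on_subset[OF c])
    then have meas: "(- K) \<union> (c ` {0..u} \<inter> K) \<in> sets borel"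
      using K(1) by (intro sets.Un sets.Int borel_open borel_closed) (auto intro: compact_imp_closed)
    consider "u < 0" | "0 \<le> u" "u < 1" | "1 \<le> u" by linarith
    then show "{x \<in> space borel. s x \<le> u} \<in> sets borel"
    proof cases
      case 1
      then have "{x. s x \<le> u} = {}" using s01 by (auto simp: not_le intro: less_le_trans)
      then show ?thesis by simp
    next
      case 2
      then show ?thesis using eq meas by simp
    next
      case 3
      then have "{x. s x \<le> u} = UNIV" using s01 order_trans by blast
      then show ?thesis by simp
    qed
  qed
  moreover have "c (s x) = x" if "x \<in> K" for x using F[OF that] that by (simp add: s_def F_def)
  ultimately show ?thesis using that s01 by blast
qed

text \<open>The indicator of a closed set is the limit of the continuous functions
  \<open>max 0 (1 - k * infdist x F)\<close>, and closed sets form an intersection-stable generator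
  of the Borel sets.\<close>

lemma borel_prob_measure_eqI:
  fixes p q :: "'a::metric_space measure"
  assumes p: "prob_space p" "sets p = sets borel" and q: "prob_space q" "sets q = sets borel"
    and eq: "\<And>f :: 'a \<Rightarrow> real. continuous_on UNIV f \<Longrightarrow> (\<And>x. \<bar>f x\<bar> \<le> 1) \<Longrightarrow> (\<integral>x. f x \<partial>p) = (\<integral>x. f x \<partial>q)"
  shows "p = q"
proof -
  interpret p: prob_space p by (rule p)
  interpret q: prob_space q by (rule q)
  have spaces: "space p = UNIV" "space q = UNIV"
    using sets_eq_imp_space_eq[OF p(2)] sets_eq_imp_space_eq[OF q(2)] by simp_all
  have closed_eq: "measure p F = measure q F" if F: "closed F" for F
  proof (cases "F = {}")
    case False
    define f where "f k x = max 0 (1 - real k * infdist x F)" for k x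
    have cont: "continuous_on UNIV (f k)" for k unfolding f_def by (intro continuous_intros)
    have bound: "\<bar>f k x\<bar> \<le> 1" for k x
      using infdist_nonneg[of x F] by (auto simp: f_def abs_if)
    have lim: "(\<lambda>k. f k x) \<longlonglongrightarrow> indicator F x" for x
    proof (cases "x \<in> F")
      case True
      then show ?thesis by (simp add: f_def)
    next
      case x: False
      then have pos: "infdist x F > 0"
        using F False infdist_pos_not_in_closed by (metis infdist_nonneg in_closed_iff_infdist_zero less_eq_real_def)
      have "eventually (\<lambda>k. f k x = 0) sequentially"
      proof -
        obtain K where "1 / infdist x F < real K" using reals_Archimedean2 by blast
        then have K: "1 < real K * infdist x F" using pos by (simp add: field_simps)
        have "1 \<le> real k * infdist x F" if "k \<ge> K" for k
        proof -
          have "real K * infdist x F \<le> real k * infdist x F" using that pos by (intro mult_right_mono) auto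
          then show ?thesis using K by linarith
        qed
        then show ?thesis unfolding eventually_sequentially f_def by (intro exI[of _ K]) auto
      qed
      then show ?thesis using x by (simp add: tendsto_eventually)
    qed
    have conv: "(\<lambda>k. \<integral>x. f k x \<partial>m) \<longlonglongrightarrow> measure m F"
      if m: "prob_space m" "sets m = sets borel" for m
    proof -
      interpret m: prob_space m by (rule m)
      note [measurable_cong] = m(2)
      have [measurable]: "f k \<in> borel_measurable borel" for k using cont by (rule borel_measurable_continuous_onI)
      have [measurable]: "F \<in> sets borel" using F by simp
      have "(\<lambda>k. \<integral>x. f k x \<partial>m) \<longlonglongrightarrow> (\<integral>x. indicator F x \<partial>m)"
        by (rule integral_dominated_convergence[where w="\<lambda>_. 1"]) (use lim bound in auto)
      moreover have "space m = UNIV" using sets_eq_imp_space_eq[OF m(2)] by simp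
      ultimately show ?thesis using m(2) by simp
    qed
    show ?thesis
      by (rule LIMSEQ_unique[OF conv[OF p]]) (use conv[OF q] eq[OF cont bound] in simp)
  qed simp
  show ?thesis
  proof (rule measure_eqI_generator_eq[where E="Collect closed" and \<Omega>=UNIV and A="\<lambda>_. UNIV"])
    show "Int_stable (Collect closed :: 'a set set)" by (auto simp: Int_stable_def)
    show "sets p = sigma_sets UNIV (Collect closed)" "sets q = sigma_sets UNIV (Collect closed)"
      unfolding p(2) q(2) borel_eq_closed by simp_all
    show "emeasure p X = emeasure q X" if "X \<in> Collect closed" for X
      using closed_eq that by (simp add: p.emeasure_eq_measure q.emeasure_eq_measure)
  qed (use p.emeasure_finite in auto)
qed

text \<open>A compact set is a continuous image of a compact subset of the line, along which measures
  lift by a Borel section; this reduces the claim to Helly's theorem.\<close>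

lemma prob_measures_on_compact_sequentially_compact:
  fixes \<nu> :: "nat \<Rightarrow> 'v::euclidean_space measure"
  assumes prob: "\<And>n. prob_space (\<nu> n)" and sets: "\<And>n. sets (\<nu> n) = sets borel"
    and K: "compact K" "\<And>n. AE x in \<nu> n. x \<in> K"
  obtains r \<nu>' where "strict_mono r" "prob_space \<nu>'" "sets \<nu>' = sets borel" "AE x in \<nu>'. x \<in> K"
    "\<And>f :: 'v \<Rightarrow> real. f \<in> borel_measurable borel \<Longrightarrow> continuous_on K f \<Longrightarrow>
      (\<lambda>n. \<integral>x. f x \<partial>\<nu> (r n)) \<longlonglongrightarrow> (\<integral>x. f x \<partial>\<nu>')"
proof -
  note [measurable_cong] = sets
  obtain R where "0 < R" "K \<subseteq> ball 0 R"
    using compact_imp_bounded[OF K(1)] bounded_subset_ballD[of K 0] by auto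
  then obtain c :: "real \<Rightarrow> 'v" where c: "continuous_on UNIV c" "K \<subseteq> c ` {0..1}"
    using space_filling_curve[OF \<open>0 < R\<close>] by (metis order_trans)
  obtain s where s [measurable]: "s \<in> borel_measurable borel" and s01: "\<And>x. 0 \<le> s x" "\<And>x. s x \<le> 1"
    and cs: "\<And>x. x \<in> K \<Longrightarrow> c (s x) = x"
    using borel_right_inverse[OF c(1) K(1) c(2)] by metis
  have c_meas [measurable]: "c \<in> borel_measurable borel" using c(1) by (rule borel_measurable_continuous_onI)
  \<comment> \<open>The lifted measures live on \<open>[0, 1]\<close>, so tightness is
    automatic.\<close>
  define m where "m n = distr (\<nu> n) borel s" for n
  have rd: "real_distribution (m n)" for n
    unfolding m_def real_distribution_def real_distribution_axioms_def
    by (auto intro!: prob_space.prob_space_distr[OF prob])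
  have "measure (m n) {-1<..2} = 1" for n
  proof -
    have "{-1<..2::real} \<in> sets borel" by simp
    then have "measure (m n) {-1<..2} = measure (\<nu> n) (s -` {-1<..2} \<inter> space (\<nu> n))"
      unfolding m_def by (subst measure_distr) auto
    also have "s -` {-1<..2} = UNIV" 
    proof (intro equalityI subsetI)
      show "x \<in> s -` {-1<..2}" for x using s01[of x] by simp
    qed simp
    finally show ?thesis using prob_space.prob_space[OF prob] by simp
  qed
  then have "tight m" unfolding tight_def using rd
    by (intro conjI allI impI exI[of _ "-1"] exI[of _ 2]) auto
  from tight_imp_convergent_subsubsequence[OF this, of id]
  obtain r M where r: "strict_mono r" "real_distribution M" "weak_conv_m (m \<circ> r) M"
    by (auto simp: strict_mono_id)
  interpret M: real_distribution M by fact
  define \<nu>' where "\<nu>' = distr M borel c"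
  have prob': "prob_space \<nu>'" unfolding \<nu>'_def by (rule M.prob_space_distr) simp
  have conv: "(\<lambda>n. \<integral>x. f x \<partial>\<nu> (r n)) \<longlonglongrightarrow> (\<integral>x. f x \<partial>\<nu>')"
    if f: "continuous_on UNIV f" and B: "\<And>x. \<bar>f x\<bar> \<le> B" for f :: "'v \<Rightarrow> real" and B
  proof -
    have [measurable]: "f \<in> borel_measurable borel" using f by (rule borel_measurable_continuous_onI)
    have "(\<lambda>n. integral\<^sup>L (m (r n)) (\<lambda>t. f (c t))) \<longlonglongrightarrow> integral\<^sup>L M (\<lambda>t. f (c t))"
    proof (rule weak_conv_imp_integral_bdd_continuous_conv)
      show "real_distribution (m (r n))" for n using rd by simp
      show "weak_conv_m (\<lambda>n. m (r n)) M" using r(3) by (simp add: o_def)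
      show "isCont (\<lambda>t. f (c t)) t" for t
        using continuous_on_compose2[OF f c(1)] by (simp add: continuous_on_eq_continuous_at)
      show "norm (f (c t)) \<le> B" for t using B by simp
    qed (use r in auto)
    moreover have "integral\<^sup>L (m (r n)) (\<lambda>t. f (c t)) = (\<integral>x. f x \<partial>\<nu> (r n))" for n
    proof -
      have "integral\<^sup>L (m (r n)) (\<lambda>t. f (c t)) = (\<integral>x. f (c (s x)) \<partial>\<nu> (r n))"
        unfolding m_def by (rule integral_distr) measurable
      also have "\<dots> = (\<integral>x. f x \<partial>\<nu> (r n))"
        by (rule integral_cong_AE) (use K(2)[of "r n"] cs in \<open>auto elim!: eventually_mono\<close>)
      finally show ?thesis .
    qed
    moreover have "integral\<^sup>L M (\<lambda>t. f (c t)) = (\<integral>x. f x \<partial>\<nu>')"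
      unfolding \<nu>'_def by (rule integral_distr[symmetric]) measurable
    ultimately show "(\<lambda>n. \<integral>x. f x \<partial>\<nu> (r n)) \<longlonglongrightarrow> (\<integral>x. f x \<partial>\<nu>')" by simp
  qed
  have "AE x in \<nu>'. x \<in> K"
  proof (cases "K = {}")
    case True
    then have "AE x in \<nu> 0. False" using K(2)[of 0] by simp
    then show ?thesis using prob_space.AE_False[OF prob] by simp
  next
    case False
    interpret P: prob_space \<nu>' by (rule prob')
    \<comment> \<open>A bounded continuous function that vanishes exactly on \<open>K\<close>: its
      integral is zero along the sequence, hence also for the limit.\<close>
    define f where "f x = min 1 (infdist x K)" for x
    have f: "continuous_on UNIV f" unfolding f_def by (intro continuous_intros)
    have [measurable]: "f \<in> borel_measurable borel" using f by (rule borel_measurable_continuous_onI)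
    have [measurable_cong]: "sets \<nu>' = sets borel" by (simp add: \<nu>'_def)
    have f01: "0 \<le> f x" "f x \<le> 1" for x by (auto simp: f_def infdist_nonneg)
    have "(\<integral>x. f x \<partial>\<nu> (r n)) = 0" for n
      by (rule integral_eq_zero_AE) (use K(2)[of "r n"] in \<open>auto elim!: eventually_mono simp: f_def\<close>)
    moreover have "(\<lambda>n. \<integral>x. f x \<partial>\<nu> (r n)) \<longlonglongrightarrow> (\<integral>x. f x \<partial>\<nu>')"
      by (rule conv[OF f, of 1]) (use f01 in auto)
    ultimately have "(\<integral>x. f x \<partial>\<nu>') = 0" by (simp add: LIMSEQ_const_iff)
    moreover have "integrable \<nu>' f" by (rule P.integrable_const_bound[of _ 1]) (use f01 in auto)
    ultimately have "AE x in \<nu>'. f x = 0" using f01 by (subst (asm) integral_nonneg_eq_0_iff_AE) auto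
    then show ?thesis
      by (rule eventually_mono)
        (use False compact_imp_closed[OF K(1)] in \<open>auto simp: f_def min_def in_closed_iff_infdist_zero split: if_splits\<close>)
  qed
  moreover have sets': "sets \<nu>' = sets borel" by (simp add: \<nu>'_def)
  moreover have "(\<lambda>n. \<integral>x. f x \<partial>\<nu> (r n)) \<longlonglongrightarrow> (\<integral>x. f x \<partial>\<nu>')"
    if [measurable]: "f \<in> borel_measurable borel" and f: "continuous_on K f" for f :: "'v \<Rightarrow> real"
  proof -
    obtain B where B: "0 \<le> B" "\<And>x. x \<in> K \<Longrightarrow> norm (f x) \<le> B"
      using compact_imp_bounded[OF compact_continuous_image[OF f K(1)]] unfolding bounded_pos
      by (metis image_eqI less_imp_le)
    \<comment> \<open>Continuity on \<open>K\<close> alone suffices, by a bounded extension. This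
      matters for functions built from directions on the unit sphere, which need not be continuous
      at the origin.\<close>
    obtain g where g: "continuous_on UNIV g" "\<And>x. x \<in> K \<Longrightarrow> g x = f x" "\<And>x. norm (g x) \<le> B"
      using Tietze[OF f _ B(1), of UNIV] compact_imp_closed[OF K(1)] B(2) by auto
    have [measurable]: "g \<in> borel_measurable borel" using g(1) by (rule borel_measurable_continuous_onI)
    note [measurable_cong] = sets'
    have "(\<integral>x. f x \<partial>\<nu> n) = (\<integral>x. g x \<partial>\<nu> n)" for n
      by (rule integral_cong_AE) (use K(2)[of n] g(2) in \<open>auto elim!: eventually_mono\<close>)
    moreover have "(\<integral>x. f x \<partial>\<nu>') = (\<integral>x. g x \<partial>\<nu>')"
      by (rule integral_cong_AE) (use \<open>AE x in \<nu>'. x \<in> K\<close> g(2) in \<open>auto elim!: eventually_mono\<close>)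
    ultimately show ?thesis using conv[OF g(1), of B] g(3) by simp
  qed
  ultimately show ?thesis using that[OF r(1) prob'] by blast
qed

section \<open>Convolution powers on the general linear group\<close>

text \<open>Maps with rational matrix entries form a countable dense set. Second countability makes
  composition measurable for product measures, and it later gives the topological support full
  measure.\<close>

instance blinfun :: (euclidean_space, euclidean_space) second_countable_topology
proof
  define mat :: "('a \<times> 'b \<Rightarrow> rat) \<Rightarrow> 'a \<Rightarrow>\<^sub>L 'b"
    where "mat q = blinfun_of_matrix (\<lambda>i j. of_rat (q (j, i)))" for q
  define Q where "Q = ((Basis :: 'a set) \<times> (Basis :: 'b set)) \<rightarrow>\<^sub>E (UNIV :: rat set)"
  define D where "D = mat ` Q"
  have "countable D" unfolding D_def Q_def by (intro countable_image countable_PiE) auto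
  have dense: "\<exists>d\<in>D. dist d g < e" if e: "0 < e" for g :: "'a \<Rightarrow>\<^sub>L 'b" and e
  proof -
    define \<delta> where "\<delta> = e / (2 * real (DIM('b) * DIM('a)))"
    have \<delta>: "0 < \<delta>" using e by (simp add: \<delta>_def)
    have "\<exists>q. \<bar>of_rat q - g j \<bullet> i\<bar> < \<delta>" for i :: 'b and j :: 'a
    proof -
      obtain r where "g j \<bullet> i - \<delta> < of_rat r" "of_rat r < g j \<bullet> i"
        using of_rat_dense[of "g j \<bullet> i - \<delta>" "g j \<bullet> i"] \<delta> by auto
      then show ?thesis by (intro exI[of _ r]) (simp add: abs_less_iff)
    qed
    then have "\<exists>q. \<forall>i j. \<bar>of_rat (q i j) - g j \<bullet> i\<bar> < \<delta>" by (intro choice allI)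
    then obtain q where q: "\<And>i j. \<bar>of_rat (q i j) - g j \<bullet> i\<bar> < \<delta>" by blast
    define q' where "q' = restrict (\<lambda>(j, i). q i j) ((Basis :: 'a set) \<times> (Basis :: 'b set))"
    have "q' \<in> Q" by (simp add: Q_def q'_def PiE_def)
    then have "mat q' \<in> D" unfolding D_def by (rule imageI)
    moreover have "dist (mat q') g < e"
    proof -
      have "mat q' - g = blinfun_of_matrix ((\<lambda>i j. of_rat (q' (j, i))) - (\<lambda>i j. g j \<bullet> i))"
        using blinfun_of_matrix_minus[of "\<lambda>i j. of_rat (q' (j, i))" "\<lambda>i j. g j \<bullet> i"]
        unfolding mat_def blinfun_of_matrix_works .
      then have "norm (mat q' - g) \<le> (\<Sum>i\<in>Basis. \<Sum>j\<in>Basis. \<bar>of_rat (q' (j, i)) - g j \<bullet> i\<bar>)"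
        using norm_blinfun_of_matrix by (metis (no_types, lifting) minus_apply sum.cong)
      also have "\<dots> \<le> (\<Sum>i\<in>(Basis :: 'b set). \<Sum>j\<in>(Basis :: 'a set). \<delta>)"
        by (intro sum_mono) (simp add: q'_def less_imp_le[OF q])
      also have "\<dots> = e / 2" by (simp add: \<delta>_def)
      finally show ?thesis using e by (simp add: dist_norm)
    qed
    ultimately show ?thesis by blast
  qed
  define B where "B = (\<lambda>(d, n). ball d (1 / real (Suc n))) ` (D \<times> UNIV)"
  have "countable B" unfolding B_def using \<open>countable D\<close> by auto
  moreover have "topological_basis B"
  proof (rule topological_basisI)
    show "open b" if "b \<in> B" for b using that by (auto simp: B_def)
    fix U :: "('a \<Rightarrow>\<^sub>L 'b) set" and g assume U: "open U" "g \<in> U"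
    then obtain e where e: "0 < e" "ball g e \<subseteq> U" by (meson openE)
    obtain n where n: "1 / real (Suc n) < e / 2" using e(1) nat_approx_posE[of "e / 2"] by auto
    obtain d where d: "d \<in> D" "dist d g < 1 / real (Suc n)" using dense[of "1 / real (Suc n)"] by auto
    have "ball d (1 / real (Suc n)) \<subseteq> ball g e"
    proof
      fix h assume "h \<in> ball d (1 / real (Suc n))"
      then show "h \<in> ball g e" using d(2) n dist_triangle[of g h d] by (simp add: dist_commute)
    qed
    then show "\<exists>b\<in>B. g \<in> b \<and> b \<subseteq> U"
      using d e by (intro bexI[of _ "ball d (1 / real (Suc n))"]) (auto simp: B_def)
  qed
  ultimately show "\<exists>B :: ('a \<Rightarrow>\<^sub>L 'b) set set. countable B \<and> open = generate_topology B"
    using topological_basis_imp_subbasis by blast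
qed

section \<open>Measurability of composition and application\<close>

lemma space_borel_GL [simp]: "space borel_GL = GL"
  by (simp add: borel_GL_def space_restrict_space)

lemma id_in_GL [simp]: "id_blinfun \<in> GL"
  by (simp add: GL_def bij_id[unfolded id_def])

lemma compose_in_GL [simp]: "g \<in> GL \<Longrightarrow> h \<in> GL \<Longrightarrow> g o\<^sub>L h \<in> GL"
  by (simp add: GL_def blinfun_compose.rep_eq bij_comp)

lemma GL_apply_eq_0_iff: "g \<in> GL \<Longrightarrow> g x = 0 \<longleftrightarrow> x = 0"
  by (metis GL_def bij_def blinfun.zero_right inj_eq mem_Collect_eq)

lemma GL_nonzero: "g \<in> GL \<Longrightarrow> g \<noteq> (0 :: 'v::euclidean_space \<Rightarrow>\<^sub>L 'v)"
  using GL_apply_eq_0_iff[of g "SOME b. b \<in> Basis"] nonzero_Basis[OF SOME_Basis] by auto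

lemma measurable_borel_GL_imp: "f \<in> measurable borel N \<Longrightarrow> f \<in> measurable borel_GL N"
  unfolding borel_GL_def by (rule measurable_restrict_space1)

lemma measurable_GL_id [measurable]: "(\<lambda>g. g) \<in> measurable borel_GL borel"
  by (intro measurable_borel_GL_imp) simp

lemma measurable_into_GL:
  "f \<in> measurable M borel \<Longrightarrow> (\<And>x. x \<in> space M \<Longrightarrow> f x \<in> GL) \<Longrightarrow> f \<in> measurable M borel_GL"
  unfolding borel_GL_def by (intro measurable_restrict_space2) auto

lemma measurable_GL_continuous_on:
  "continuous_on GL f \<Longrightarrow> f \<in> borel_measurable borel_GL"
  unfolding borel_GL_def by (rule borel_measurable_continuous_on_restrict)

lemma borel_measurable_compose_blinfun [measurable (raw)]:
  fixes f g :: "'a \<Rightarrow> 'v::euclidean_space \<Rightarrow>\<^sub>L 'v"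
  assumes [measurable]: "f \<in> borel_measurable M" "g \<in> borel_measurable M"
  shows "(\<lambda>x. f x o\<^sub>L g x) \<in> borel_measurable M"
proof -
  have "continuous_on UNIV (\<lambda>x :: ('v \<Rightarrow>\<^sub>L 'v) \<times> ('v \<Rightarrow>\<^sub>L 'v). fst x o\<^sub>L snd x)"
    by (intro bounded_bilinear.continuous_on[OF bounded_bilinear_blinfun_compose] continuous_intros)
  from borel_measurable_continuous_Pair[where H=blinfun_compose, OF assms this] show ?thesis .
qed

lemma borel_measurable_apply_blinfun [measurable (raw)]:
  fixes f :: "'a \<Rightarrow> 'v::euclidean_space \<Rightarrow>\<^sub>L 'v"
  assumes [measurable]: "f \<in> borel_measurable M" "g \<in> borel_measurable M"
  shows "(\<lambda>x. f x (g x)) \<in> borel_measurable M"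
proof -
  have "continuous_on UNIV (\<lambda>x :: ('v \<Rightarrow>\<^sub>L 'v) \<times> 'v. blinfun_apply (fst x) (snd x))"
    by (intro bounded_bilinear.continuous_on[OF bounded_bilinear_blinfun_apply] continuous_intros)
  from borel_measurable_continuous_Pair[where H=blinfun_apply, OF assms this] show ?thesis .
qed

lemma measurable_compose_GL [measurable]:
  "(\<lambda>(g, h). g o\<^sub>L h) \<in> measurable (borel_GL \<Otimes>\<^sub>M borel_GL) borel_GL"
proof (rule measurable_into_GL)
  have [measurable]: "fst \<in> borel_measurable (borel_GL \<Otimes>\<^sub>M borel_GL)" "snd \<in> borel_measurable (borel_GL \<Otimes>\<^sub>M borel_GL)"
    using measurable_compose[OF measurable_fst measurable_GL_id]
      measurable_compose[OF measurable_snd measurable_GL_id] by auto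
  show "(\<lambda>(g, h). g o\<^sub>L h) \<in> borel_measurable (borel_GL \<Otimes>\<^sub>M borel_GL)"
    unfolding split_beta' by measurable
qed (auto simp: space_pair_measure)

lemma measurable_apply_GL [measurable]:
  "(\<lambda>(g, x). blinfun_apply g x) \<in> borel_measurable (borel_GL \<Otimes>\<^sub>M borel)"
  unfolding split_beta'
  by (intro borel_measurable_apply_blinfun measurable_compose[OF measurable_fst measurable_GL_id] measurable_snd)

section \<open>Convolution and the law of the walk\<close>

definition GL_prob :: "('v::euclidean_space \<Rightarrow>\<^sub>L 'v) measure \<Rightarrow> bool" where
  "GL_prob p \<longleftrightarrow> prob_space p \<and> sets p = sets borel_GL"

definition conv :: "('v::euclidean_space \<Rightarrow>\<^sub>L 'v) measure \<Rightarrow> ('v \<Rightarrow>\<^sub>L 'v) measure \<Rightarrow> ('v \<Rightarrow>\<^sub>L 'v) measure" where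
  "conv p q = distr (p \<Otimes>\<^sub>M q) borel_GL (\<lambda>(g, h). g o\<^sub>L h)"

primrec conv_power :: "('v::euclidean_space \<Rightarrow>\<^sub>L 'v) measure \<Rightarrow> nat \<Rightarrow> ('v \<Rightarrow>\<^sub>L 'v) measure" where
  "conv_power \<mu> 0 = return borel_GL id_blinfun"
| "conv_power \<mu> (Suc n) = conv \<mu> (conv_power \<mu> n)"

lemma GL_probD:
  assumes "GL_prob p"
  shows "prob_space p" "sets p = sets borel_GL" "space p = GL" "sigma_finite_measure p"
  using assms sets_eq_imp_space_eq[of p borel_GL]
  by (auto simp: GL_prob_def prob_space_imp_sigma_finite)

context
  fixes p q :: "('v::euclidean_space \<Rightarrow>\<^sub>L 'v) measure"
  assumes p: "GL_prob p" and q: "GL_prob q"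
begin

interpretation p: prob_space p using GL_probD[OF p] by simp
interpretation q: prob_space q using GL_probD[OF q] by simp
interpretation pq: pair_prob_space p q ..

lemmas [measurable_cong] = GL_probD(2)[OF p] GL_probD(2)[OF q]

lemma measurable_compose_pq: "(\<lambda>(g, h). g o\<^sub>L h) \<in> measurable (p \<Otimes>\<^sub>M q) borel_GL"
  by measurable

lemma GL_prob_conv: "GL_prob (conv p q)"
  unfolding GL_prob_def conv_def using pq.prob_space_distr[OF measurable_compose_pq] by simp

lemma nn_integral_conv:
  assumes [measurable]: "f \<in> borel_measurable borel_GL"
  shows "(\<integral>\<^sup>+ g. f g \<partial>conv p q) = (\<integral>\<^sup>+ g. \<integral>\<^sup>+ h. f (g o\<^sub>L h) \<partial>q \<partial>p)"
proof -
  have "(\<integral>\<^sup>+ g. f g \<partial>conv p q) = (\<integral>\<^sup>+ x. f (case x of (g, h) \<Rightarrow> g o\<^sub>L h) \<partial>(p \<Otimes>\<^sub>M q))"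
    unfolding conv_def by (rule nn_integral_distr) measurable
  also have "\<dots> = (\<integral>\<^sup>+ g. \<integral>\<^sup>+ h. f (case (g, h) of (g, h) \<Rightarrow> g o\<^sub>L h) \<partial>q \<partial>p)"
    by (rule q.nn_integral_fst[symmetric]) measurable
  finally show ?thesis by simp
qed

lemma integral_conv:
  fixes f :: "_ \<Rightarrow> real"
  assumes [measurable]: "f \<in> borel_measurable borel_GL" and B: "\<And>g. g \<in> GL \<Longrightarrow> \<bar>f g\<bar> \<le> B"
  shows "(\<integral> g. f g \<partial>conv p q) = (\<integral> g. \<integral> h. f (g o\<^sub>L h) \<partial>q \<partial>p)"
proof -
  have "(\<integral> g. f g \<partial>conv p q) = (\<integral> x. f (case x of (g, h) \<Rightarrow> g o\<^sub>L h) \<partial>(p \<Otimes>\<^sub>M q))"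
    unfolding conv_def by (rule integral_distr) measurable
  also have "\<dots> = (\<integral> g. \<integral> h. f (case (g, h) of (g, h) \<Rightarrow> g o\<^sub>L h) \<partial>q \<partial>p)"
  proof (rule pq.integral_fst'[symmetric], rule pq.integrable_const_bound[of _ B])
    show "AE x in p \<Otimes>\<^sub>M q. norm (f (case x of (g, h) \<Rightarrow> g o\<^sub>L h)) \<le> B"
      using B GL_probD(3)[OF p] GL_probD(3)[OF q] by (intro AE_I2) (auto simp: space_pair_measure)
  qed measurable
  finally show ?thesis by simp
qed

lemma measurable_nn_integral_compose:
  assumes [measurable]: "f \<in> borel_measurable borel_GL"
  shows "(\<lambda>g. \<integral>\<^sup>+ h. f (g o\<^sub>L h) \<partial>q) \<in> borel_measurable borel_GL"
  by measurable

end

lemma blinfun_compose_assoc: "(f o\<^sub>L g) o\<^sub>L h = f o\<^sub>L (g o\<^sub>L h)"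
  by (auto intro: blinfun_eqI)

lemma conv_assoc:
  assumes p: "GL_prob p" and q: "GL_prob q" and r: "GL_prob r"
  shows "conv (conv p q) r = conv p (conv q r)"
proof (rule measure_eqI)
  show "sets (conv (conv p q) r) = sets (conv p (conv q r))" by (simp add: conv_def)
  fix A assume "A \<in> sets (conv (conv p q) r)"
  then have A: "A \<in> sets borel_GL" by (simp add: conv_def)
  have [measurable]: "indicator A \<in> borel_measurable borel_GL" using A by simp
  have [measurable]: "(\<lambda>h. indicator A (g o\<^sub>L h)) \<in> borel_measurable borel_GL" if "g \<in> GL" for g
    using that measurable_compose[OF measurable_Pair1'[of g borel_GL borel_GL] measurable_compose[OF measurable_compose_GL, of "indicator A"]] by simp
  have "emeasure (conv (conv p q) r) A = (\<integral>\<^sup>+ g. indicator A g \<partial>conv (conv p q) r)"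
    using A by (simp add: conv_def)
  also have "\<dots> = (\<integral>\<^sup>+ g. \<integral>\<^sup>+ k. indicator A (g o\<^sub>L k) \<partial>r \<partial>conv p q)"
    by (rule nn_integral_conv[OF GL_prob_conv[OF p q] r]) measurable
  also have "\<dots> = (\<integral>\<^sup>+ g. \<integral>\<^sup>+ h. \<integral>\<^sup>+ k. indicator A ((g o\<^sub>L h) o\<^sub>L k) \<partial>r \<partial>q \<partial>p)"
    by (rule nn_integral_conv[OF p q]) (rule measurable_nn_integral_compose[OF q r], measurable)
  also have "\<dots> = (\<integral>\<^sup>+ g. \<integral>\<^sup>+ h. indicator A (g o\<^sub>L h) \<partial>conv q r \<partial>p)"
    by (rule nn_integral_cong, subst nn_integral_conv[OF q r])
      (auto simp: GL_probD(3)[OF p] blinfun_compose_assoc)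
  also have "\<dots> = (\<integral>\<^sup>+ g. indicator A g \<partial>conv p (conv q r))"
    by (rule nn_integral_conv[OF p GL_prob_conv[OF q r], symmetric]) measurable
  also have "\<dots> = emeasure (conv p (conv q r)) A" using A by (simp add: conv_def)
  finally show "emeasure (conv (conv p q) r) A = emeasure (conv p (conv q r)) A" .
qed

lemma id_blinfun_compose [simp]: "id_blinfun o\<^sub>L h = h" "h o\<^sub>L id_blinfun = h"
  by (auto intro: blinfun_eqI)

lemma conv_return_id:
  assumes q: "GL_prob q"
  shows "conv (return borel_GL id_blinfun) q = q"
proof (rule measure_eqI)
  show "sets (conv (return borel_GL id_blinfun) q) = sets q" using GL_probD[OF q] by (simp add: conv_def)
  fix A assume "A \<in> sets (conv (return borel_GL id_blinfun) q)"
  then have A: "A \<in> sets borel_GL" by (simp add: conv_def)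
  have ret: "GL_prob (return borel_GL id_blinfun)"
    by (simp add: GL_prob_def prob_space_return)
  have "emeasure (conv (return borel_GL id_blinfun) q) A
      = (\<integral>\<^sup>+ g. indicator A g \<partial>conv (return borel_GL id_blinfun) q)"
    using A by (simp add: conv_def)
  also have "\<dots> = (\<integral>\<^sup>+ g. \<integral>\<^sup>+ h. indicator A (g o\<^sub>L h) \<partial>q \<partial>return borel_GL id_blinfun)"
    by (rule nn_integral_conv[OF ret q]) (use A in simp)
  also have "\<dots> = (\<integral>\<^sup>+ h. indicator A (id_blinfun o\<^sub>L h) \<partial>q)"
    by (rule nn_integral_return) (use A in \<open>auto intro: measurable_nn_integral_compose[OF ret q]\<close>)
  also have "\<dots> = emeasure q A" using A GL_probD(2)[OF q] by simp
  finally show "emeasure (conv (return borel_GL id_blinfun) q) A = emeasure q A" .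
qed

lemma GL_prob_conv_power: "GL_prob \<mu> \<Longrightarrow> GL_prob (conv_power \<mu> n)"
  by (induction n) (simp add: GL_prob_def prob_space_return, simp add: GL_prob_conv)

text \<open>This is what splits a long product into two independent factors.\<close>

lemma conv_power_add:
  assumes "GL_prob \<mu>"
  shows "conv_power \<mu> (m + n) = conv (conv_power \<mu> m) (conv_power \<mu> n)"
  by (induction m)
    (simp_all add: conv_return_id conv_assoc GL_prob_conv_power assms)

lemma left_walk_cong: "(\<And>i. i \<in> {1..n} \<Longrightarrow> X i \<omega> = Y i \<omega>') \<Longrightarrow> left_walk X n \<omega> = left_walk Y n \<omega>'"
  by (induction n) auto

text \<open>The product of the first \<open>n\<close> factors is a function of those factors alone,
  hence independent of \<open>X (Suc n)\<close>, and one more factor convolves its law with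
  \<open>\<mu>\<close>. This turns the theorem into a statement about convolution powers.\<close>

lemma distr_left_walk:
  assumes M: "prob_space M" and \<mu>: "GL_prob \<mu>"
    and indep: "prob_space.indep_vars M (\<lambda>_. \<mu>) X {1..}"
    and law: "\<And>i. i \<ge> 1 \<Longrightarrow> distr M \<mu> (X i) = \<mu>"
  shows "left_walk X n \<in> measurable M borel_GL \<and> distr M borel_GL (left_walk X n) = conv_power \<mu> n"
proof (induction n)
  case 0
  interpret prob_space M by (rule M)
  have "distr M borel_GL (\<lambda>_. id_blinfun) = return borel_GL id_blinfun"
    by (rule distr_const) simp
  moreover have "left_walk X 0 = (\<lambda>_. id_blinfun)" by auto
  ultimately show ?case by simp
next
  case (Suc n)
  interpret prob_space M by (rule M)
  note [measurable_cong] = GL_probD(2)[OF \<mu>]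
  have [measurable]: "X i \<in> measurable M \<mu>" if "i \<ge> 1" for i
    using indep that unfolding indep_vars_def by auto
  \<comment> \<open>The walk is read off the coordinates of a finite product space, so that
    independence of blocks of coordinates passes to it.\<close>
  have walk_meas: "(\<lambda>y. left_walk (\<lambda>i x. x i) k y) \<in> measurable (PiM {1..N} (\<lambda>_. \<mu>)) borel_GL" if "k \<le> N" for k N
    using that
  proof (induction k)
    case (Suc k)
    have "(\<lambda>y. y (Suc k)) \<in> measurable (PiM {1..N} (\<lambda>_. \<mu>)) \<mu>"
      using Suc.prems by (intro measurable_component_singleton) auto
    then have "(\<lambda>y. (y (Suc k), left_walk (\<lambda>i x. x i) k y)) \<in> measurable (PiM {1..N} (\<lambda>_. \<mu>)) (borel_GL \<Otimes>\<^sub>M borel_GL)"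
      using Suc by (intro measurable_Pair) (auto simp: measurable_cong_sets[OF refl GL_probD(2)[OF \<mu>]])
    from measurable_compose[OF this measurable_compose_GL] show ?case by simp
  next
    case 0
    have "left_walk (\<lambda>i x. x i) 0 = (\<lambda>_. id_blinfun)" by auto
    then show ?case by simp
  qed
  have "indep_var (PiM {Suc n} (\<lambda>_. \<mu>)) (\<lambda>\<omega>. restrict (\<lambda>i. X i \<omega>) {Suc n})
      (PiM {1..n} (\<lambda>_. \<mu>)) (\<lambda>\<omega>. restrict (\<lambda>i. X i \<omega>) {1..n})"
    by (rule indep_var_restrict[OF indep]) auto
  then have "indep_var \<mu> ((\<lambda>y. y (Suc n)) \<circ> (\<lambda>\<omega>. restrict (\<lambda>i. X i \<omega>) {Suc n}))
      borel_GL ((\<lambda>y. left_walk (\<lambda>i x. x i) n y) \<circ> (\<lambda>\<omega>. restrict (\<lambda>i. X i \<omega>) {1..n}))"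
    by (rule indep_var_compose, intro measurable_component_singleton singletonI, intro walk_meas order_refl)
  moreover have "(\<lambda>y. left_walk (\<lambda>i x. x i) n y) \<circ> (\<lambda>\<omega>. restrict (\<lambda>i. X i \<omega>) {1..n}) = left_walk X n"
    by (rule ext, unfold o_def, rule left_walk_cong) simp
  ultimately have indep2: "indep_var \<mu> (X (Suc n)) borel_GL (left_walk X n)"
    by (simp add: o_def)
  have pair: "distr M (\<mu> \<Otimes>\<^sub>M borel_GL) (\<lambda>\<omega>. (X (Suc n) \<omega>, left_walk X n \<omega>)) = \<mu> \<Otimes>\<^sub>M conv_power \<mu> n"
    using indep2 Suc.IH law[of "Suc n"] unfolding indep_var_distribution_eq by simp
  have IH [measurable]: "left_walk X n \<in> measurable M borel_GL" using Suc.IH by simp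
  have Xm [measurable]: "X (Suc n) \<in> measurable M \<mu>" by measurable
  have comp [measurable]: "(\<lambda>(g, h). g o\<^sub>L h) \<in> measurable (\<mu> \<Otimes>\<^sub>M borel_GL) borel_GL"
    using measurable_compose_GL
    by (simp add: measurable_cong_sets[OF sets_pair_measure_cong[OF GL_probD(2)[OF \<mu>] refl] refl])
  have eq: "left_walk X (Suc n) = (\<lambda>(g, h). g o\<^sub>L h) \<circ> (\<lambda>\<omega>. (X (Suc n) \<omega>, left_walk X n \<omega>))"
    by auto
  have pm: "(\<lambda>\<omega>. (X (Suc n) \<omega>, left_walk X n \<omega>)) \<in> measurable M (\<mu> \<Otimes>\<^sub>M borel_GL)"
    by (intro measurable_Pair Xm IH)
  have "distr M borel_GL (left_walk X (Suc n)) = conv_power \<mu> (Suc n)"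
    unfolding eq distr_distr[OF comp pm, symmetric] pair by (simp add: conv_def)
  moreover have "left_walk X (Suc n) \<in> measurable M borel_GL"
    unfolding eq by (rule measurable_comp[OF pm comp])
  ultimately show ?case by blast
qed

section \<open>Stationary measures\<close>

text \<open>The test functions are constant on open rays, that is, functions of the direction. For
  them the action \<open>x \<mapsto> sgn (g x)\<close> on the sphere can be replaced by the linear
  action itself.\<close>

definition stationary :: "('v::euclidean_space \<Rightarrow>\<^sub>L 'v) measure \<Rightarrow> 'v measure \<Rightarrow> bool" where
  "stationary p \<nu> \<longleftrightarrow> (\<forall>F B. F \<in> borel_measurable borel \<longrightarrow> (\<forall>x. \<bar>F x\<bar> \<le> (B::real)) \<longrightarrow>
     (\<forall>t x. 0 < t \<longrightarrow> F (t *\<^sub>R x) = F x) \<longrightarrow> (\<integral>x. F x \<partial>\<nu>) = (\<integral>g. \<integral>x. F (g x) \<partial>\<nu> \<partial>p))"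

lemma stationaryD:
  fixes F :: "_ \<Rightarrow> real"
  assumes "stationary p \<nu>" "F \<in> borel_measurable borel" "\<And>x. \<bar>F x\<bar> \<le> B"
    "\<And>t x. 0 < t \<Longrightarrow> F (t *\<^sub>R x) = F x"
  shows "(\<integral>x. F x \<partial>\<nu>) = (\<integral>g. \<integral>x. F (g x) \<partial>\<nu> \<partial>p)"
  using assms unfolding stationary_def by blast

lemma sgn_apply_sgn: "sgn (blinfun_apply g (sgn x)) = sgn (g x)"
proof (cases "x = 0")
  case False
  have "g (sgn x) = inverse (norm x) *\<^sub>R g x" by (simp add: sgn_div_norm blinfun.scaleR_right)
  then show ?thesis using False by (simp add: sgn_scaleR)
qed simp

text \<open>The Krylov-Bogoliubov argument on the unit sphere: the averages of the laws of
  \<open>sgn (g x0)\<close> over the first steps are invariant up to \<open>O(1/n)\<close>, so a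
  weak limit of them is invariant.\<close>

lemma stationary_exists:
  fixes \<mu> :: "('v::euclidean_space \<Rightarrow>\<^sub>L 'v) measure"
  assumes \<mu>: "GL_prob \<mu>"
  obtains \<nu> :: "'v measure" where "prob_space \<nu>" "sets \<nu> = sets borel" "AE x in \<nu>. norm x = 1"
    "stationary \<mu> \<nu>"
proof -
  interpret \<mu>: prob_space \<mu> using GL_probD[OF \<mu>] by simp
  note [measurable_cong] = GL_probD(2)[OF \<mu>]
  have act [measurable]: "(\<lambda>(g, x). sgn (blinfun_apply g x)) \<in> borel_measurable (\<mu> \<Otimes>\<^sub>M borel)"
    using measurable_compose[OF measurable_apply_GL borel_measurable_sgn]
    by (simp add: measurable_cong_sets[OF sets_pair_measure_cong[OF GL_probD(2)[OF \<mu>] refl] refl] split_beta')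
  obtain x0 :: 'v where x0: "norm x0 = 1" using vector_choose_size[of 1] by auto
  define P where "P n = conv_power \<mu> n" for n
  have P: "GL_prob (P n)" for n unfolding P_def by (rule GL_prob_conv_power[OF \<mu>])
  note P_cong [measurable_cong] = GL_probD(2)[OF P]
  have Pprob: "prob_space (P n)" for n using GL_probD(1)[OF P] .
  define q where "q n = distr (P n) borel (\<lambda>g. sgn (g x0))" for n
  have orbit [measurable]: "(\<lambda>g. sgn (blinfun_apply g x0)) \<in> borel_measurable borel_GL" by measurable
  have orbitP: "(\<lambda>g. sgn (blinfun_apply g x0)) \<in> borel_measurable (P n)" for n
    using orbit by (simp add: measurable_cong_sets[OF GL_probD(2)[OF P] refl])
  have q: "prob_space (q n)" "sets (q n) = sets borel" for n
    unfolding q_def by (auto intro!: prob_space.prob_space_distr[OF Pprob] orbitP)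
  have q_sphere: "AE x in q n. x \<in> sphere 0 1" for n
    unfolding q_def
  proof (subst AE_distr_iff)
    have "norm (sgn (blinfun_apply g x0)) = 1" if "g \<in> GL" for g
      using GL_apply_eq_0_iff[OF that, of x0] x0 by (auto simp: norm_sgn)
    then show "AE g in P n. sgn (blinfun_apply g x0) \<in> sphere 0 1"
      using GL_probD(3)[OF P] by (intro AE_I2) simp
  qed (simp_all add: orbitP)
  define \<nu>n where "\<nu>n n = measure_pmf (pmf_of_set {..n::nat}) \<bind> q" for n
  have q_kernel: "q \<in> measurable (measure_pmf (pmf_of_set {..n})) (subprob_algebra borel)" for n
    using q by (auto simp: space_subprob_algebra intro: prob_space_imp_subprob_space)
  have \<nu>n: "prob_space (\<nu>n n)" "sets (\<nu>n n) = sets borel" for n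
  proof -
    show "prob_space (\<nu>n n)" unfolding \<nu>n_def
      by (rule measure_pmf.prob_space_bind[OF _ q_kernel]) (use q in auto)
    show "sets (\<nu>n n) = sets borel" unfolding \<nu>n_def by (rule sets_bind) (use q in auto)
  qed
  have \<nu>n_sphere: "AE x in \<nu>n n. x \<in> sphere 0 1" for n
    unfolding \<nu>n_def by (subst AE_bind[OF q_kernel]) (use q_sphere in auto)
  have \<nu>n_integral: "(\<integral>x. f x \<partial>\<nu>n n) = (\<Sum>j\<le>n. \<integral>x. f x \<partial>q j) / real (Suc n)"
    if f: "f \<in> borel_measurable borel" and B: "\<And>x. \<bar>f x\<bar> \<le> B" for f :: "'v \<Rightarrow> real" and B n
  proof -
    have "(\<integral>x. f x \<partial>\<nu>n n) = (\<integral>j. \<integral>x. f x \<partial>q j \<partial>measure_pmf (pmf_of_set {..n}))"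
      unfolding \<nu>n_def
    proof (rule integral_bind[where K=borel and B=B and B'=1])
      show "AE j in measure_pmf (pmf_of_set {..n}). emeasure (q j) (space (q j)) \<le> ennreal 1"
        using prob_space.emeasure_space_1[OF q(1)] by simp
    qed (use f B q_kernel[of n] measure_pmf.finite_measure_axioms in auto)
    also have "\<dots> = (\<Sum>j\<le>n. \<integral>x. f x \<partial>q j) / real (Suc n)"
      by (subst integral_pmf_of_set) auto
    finally show ?thesis .
  qed
  obtain r \<nu> where r: "strict_mono r" and \<nu>: "prob_space \<nu>" "sets \<nu> = sets borel"
    and sphere: "AE x in \<nu>. x \<in> sphere 0 1"
    and lim: "\<And>f :: 'v \<Rightarrow> real. f \<in> borel_measurable borel \<Longrightarrow> continuous_on (sphere 0 1) f \<Longrightarrow>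
      (\<lambda>n. \<integral>x. f x \<partial>\<nu>n (r n)) \<longlonglongrightarrow> (\<integral>x. f x \<partial>\<nu>)"
    by (rule prob_measures_on_compact_sequentially_compact[where \<nu>=\<nu>n, OF \<nu>n compact_sphere \<nu>n_sphere]) blast
  interpret \<nu>: prob_space \<nu> by (rule \<nu>)
  interpret \<mu>\<nu>: pair_prob_space \<mu> \<nu> ..
  note [measurable_cong] = \<nu>(2)
  \<comment> \<open>The image of \<open>\<nu>\<close> under one random step on the sphere;
    invariance is the equality \<open>\<nu>' = \<nu>\<close>.\<close>
  define \<nu>' where "\<nu>' = distr (\<mu> \<Otimes>\<^sub>M \<nu>) borel (\<lambda>(g, x). sgn (blinfun_apply g x))"
  have act\<nu>: "(\<lambda>(g, x). sgn (blinfun_apply g x)) \<in> borel_measurable (\<mu> \<Otimes>\<^sub>M \<nu>)" by measurable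
  have \<nu>': "prob_space \<nu>'" "sets \<nu>' = sets borel"
    unfolding \<nu>'_def by (auto intro!: \<mu>\<nu>.prob_space_distr)
  have \<nu>'_integral: "(\<integral>x. f x \<partial>\<nu>') = (\<integral>g. \<integral>x. f (sgn (g x)) \<partial>\<nu> \<partial>\<mu>)"
      "(\<integral>x. f x \<partial>\<nu>') = (\<integral>x. \<integral>g. f (sgn (g x)) \<partial>\<mu> \<partial>\<nu>)"
    if [measurable]: "f \<in> borel_measurable borel" and B: "\<And>x. \<bar>f x\<bar> \<le> B" for f :: "'v \<Rightarrow> real" and B
  proof -
    have int: "integrable (\<mu> \<Otimes>\<^sub>M \<nu>) (\<lambda>(g, x). f (sgn (blinfun_apply g x)))"
    proof (rule \<mu>\<nu>.integrable_const_bound[of _ B])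
      show "(\<lambda>(g, x). f (sgn (blinfun_apply g x))) \<in> borel_measurable (\<mu> \<Otimes>\<^sub>M \<nu>)"
        using measurable_compose[OF act\<nu>, of f borel] by (simp add: split_beta')
    qed (use B in auto)
    have "(\<integral>x. f x \<partial>\<nu>') = (\<integral>z. (case z of (g, x) \<Rightarrow> f (sgn (blinfun_apply g x))) \<partial>(\<mu> \<Otimes>\<^sub>M \<nu>))"
      unfolding \<nu>'_def by (subst integral_distr) (auto intro!: Bochner_Integration.integral_cong)
    then show "(\<integral>x. f x \<partial>\<nu>') = (\<integral>g. \<integral>x. f (sgn (g x)) \<partial>\<nu> \<partial>\<mu>)"
        "(\<integral>x. f x \<partial>\<nu>') = (\<integral>x. \<integral>g. f (sgn (g x)) \<partial>\<mu> \<partial>\<nu>)"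
      using \<mu>\<nu>.integral_fst'[OF int] \<mu>\<nu>.integral_snd[OF int] by simp_all
  qed
  have "\<nu>' = \<nu>"
  proof (rule borel_prob_measure_eqI[OF \<nu>' \<nu>])
    fix f :: "'v \<Rightarrow> real"
    assume f: "continuous_on UNIV f" and B: "\<And>x. \<bar>f x\<bar> \<le> 1"
    have [measurable]: "f \<in> borel_measurable borel" using f by (rule borel_measurable_continuous_onI)
    define Tf where "Tf x = (\<integral>g. f (sgn (g x)) \<partial>\<mu>)" for x
    have Tf_meas [measurable]: "Tf \<in> borel_measurable borel"
      unfolding Tf_def by measurable
    have Tf_bound: "\<bar>Tf x\<bar> \<le> 1" for x
    proof -
      have "\<bar>Tf x\<bar> \<le> (\<integral>g. \<bar>f (sgn (g x))\<bar> \<partial>\<mu>)" unfolding Tf_def by (rule integral_abs_bound)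
      also have "\<dots> \<le> (\<integral>g. 1 \<partial>\<mu>)"
        by (rule integral_mono') (use B in auto)
      finally show ?thesis by (simp add: \<mu>.prob_space)
    qed
    \<comment> \<open>For \<open>a\<close> on the sphere and invertible \<open>g\<close>, the vector
      \<open>g a\<close> is nonzero, and \<open>sgn\<close> is continuous there.\<close>
    have Tf_cont: "continuous_on (sphere 0 1) Tf"
      unfolding continuous_on_sequentially o_def Tf_def
    proof (intro allI ballI impI, elim conjE)
      fix u and a :: 'v assume a: "a \<in> sphere 0 1" and u: "u \<longlonglongrightarrow> a"
      show "(\<lambda>n. \<integral>g. f (sgn (g (u n))) \<partial>\<mu>) \<longlonglongrightarrow> (\<integral>g. f (sgn (g a)) \<partial>\<mu>)"
      proof (rule integral_dominated_convergence[where w="\<lambda>_. 1"])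
        show "AE g in \<mu>. (\<lambda>n. f (sgn (g (u n)))) \<longlonglongrightarrow> f (sgn (g a))"
        proof (rule AE_I2)
          fix g assume "g \<in> space \<mu>"
          then have "g a \<noteq> 0" using a GL_probD(3)[OF \<mu>] GL_apply_eq_0_iff by fastforce
          then have "(\<lambda>n. sgn (g (u n))) \<longlonglongrightarrow> sgn (g a)"
            by (intro tendsto_sgn blinfun.tendsto tendsto_const u)
          moreover have "isCont f (sgn (g a))" using f by (simp add: continuous_on_eq_continuous_at)
          ultimately show "(\<lambda>n. f (sgn (g (u n)))) \<longlonglongrightarrow> f (sgn (g a))"
            by (rule isCont_tendsto_compose[rotated])
        qed
      qed (use B in auto)
    qed
    have q_integral: "(\<integral>x. h x \<partial>q j) = (\<integral>g. h (sgn (g x0)) \<partial>P j)" if [measurable]: "h \<in> borel_measurable borel" for h :: "'v \<Rightarrow> real" and j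
      unfolding q_def by (rule integral_distr[OF orbitP]) measurable
    \<comment> \<open>The operator \<open>Tf\<close> adds one factor on the left, which moves
      \<open>q j\<close> to \<open>q (Suc j)\<close>; the averages therefore telescope.\<close>
    have shift: "(\<integral>x. Tf x \<partial>q j) = (\<integral>x. f x \<partial>q (Suc j))" for j
    proof -
      interpret Pj: prob_space "P j" by (rule Pprob)
      interpret \<mu>P: pair_prob_space \<mu> "P j" ..
      have [measurable]: "(\<lambda>g. f (sgn (blinfun_apply g x0))) \<in> borel_measurable borel_GL" by measurable
      have int: "integrable (\<mu> \<Otimes>\<^sub>M P j) (\<lambda>(g, h). f (sgn (blinfun_apply g (blinfun_apply h x0))))"
      proof (rule \<mu>P.integrable_const_bound[of _ 1])
        show "(\<lambda>(g, h). f (sgn (blinfun_apply g (blinfun_apply h x0)))) \<in> borel_measurable (\<mu> \<Otimes>\<^sub>M P j)"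
          using measurable_compose[OF measurable_compose_pq[OF \<mu> P], of "\<lambda>g. f (sgn (blinfun_apply g x0))" borel j]
          by (simp add: split_beta')
      qed (use B in auto)
      have "(\<integral>x. Tf x \<partial>q j) = (\<integral>h. \<integral>g. f (sgn (g (h x0))) \<partial>\<mu> \<partial>P j)"
        by (subst q_integral[OF Tf_meas]) (simp only: Tf_def sgn_apply_sgn)
      also have "\<dots> = (\<integral>g. \<integral>h. f (sgn (g (h x0))) \<partial>P j \<partial>\<mu>)"
        using \<mu>P.integral_fst'[OF int] \<mu>P.integral_snd[OF int] by simp
      also have "\<dots> = (\<integral>g. f (sgn (g x0)) \<partial>conv \<mu> (P j))"
        by (subst integral_conv[OF \<mu> P, where B=1]) (use B in auto)
      also have "\<dots> = (\<integral>x. f x \<partial>q (Suc j))"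
        by (subst q_integral) (simp_all add: P_def)
      finally show ?thesis .
    qed
    have diff: "(\<integral>x. Tf x \<partial>\<nu>n n) - (\<integral>x. f x \<partial>\<nu>n n) = ((\<integral>x. f x \<partial>q (Suc n)) - (\<integral>x. f x \<partial>q 0)) / real (Suc n)" for n
    proof -
      have "(\<Sum>j\<le>n. \<integral>x. f x \<partial>q (Suc j)) - (\<Sum>j\<le>n. \<integral>x. f x \<partial>q j) = (\<integral>x. f x \<partial>q (Suc n)) - (\<integral>x. f x \<partial>q 0)"
        by (induction n) auto
      then show ?thesis
        using \<nu>n_integral[of Tf 1 n] \<nu>n_integral[of f 1 n] Tf_bound B
        by (simp add: shift diff_divide_distrib[symmetric])
    qed
    have "(\<lambda>n. (\<integral>x. Tf x \<partial>\<nu>n (r n)) - (\<integral>x. f x \<partial>\<nu>n (r n))) \<longlonglongrightarrow> (\<integral>x. Tf x \<partial>\<nu>) - (\<integral>x. f x \<partial>\<nu>)"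
      by (intro tendsto_diff lim Tf_cont continuous_on_subset[OF f]) auto
    moreover have "(\<lambda>n. (\<integral>x. Tf x \<partial>\<nu>n (r n)) - (\<integral>x. f x \<partial>\<nu>n (r n))) \<longlonglongrightarrow> 0"
    proof (rule Lim_null_comparison)
      show "\<forall>\<^sub>F n in sequentially. norm ((\<integral>x. Tf x \<partial>\<nu>n (r n)) - (\<integral>x. f x \<partial>\<nu>n (r n))) \<le> 2 * inverse (real (Suc n))"
      proof (intro always_eventually allI)
        fix n
        have fb: "\<bar>\<integral>x. f x \<partial>q j\<bar> \<le> 1" for j
        proof -
          interpret prob_space "q j" by (rule q)
          have "\<bar>\<integral>x. f x \<partial>q j\<bar> \<le> (\<integral>x. \<bar>f x\<bar> \<partial>q j)" by (rule integral_abs_bound)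
          also have "\<dots> \<le> (\<integral>x. 1 \<partial>q j)" by (rule integral_mono') (use B in auto)
          finally show ?thesis by (simp add: prob_space)
        qed
        have "norm ((\<integral>x. Tf x \<partial>\<nu>n (r n)) - (\<integral>x. f x \<partial>\<nu>n (r n)))
            = \<bar>(\<integral>x. f x \<partial>q (Suc (r n))) - (\<integral>x. f x \<partial>q 0)\<bar> / real (Suc (r n))"
          unfolding diff by simp
        also have "\<dots> \<le> 2 / real (Suc (r n))"
          using fb[of "Suc (r n)"] fb[of 0] by (intro divide_right_mono) linarith+
        also have "\<dots> \<le> 2 / real (Suc n)"
          using seq_suble[OF r, of n] by (intro divide_left_mono) auto
        finally show "norm ((\<integral>x. Tf x \<partial>\<nu>n (r n)) - (\<integral>x. f x \<partial>\<nu>n (r n))) \<le> 2 * inverse (real (Suc n))"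
          by (simp add: divide_inverse)
      qed
      show "(\<lambda>n. 2 * inverse (real (Suc n))) \<longlonglongrightarrow> 0"
        by (rule tendsto_mult_right_zero[OF LIMSEQ_inverse_real_of_nat])
    qed
    ultimately have "(\<integral>x. Tf x \<partial>\<nu>) = (\<integral>x. f x \<partial>\<nu>)" using LIMSEQ_unique by fastforce
    then show "(\<integral>x. f x \<partial>\<nu>') = (\<integral>x. f x \<partial>\<nu>)"
      using \<nu>'_integral(2)[of f 1] B by (simp add: Tf_def)
  qed
  have "stationary \<mu> \<nu>"
    unfolding stationary_def
  proof (intro allI impI)
    fix F :: "'v \<Rightarrow> real" and B
    assume F: "F \<in> borel_measurable borel" and B: "\<forall>x. \<bar>F x\<bar> \<le> B"
      and hom: "\<forall>t x. 0 < t \<longrightarrow> F (t *\<^sub>R x) = F x"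
    \<comment> \<open>Invariance was shown for the normalised action; homogeneity of
      \<open>F\<close> transfers it to the linear one.\<close>
    have "F (sgn x) = F x" for x
      using hom by (cases "x = 0") (simp_all add: sgn_div_norm)
    then show "(\<integral>x. F x \<partial>\<nu>) = (\<integral>g. \<integral>x. F (g x) \<partial>\<nu> \<partial>\<mu>)"
      using \<nu>'_integral(1)[OF F, of B] B \<open>\<nu>' = \<nu>\<close> by simp
  qed
  then show ?thesis using that[OF \<nu>] sphere by simp
qed

text \<open>For fixed \<open>g\<close> the function \<open>x \<mapsto> F (g x)\<close> is again
  bounded and constant on open rays, so stationarity under \<open>q\<close> removes the inner
  factor, and stationarity under \<open>p\<close> then removes the outer one.\<close>

lemma stationary_conv:
  fixes \<nu> :: "'v::euclidean_space measure"
  assumes p: "GL_prob p" and q: "GL_prob q" and \<nu>: "prob_space \<nu>" "sets \<nu> = sets borel"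
    and stat: "stationary p \<nu>" "stationary q \<nu>"
  shows "stationary (conv p q) \<nu>"
  unfolding stationary_def
proof (intro allI impI)
  interpret \<nu>: prob_space \<nu> by (rule \<nu>)
  fix F :: "'v \<Rightarrow> real" and B
  assume [measurable]: "F \<in> borel_measurable borel" and B: "\<forall>x. \<bar>F x\<bar> \<le> B"
    and hom: "\<forall>t x. 0 < t \<longrightarrow> F (t *\<^sub>R x) = F x"
  define f where "f g = (\<integral>x. F (blinfun_apply g x) \<partial>\<nu>)" for g
  have "(\<lambda>(g, x). F (blinfun_apply g x)) \<in> borel_measurable (borel_GL \<Otimes>\<^sub>M \<nu>)"
    using measurable_compose[OF measurable_apply_GL, of F borel]
    by (simp add: measurable_cong_sets[OF sets_pair_measure_cong[OF refl \<nu>(2)] refl] split_beta')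
  then have f_meas: "f \<in> borel_measurable borel_GL" unfolding f_def by (rule \<nu>.borel_measurable_lebesgue_integral)
  have f_bound: "\<bar>f g\<bar> \<le> B" for g
  proof -
    have "\<bar>f g\<bar> \<le> (\<integral>x. \<bar>F (g x)\<bar> \<partial>\<nu>)" unfolding f_def by (rule integral_abs_bound)
    also have "\<dots> \<le> (\<integral>x. B \<partial>\<nu>)" by (rule integral_mono') (use B in auto)
    finally show ?thesis by (simp add: \<nu>.prob_space)
  qed
  have [measurable]: "(\<lambda>x. F (blinfun_apply g x)) \<in> borel_measurable borel" for g :: "'v \<Rightarrow>\<^sub>L 'v"
    by measurable
  have "(\<integral>g. f g \<partial>conv p q) = (\<integral>g. \<integral>h. f (g o\<^sub>L h) \<partial>q \<partial>p)"
    by (rule integral_conv[OF p q f_meas f_bound])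
  also have "\<dots> = (\<integral>g. f g \<partial>p)"
  proof (rule Bochner_Integration.integral_cong[OF refl])
    fix g :: "'v \<Rightarrow>\<^sub>L 'v"
    have "(\<integral>x. F (g x) \<partial>\<nu>) = (\<integral>h. \<integral>x. F (g (h x)) \<partial>\<nu> \<partial>q)"
      by (rule stationaryD[OF stat(2), of _ B]) (use B hom in \<open>auto simp: blinfun.scaleR_right\<close>)
    then show "(\<integral>h. f (g o\<^sub>L h) \<partial>q) = f g" by (simp add: f_def)
  qed
  also have "\<dots> = (\<integral>x. F x \<partial>\<nu>)"
    unfolding f_def by (rule stationaryD[OF stat(1), of _ B, symmetric]) (use B hom in auto)
  finally show "(\<integral>x. F x \<partial>\<nu>) = (\<integral>g. \<integral>x. F (g x) \<partial>\<nu> \<partial>conv p q)" by (simp add: f_def)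
qed

lemma stationary_conv_power:
  assumes "GL_prob \<mu>" "prob_space \<nu>" "sets \<nu> = sets borel" "stationary \<mu> \<nu>"
  shows "stationary (conv_power \<mu> n) \<nu>"
proof (induction n)
  case 0
  interpret \<nu>: prob_space \<nu> by fact
  have "(\<integral>g. \<integral>x. F (blinfun_apply g x) \<partial>\<nu> \<partial>return borel_GL id_blinfun) = (\<integral>x. F x \<partial>\<nu>)"
    if "F \<in> borel_measurable borel" for F :: "_ \<Rightarrow> real"
  proof (subst integral_return)
    have "(\<lambda>(g, x). F (blinfun_apply g x)) \<in> borel_measurable (borel_GL \<Otimes>\<^sub>M \<nu>)"
      using measurable_compose[OF measurable_apply_GL that]
      by (simp add: measurable_cong_sets[OF sets_pair_measure_cong[OF refl assms(3)] refl] split_beta')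
    then show "(\<lambda>g. \<integral>x. F (blinfun_apply g x) \<partial>\<nu>) \<in> borel_measurable borel_GL"
      by (rule \<nu>.borel_measurable_lebesgue_integral)
  qed simp_all
  then show ?case by (simp add: stationary_def)
next
  case (Suc n)
  then show ?case using assms by (simp add: stationary_conv GL_prob_conv_power)
qed

section \<open>Stationary measures and proper subspaces\<close>

lemma subspace_vimage_GL: "subspace W \<Longrightarrow> subspace (blinfun_apply g -` W)"
  by (auto simp: subspace_def blinfun.zero_right blinfun.add_right blinfun.scaleR_right)

lemma dim_vimage_GL:
  assumes "g \<in> GL" "subspace W"
  shows "dim (blinfun_apply g -` W) = dim W"
proof -
  have bij: "bij (blinfun_apply g)" using assms by (simp add: GL_def)
  have "dim (blinfun_apply g ` (blinfun_apply g -` W)) = dim (blinfun_apply g -` W)"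
    by (rule dim_image_eq) (use bij in \<open>auto simp: bij_def inj_on_def blinfun.bounded_linear_right bounded_linear.linear\<close>)
  moreover have "blinfun_apply g ` (blinfun_apply g -` W) = W"
    using bij by (simp add: surj_image_vimage_eq bij_def)
  ultimately show ?thesis by simp
qed

lemma sum_measure_le_measure_Union:
  assumes M: "finite_measure M" and "finite \<F>" "\<F> \<subseteq> sets M"
    and null: "\<And>A B. A \<in> \<F> \<Longrightarrow> B \<in> \<F> \<Longrightarrow> A \<noteq> B \<Longrightarrow> measure M (A \<inter> B) = 0"
  shows "(\<Sum>A\<in>\<F>. measure M A) \<le> measure M (\<Union>\<F>)"
  using assms(2-)
proof (induction \<F> rule: finite_induct)
  case (insert A \<F>)
  interpret finite_measure M by (rule M)
  have U: "\<Union>\<F> \<in> sets M" using insert by (intro sets.finite_Union) auto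
  have "measure M (A \<inter> \<Union>\<F>) = measure M (\<Union>B\<in>\<F>. A \<inter> B)" by (simp add: Int_UN_distrib)
  also have "\<dots> \<le> (\<Sum>B\<in>\<F>. measure M (A \<inter> B))"
    using insert by (intro finite_measure_subadditive_finite) auto
  also have "\<dots> = 0" using insert by (intro sum.neutral) auto
  finally have "measure M (A \<inter> \<Union>\<F>) = 0" using measure_nonneg[of M] by (simp add: order_antisym)
  then have "measure M (A \<union> \<Union>\<F>) = measure M A + measure M (\<Union>\<F>)"
    using insert U by (subst measure_Un3) (auto simp: fmeasurable_eq_sets)
  then show ?case using insert by auto
qed simp

text \<open>Among the subspaces of minimal dimension that carry mass, those of maximal mass form a finite
  family that the support permutes.\<close>

lemma stationary_null_subspace:
  fixes \<mu> :: "('v::euclidean_space \<Rightarrow>\<^sub>L 'v) measure"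
  assumes \<mu>: "GL_prob \<mu>" and \<nu>: "prob_space \<nu>" "sets \<nu> = sets borel" "AE x in \<nu>. norm x = 1"
    and stat: "stationary \<mu> \<nu>" and irr: "strongly_irreducible (generated_semigroup (support_GL \<mu>))"
    and W: "subspace W" "W \<noteq> UNIV"
  shows "measure \<nu> W = 0"
proof (rule ccontr)
  interpret \<nu>: prob_space \<nu> by (rule \<nu>)
  interpret \<mu>: prob_space \<mu> using GL_probD[OF \<mu>] by simp
  have space_\<nu>: "space \<nu> = UNIV" using sets_eq_imp_space_eq[OF \<nu>(2)] by simp
  have meas: "V \<in> sets \<nu>" if "subspace V" for V using closed_subspace[OF that] \<nu>(2) by simp
  define m where "m V = measure \<nu> V" for V
  assume "measure \<nu> W \<noteq> 0"
  then have mW: "0 < m W" by (simp add: m_def zero_less_measure_iff)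
  define Q where "Q k \<longleftrightarrow> (\<exists>V. subspace V \<and> dim V = k \<and> 0 < m V)" for k
  have QW: "Q (dim W)" using W mW by (auto simp: Q_def)
  define s where "s = (LEAST k. Q k)"
  have "Q s" unfolding s_def by (rule LeastI[of Q, OF QW])
  have minimal: "m V = 0" if "subspace V" "dim V < s" for V
  proof -
    have "\<not> Q (dim V)" using not_less_Least[of "dim V" Q] that by (simp add: s_def)
    then have "\<not> 0 < m V" using that(1) by (auto simp: Q_def)
    then show ?thesis by (simp add: m_def zero_less_measure_iff)
  qed
  obtain W1 where W1: "subspace W1" "dim W1 = s" "0 < m W1" using \<open>Q s\<close> by (auto simp: Q_def)
  have "s \<le> dim W" unfolding s_def by (rule Least_le[of Q, OF QW])
  moreover have "dim W < DIM('v)"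
  proof -
    have "span W = W" using W by (simp add: span_eq_iff)
    then have "dim W \<noteq> DIM('v)" using W(2) dim_eq_full[of W] by metis
    then show ?thesis using dim_subset_UNIV[of W] by simp
  qed
  ultimately have s_less: "s < DIM('v)" by simp
  have "s \<noteq> 0"
  proof
    assume "s = 0"
    then have "W1 = {0}" using W1 by (metis dim_eq_0 singletonD subset_singletonD subspace_0 empty_iff)
    then have "AE x in \<nu>. x \<notin> W1" using \<nu>(3) by (auto elim!: eventually_mono)
    then have "m W1 = 0" unfolding m_def using meas[OF W1(1)]
      by (simp add: \<nu>.prob_eq_0)
    then show False using W1 by simp
  qed
  \<comment> \<open>Two distinct subspaces of dimension \<open>s\<close> meet in a smaller
    dimension, where by minimality there is no mass.\<close>
  have inter: "m (U \<inter> V) = 0" if "subspace U" "subspace V" "dim U = s" "dim V = s" "U \<noteq> V" for U V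
  proof (rule minimal)
    show "subspace (U \<inter> V)" using that by (simp add: subspace_inter)
    have "dim (U \<inter> V) \<noteq> s"
    proof
      assume "dim (U \<inter> V) = s"
      have sub: "subspace (U \<inter> V)" using that by (simp add: subspace_inter)
      have "U \<inter> V = U"
        by (rule subspace_dim_equal[OF sub]) (use that \<open>dim (U \<inter> V) = s\<close> in auto)
      moreover have "U \<inter> V = V"
        by (rule subspace_dim_equal[OF sub]) (use that \<open>dim (U \<inter> V) = s\<close> in auto)
      ultimately have "U \<inter> V = U" "U \<inter> V = V" .
      then show False using that by simp
    qed
    moreover have "dim (U \<inter> V) \<le> s" using dim_subset[of "U \<inter> V" U] that by simp
    ultimately show "dim (U \<inter> V) < s" by simp
  qed
  define S where "S = {V. subspace V \<and> dim V = s \<and> m W1 \<le> m V}"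
  have finS: "finite S"
  proof (rule ccontr)
    assume inf: "infinite S"
    \<comment> \<open>Members of \<open>S\<close> have mass at least \<open>m W1\<close> and meet
      pairwise in null sets, so at most \<open>1 / m W1\<close> of them fit into total mass
      one.\<close>
    obtain N :: nat where N: "1 / m W1 < real N" using reals_Archimedean2 by blast
    obtain T where T: "finite T" "card T = N" "T \<subseteq> S" using infinite_arbitrarily_large[OF inf] by blast
    have "real N * m W1 = (\<Sum>V\<in>T. m W1)" using T by simp
    also have "\<dots> \<le> (\<Sum>V\<in>T. m V)" using T by (intro sum_mono) (auto simp: S_def)
    also have "\<dots> \<le> m (\<Union>T)" unfolding m_def
      by (rule sum_measure_le_measure_Union)
        (use T inter meas in \<open>auto simp: S_def m_def \<nu>.finite_measure_axioms\<close>)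
    also have "\<dots> \<le> 1" by (simp add: m_def)
    finally show False using N W1(3) by (simp add: field_simps)
  qed
  have "W1 \<in> S" using W1 by (simp add: S_def)
  define \<alpha> where "\<alpha> = Max (m ` S)"
  have le\<alpha>: "m V \<le> \<alpha>" if "subspace V" "dim V = s" for V
  proof (cases "m W1 \<le> m V")
    case True
    then show ?thesis unfolding \<alpha>_def using finS that by (intro Max_ge) (auto simp: S_def)
  next
    case False
    moreover have "m W1 \<le> \<alpha>" unfolding \<alpha>_def using finS \<open>W1 \<in> S\<close> by (intro Max_ge) auto
    ultimately show ?thesis by simp
  qed
  define F where "F = {V \<in> S. m V = \<alpha>}"
  have finF: "finite F" using finS by (simp add: F_def)
  have "\<alpha> \<in> m ` S" unfolding \<alpha>_def using finS \<open>W1 \<in> S\<close> by (intro Max_in) auto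
  then have "F \<noteq> {}" by (auto simp: F_def)
  have F: "subspace V" "dim V = s" "m V = \<alpha>" if "V \<in> F" for V using that by (auto simp: F_def S_def)
  have FI: "V \<in> F" if "subspace V" "dim V = s" "m V = \<alpha>" for V
  proof -
    have "m W1 \<le> \<alpha>" using le\<alpha> W1 by simp
    then show ?thesis using that by (simp add: F_def S_def)
  qed
  have AE_F: "AE g in \<mu>. blinfun_apply g -` K \<in> F" if K: "K \<in> F" for K
  proof -
    have sub: "subspace K" using F[OF K] by simp
    have ind_meas: "indicator K \<in> borel_measurable borel"
      using closed_subspace[OF sub] by (intro borel_measurable_indicator) simp
    have "t *\<^sub>R x \<in> K \<longleftrightarrow> x \<in> K" if "0 < t" for t x
      using subspace_scale[OF sub, of x t] subspace_scale[OF sub, of "t *\<^sub>R x" "inverse t"] that by auto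
    then have "(\<integral>x. indicat_real K x \<partial>\<nu>) = (\<integral>g. \<integral>x. indicat_real K (blinfun_apply g x) \<partial>\<nu> \<partial>\<mu>)"
      by (intro stationaryD[OF stat ind_meas, of 1]) (auto simp: indicator_def)
    moreover have "(\<integral>x. indicat_real K (blinfun_apply g x) \<partial>\<nu>) = m (blinfun_apply g -` K)" for g
    proof -
      have "(\<integral>x. indicator K (blinfun_apply g x) \<partial>\<nu>) = (\<integral>x. indicator (blinfun_apply g -` K) x \<partial>\<nu> :: real)"
        by (rule Bochner_Integration.integral_cong) (auto simp: indicator_def)
      then show ?thesis by (simp add: m_def space_\<nu>)
    qed
    ultimately have int: "(\<integral>g. m (blinfun_apply g -` K) \<partial>\<mu>) = \<alpha>" using F[OF K] by (simp add: m_def space_\<nu>)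
    \<comment> \<open>A non-integrable function has integral \<open>0\<close> by convention, so a
      nonzero integral proves integrability. As the mean of \<open>m\<close> over the preimages of
      \<open>K\<close> equals its maximum \<open>\<alpha>\<close>, almost every preimage attains
      it.\<close>
    have "\<alpha> \<noteq> 0" using le\<alpha>[of W1] W1 by simp
    then have int': "integrable \<mu> (\<lambda>g. m (blinfun_apply g -` K))" using int not_integrable_integral_eq by fastforce
    then have "(\<integral>g. \<alpha> - m (blinfun_apply g -` K) \<partial>\<mu>) = 0"
      using int by (simp add: \<mu>.prob_space)
    moreover have nonneg: "AE g in \<mu>. 0 \<le> \<alpha> - m (blinfun_apply g -` K)"
      using le\<alpha> dim_vimage_GL[OF _ sub] subspace_vimage_GL[OF sub] F[OF K] GL_probD(3)[OF \<mu>]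
      by (intro AE_I2) auto
    ultimately have "AE g in \<mu>. \<alpha> - m (blinfun_apply g -` K) = 0"
      using int' by (subst (asm) integral_nonneg_eq_0_iff_AE) auto
    moreover have "AE g in \<mu>. g \<in> GL" using GL_probD(3)[OF \<mu>] by (intro AE_I2) simp
    ultimately show ?thesis
    proof eventually_elim
      case (elim g)
      then show ?case using dim_vimage_GL[OF _ sub] subspace_vimage_GL[OF sub] F[OF K] by (intro FI) auto
    qed
  qed
  have supp: "blinfun_apply g -` K \<in> F" if g: "g \<in> support_GL \<mu>" and K: "K \<in> F" for g K
  proof -
    \<comment> \<open>\<open>A\<close> consists of the maps that send some member of
      \<open>F\<close> into \<open>K\<close>. It is closed because \<open>F\<close> is finite, and
      it has full measure, so it contains the support; equal dimensions then turn the inclusion into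
      an equality.\<close>
    define A where "A = (\<Union>K'\<in>F. \<Inter>x\<in>K'. {h :: 'v \<Rightarrow>\<^sub>L 'v. h x \<in> K})"
    have "closed {h :: 'v \<Rightarrow>\<^sub>L 'v. h x \<in> K}" for x
    proof -
      have "closed ((\<lambda>h :: 'v \<Rightarrow>\<^sub>L 'v. blinfun_apply h x) -` K)"
        by (intro closed_vimage closed_subspace F[OF K] continuous_intros)
      then show ?thesis by (simp add: vimage_def)
    qed
    then have "closed A" unfolding A_def using finF by (intro closed_UN closed_INT ballI)
    have GL: "g \<in> GL" using g by (simp add: support_GL_def)
    have "g \<in> A"
    proof (rule ccontr)
      assume "g \<notin> A"
      then have pos: "0 < emeasure \<mu> (- A \<inter> GL)"
        using g \<open>closed A\<close> by (auto simp: support_GL_def)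
      have "AE h in \<mu>. \<not> h \<notin> A"
        using AE_F[OF K] by eventually_elim (auto simp: A_def)
      then have "emeasure \<mu> {h \<in> space \<mu>. h \<notin> A} = 0" by (rule emeasure_eq_0_AE)
      moreover have "{h \<in> space \<mu>. h \<notin> A} = - A \<inter> GL" using GL_probD(3)[OF \<mu>] by auto
      ultimately show False using pos by simp
    qed
    then obtain K' where K': "K' \<in> F" "K' \<subseteq> blinfun_apply g -` K" by (auto simp: A_def)
    have "K' = blinfun_apply g -` K"
      using K' F[OF K'(1)] F[OF K] dim_vimage_GL[OF GL] by (intro subspace_dim_equal subspace_vimage_GL) auto
    then show ?thesis using K' by simp
  qed
  have stable: "blinfun_apply g ` (\<Union>F) \<subseteq> \<Union>F" if "g \<in> generated_semigroup (support_GL \<mu>)" for g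
    using that
  proof induction
    case (base g)
    then have "surj (blinfun_apply g)" by (simp add: support_GL_def GL_def bij_def)
    \<comment> \<open>Taking preimages under a surjection is injective on sets, hence a permutation
      of the finite family \<open>F\<close>. Each member is thus the preimage of a member, which
      converts a statement on preimages into one on images.\<close>
    then have "inj_on ((-`) (blinfun_apply g)) F"
      by (intro inj_onI) (metis surj_image_vimage_eq)
    then have onto: "(-`) (blinfun_apply g) ` F = F"
      using supp[OF base] finF by (intro endo_inj_surj) auto
    show ?case
    proof
      fix y assume "y \<in> blinfun_apply g ` (\<Union>F)"
      then obtain K' x where "K' \<in> F" "x \<in> K'" "y = g x" by auto
      moreover then obtain K where "K \<in> F" "K' = blinfun_apply g -` K" using onto by blast
      ultimately show "y \<in> \<Union>F" by auto
    qed
  next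
    case (comp g h)
    have "blinfun_apply (g o\<^sub>L h) ` (\<Union>F) = blinfun_apply g ` (blinfun_apply h ` (\<Union>F))"
      by (simp add: image_image)
    also have "\<dots> \<subseteq> blinfun_apply g ` (\<Union>F)" using comp.IH(2) by (rule image_mono)
    also have "\<dots> \<subseteq> \<Union>F" by (rule comp.IH(1))
    finally show ?case .
  qed
  have proper: "\<forall>V\<in>F. subspace V \<and> V \<noteq> {0} \<and> V \<noteq> UNIV"
    using F(1) F(2)[of "{0}"] F(2)[of UNIV] \<open>s \<noteq> 0\<close> s_less by auto
  have "\<not> strongly_irreducible (generated_semigroup (support_GL \<mu>))"
    unfolding strongly_irreducible_def not_not
    by (rule exI[of _ F], intro conjI finF \<open>F \<noteq> {}\<close> proper, intro ballI stable)
  then show False using irr by simp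
qed

section \<open>Nondegeneracy and a martingale\<close>

text \<open>The assumption \<open>null\<close> is the form in which strong irreducibility enters
  everything that follows.\<close>

locale stationary_walk =
  fixes \<mu> :: "('v::euclidean_space \<Rightarrow>\<^sub>L 'v) measure" and \<nu> :: "'v measure"
  assumes \<mu>: "GL_prob \<mu>"
    and \<nu>: "prob_space \<nu>" "sets \<nu> = sets borel" "AE x in \<nu>. norm x = 1"
    and stat: "stationary \<mu> \<nu>"
    and null: "\<And>W. subspace W \<Longrightarrow> W \<noteq> UNIV \<Longrightarrow> measure \<nu> W = 0"
begin

abbreviation P :: "nat \<Rightarrow> ('v \<Rightarrow>\<^sub>L 'v) measure" where
  "P n \<equiv> conv_power \<mu> n"

sublocale \<nu>: prob_space \<nu> by (rule \<nu>)

lemma GL_prob_P: "GL_prob (P n)"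
  by (rule GL_prob_conv_power[OF \<mu>])

lemma prob_space_P: "prob_space (P n)"
  using GL_probD[OF GL_prob_P] by blast

lemma space_P [simp]: "space (P n) = GL"
  using GL_probD[OF GL_prob_P] by blast

lemma sets_P: "sets (P n) = sets borel_GL"
  using GL_probD[OF GL_prob_P] by blast

lemma measurable_P_iff: "f \<in> measurable (P n) N \<longleftrightarrow> f \<in> measurable borel_GL N"
  by (simp add: measurable_cong_sets[OF sets_P refl])

lemma measurable_\<nu>_iff: "f \<in> measurable \<nu> N \<longleftrightarrow> f \<in> measurable borel N"
  by (simp add: measurable_cong_sets[OF \<nu>(2) refl])

lemma space_\<nu> [simp]: "space \<nu> = UNIV"
  using sets_eq_imp_space_eq[OF \<nu>(2)] by simp

lemma prob_UNIV [simp]: "\<nu>.prob UNIV = 1"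
  using \<nu>.prob_space by simp

lemma measure_P_GL [simp]: "measure (P n) GL = 1"
  using prob_space.prob_space[OF prob_space_P, of n] by simp

lemma stationary_P: "stationary (P n) \<nu>"
  by (rule stationary_conv_power[OF \<mu> \<nu>(1,2) stat])

lemma AE_apply_nonzero:
  assumes "a \<noteq> 0"
  shows "AE x in \<nu>. blinfun_apply a x \<noteq> 0"
proof -
  have ker: "subspace {x. blinfun_apply a x = 0}"
    by (auto simp: subspace_def blinfun.zero_right blinfun.add_right blinfun.scaleR_right)
  have "{x. blinfun_apply a x = 0} \<noteq> UNIV"
  proof
    assume "{x. blinfun_apply a x = 0} = UNIV"
    then have "blinfun_apply a x = blinfun_apply 0 x" for x by auto
    then show False using assms by (metis blinfun_eqI)
  qed
  then have 0: "\<nu>.prob {x. blinfun_apply a x = 0} = 0" using null ker by blast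
  have "{x. blinfun_apply a x = 0} \<in> sets \<nu>" using closed_subspace[OF ker] \<nu>(2) by simp
  then show ?thesis using 0 by (simp add: \<nu>.prob_eq_0)
qed

lemma borel_measurable_apply [measurable]: "blinfun_apply a \<in> borel_measurable borel" for a :: "'v \<Rightarrow>\<^sub>L 'v"
  by measurable

lemma compact_unit_sphere:
  "compact (sphere 0 1 :: 'a::{real_normed_vector, heine_borel} set)"
proof -
  have "closed {x :: 'a. norm x = 1}" by (intro closed_Collect_eq continuous_intros)
  moreover have "sphere 0 1 = {x :: 'a. norm x = 1}" by auto
  ultimately show ?thesis by (simp add: compact_eq_bounded_closed) (auto simp: bounded_iff)
qed

text \<open>Otherwise there are maps of norm one violating the bound with \<open>\<delta>\<close>
  tending to zero. A subsequence converges to some \<open>l \<noteq> 0\<close>, whose kernel is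
  \<open>\<nu>\<close>-null; so along it the values at almost every \<open>x\<close> stay away from
  zero, and the exceptional sets lose their mass.\<close>

lemma uniform_nondegeneracy:
  assumes "0 < \<eta>"
  shows "\<exists>\<delta>>0. \<forall>b :: 'v \<Rightarrow>\<^sub>L 'v. norm b = 1 \<longrightarrow>
    \<nu>.prob {x. norm (blinfun_apply b x) \<le> \<delta> * norm x} \<le> \<eta>" (is ?thesis)
proof (rule ccontr)
  assume "\<not> ?thesis"
  then have no: "\<exists>b :: 'v \<Rightarrow>\<^sub>L 'v. norm b = 1 \<and> \<eta> < \<nu>.prob {x. norm (blinfun_apply b x) \<le> \<delta> * norm x}" if "0 < \<delta>" for \<delta>
    using that by (meson not_le)
  have "\<exists>b. \<forall>n. norm (b n :: 'v \<Rightarrow>\<^sub>L 'v) = 1 \<and> \<eta> < \<nu>.prob {x. norm (blinfun_apply (b n) x) \<le> inverse (real (Suc n)) * norm x}"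
    by (intro choice allI no) simp
  then obtain b where b: "\<And>n. norm (b n :: 'v \<Rightarrow>\<^sub>L 'v) = 1"
    "\<And>n. \<eta> < \<nu>.prob {x. norm (blinfun_apply (b n) x) \<le> inverse (real (Suc n)) * norm x}" by blast
  have "compact (sphere (0 :: 'v \<Rightarrow>\<^sub>L 'v) 1)" by (rule compact_unit_sphere)
  then obtain l r where l: "l \<in> sphere 0 1" and r: "strict_mono r" "(b \<circ> r) \<longlonglongrightarrow> l"
    unfolding compact_def using b(1) by (metis mem_sphere_0)
  have "l \<noteq> 0" using l by auto
  \<comment> \<open>A stand-in for the indicator of the exceptional set: at unit vectors of that set
    it is at least \<open>1 / 2\<close>, and it tends to \<open>0\<close> wherever
    \<open>l x \<noteq> 0\<close>.\<close>
  define f where "f n x = 1 / (1 + real (Suc (r n)) * norm (blinfun_apply (b (r n)) x))" for n x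
  have f01: "0 \<le> f n x" "f n x \<le> 1" for n x
    by (auto simp: f_def divide_le_eq_1 add_pos_nonneg)
  have f_meas [measurable]: "f n \<in> borel_measurable borel" for n unfolding f_def by measurable
  have half: "\<eta> / 2 \<le> (\<integral>x. f n x \<partial>\<nu>)" for n
  proof -
    define A where "A = {x. norm (blinfun_apply (b (r n)) x) \<le> inverse (real (Suc (r n))) * norm x}"
    have A: "A \<in> sets \<nu>" unfolding A_def \<nu>(2) by measurable
    have "\<eta> / 2 \<le> \<nu>.prob A / 2" using b(2)[of "r n"] by (simp add: A_def)
    also have "\<dots> = (\<integral>x. indicator A x / 2 \<partial>\<nu>)" using A by simp
    also have "\<dots> \<le> (\<integral>x. f n x \<partial>\<nu>)"
    proof (rule integral_mono_AE)
      show "integrable \<nu> (\<lambda>x. indicator A x / 2 :: real)"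
        by (intro integrable_divide integrable_real_indicator A) (simp add: \<nu>.emeasure_eq_measure)
      show "integrable \<nu> (f n)"
        by (rule \<nu>.integrable_const_bound[of _ 1]) (use f01 in \<open>auto simp: measurable_\<nu>_iff\<close>)
      show "AE x in \<nu>. indicator A x / 2 \<le> f n x"
        using \<nu>(3)
      proof eventually_elim
        case (elim x)
        show ?case
        proof (cases "x \<in> A")
          case True
          then have "real (Suc (r n)) * norm (blinfun_apply (b (r n)) x) \<le> 1" using elim by (simp add: A_def field_simps)
          then show ?thesis using True by (simp add: f_def field_simps add_pos_nonneg)
        qed (use f01 in auto)
      qed
    qed
    finally show ?thesis .
  qed
  have "(\<lambda>n. \<integral>x. f n x \<partial>\<nu>) \<longlonglongrightarrow> (\<integral>x. 0 \<partial>\<nu>)"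
  proof (rule integral_dominated_convergence[where w="\<lambda>_. 1"])
    show "AE x in \<nu>. (\<lambda>n. f n x) \<longlonglongrightarrow> 0"
      using AE_apply_nonzero[OF \<open>l \<noteq> 0\<close>]
    proof eventually_elim
      case (elim x)
      have bl: "(\<lambda>n. norm (blinfun_apply (b (r n)) x)) \<longlonglongrightarrow> norm (blinfun_apply l x)"
        using r(2) unfolding o_def by (intro tendsto_norm blinfun.tendsto tendsto_const)
      have "filterlim (\<lambda>n. real (Suc (r n))) at_top sequentially"
        using filterlim_compose[OF filterlim_real_sequentially]
          filterlim_compose[OF filterlim_Suc filterlim_subseq[OF r(1)]] by blast
      then have "filterlim (\<lambda>n. norm (blinfun_apply (b (r n)) x) * real (Suc (r n))) at_top sequentially"
        using elim by (intro filterlim_tendsto_pos_mult_at_top[OF bl]) auto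
      then have "filterlim (\<lambda>n. 1 + real (Suc (r n)) * norm (blinfun_apply (b (r n)) x)) at_top sequentially"
        by (intro filterlim_tendsto_add_at_top[OF tendsto_const]) (simp add: mult.commute)
      from tendsto_inverse_0_at_top[OF this] show ?case
        by (simp add: f_def inverse_eq_divide)
    qed
  qed (use f01 in \<open>auto simp: measurable_\<nu>_iff\<close>)
  then have "\<eta> / 2 \<le> 0" using half LIMSEQ_le_const[of "\<lambda>n. \<integral>x. f n x \<partial>\<nu>" 0 "\<eta> / 2"] by auto
  then show False using assms by simp
qed

text \<open>By stationarity \<open>\<nu> {x. norm (b x) \<le> \<delta> * norm x}\<close> is the mean over \<open>g\<close> of
  \<open>\<nu> {x. norm (b (g x)) \<le> \<delta> * norm (g x)}\<close>, and on the bad event the latter set contains all \<open>x\<close>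
  with \<open>norm (g x) > \<delta> * norm g * norm x\<close>.\<close>

lemma small_product_unlikely:
  assumes "0 < \<eta>"
  obtains c where "0 < c"
    "\<And>n (b :: 'v \<Rightarrow>\<^sub>L 'v). b \<noteq> 0 \<Longrightarrow> measure (P n) {g \<in> GL. norm (b o\<^sub>L g) \<le> c * norm b * norm g} \<le> \<eta>"
proof -
  \<comment> \<open>The bound \<open>1 / 2\<close>, applied to \<open>g\<close>, leaves at least
    half of the directions uncontracted, so each bad \<open>g\<close> contributes at least
    \<open>1 / 2\<close> to a mean which the bound \<open>\<eta> / 2\<close>, applied to
    \<open>b\<close>, controls. The constant of the lemma is \<open>\<delta> * \<delta>\<close>, one
    factor for each map.\<close>
  obtain \<delta> where \<delta>: "0 < \<delta>"
    "\<And>b :: 'v \<Rightarrow>\<^sub>L 'v. norm b = 1 \<Longrightarrow> \<nu>.prob {x. norm (blinfun_apply b x) \<le> \<delta> * norm x} \<le> min (\<eta> / 2) (1 / 2)"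
    using uniform_nondegeneracy[of "min (\<eta> / 2) (1 / 2)"] assms by auto
  have scaled: "\<nu>.prob {x. norm (b x) \<le> \<delta> * norm b * norm x} \<le> min (\<eta> / 2) (1 / 2)" if "b \<noteq> 0" for b :: "'v \<Rightarrow>\<^sub>L 'v"
  proof -
    have "norm (b x) \<le> \<delta> * norm b * norm x \<longleftrightarrow> norm ((b /\<^sub>R norm b) x) \<le> \<delta> * norm x" for x
      using that by (simp add: blinfun.scaleR_left field_simps)
    then show ?thesis using \<delta>(2)[of "b /\<^sub>R norm b"] that by simp
  qed
  show ?thesis
  proof (rule that[of "\<delta> * \<delta>"])
    show "0 < \<delta> * \<delta>" using \<delta> by simp
    fix n and b :: "'v \<Rightarrow>\<^sub>L 'v" assume b: "b \<noteq> 0"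
    interpret Pn: prob_space "P n" by (rule prob_space_P)
    define A where "A = {x. norm (b x) \<le> \<delta> * norm b * norm x}"
    define Bad where "Bad = {g \<in> GL. norm (b o\<^sub>L g) \<le> \<delta> * \<delta> * norm b * norm g}"
    have A: "A \<in> sets borel" unfolding A_def by measurable
    have Bad: "Bad \<in> sets (P n)"
    proof -
      have "Measurable.pred borel_GL (\<lambda>g. norm (b o\<^sub>L g) \<le> \<delta> * \<delta> * norm b * norm g)" by measurable
      then show ?thesis unfolding Bad_def sets_P by (simp add: pred_def)
    qed
    have low: "1 / 2 \<le> (\<integral>x. indicat_real A (g x) \<partial>\<nu>)" if g: "g \<in> Bad" for g
    proof -
      define D where "D = {x. norm (g x) \<le> \<delta> * norm g * norm x}"
      have "g \<noteq> 0" using g GL_nonzero by (auto simp: Bad_def)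
      have D: "D \<in> sets \<nu>" unfolding D_def \<nu>(2) by measurable
      have gA: "blinfun_apply g -` A \<in> sets \<nu>"
        using measurable_sets_borel[OF borel_measurable_apply A] \<nu>(2) by simp
      have "- D \<subseteq> blinfun_apply g -` A"
      proof
        fix x assume "x \<in> - D"
        then have x: "\<delta> * norm g * norm x < norm (g x)" by (simp add: D_def)
        have "norm (b (g x)) \<le> norm (b o\<^sub>L g) * norm x" using norm_blinfun[of "b o\<^sub>L g" x] by simp
        also have "\<dots> \<le> (\<delta> * \<delta> * norm b * norm g) * norm x"
          using g by (intro mult_right_mono) (auto simp: Bad_def)
        also have "\<dots> = (\<delta> * norm b) * (\<delta> * norm g * norm x)" by simp
        also have "\<dots> \<le> (\<delta> * norm b) * norm (g x)" using x \<delta> by (intro mult_left_mono) auto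
        finally show "x \<in> blinfun_apply g -` A" by (simp add: A_def)
      qed
      then have "\<nu>.prob (space \<nu> - D) \<le> \<nu>.prob (blinfun_apply g -` A)"
        using gA by (intro \<nu>.finite_measure_mono) auto
      moreover have "\<nu>.prob D \<le> 1 / 2" using scaled[OF \<open>g \<noteq> 0\<close>] by (simp add: D_def)
      moreover have "\<nu>.prob (space \<nu> - D) = 1 - \<nu>.prob D" by (rule \<nu>.prob_compl[OF D])
      moreover have "(\<integral>x. indicat_real A (g x) \<partial>\<nu>) = \<nu>.prob (blinfun_apply g -` A)"
        using gA by (simp add: indicator_vimage[symmetric])
      ultimately show ?thesis by simp
    qed
    define h where "h g = (\<integral>x. indicat_real A (blinfun_apply g x) \<partial>\<nu>)" for g
    have h01: "0 \<le> h g" "h g \<le> 1" for g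
    proof -
      show "0 \<le> h g" by (simp add: h_def)
      have "h g \<le> (\<integral>x. 1 \<partial>\<nu>)" unfolding h_def by (rule integral_mono') (auto simp: indicator_def)
      then show "h g \<le> 1" by (simp add: \<nu>.prob_space)
    qed
    have h_meas: "h \<in> borel_measurable borel_GL"
    proof -
      have "(\<lambda>(g, x). indicat_real A (blinfun_apply g x)) \<in> borel_measurable (borel_GL \<Otimes>\<^sub>M \<nu>)"
        using measurable_compose[OF measurable_apply_GL, of "indicat_real A" borel] A
        by (simp add: measurable_cong_sets[OF sets_pair_measure_cong[OF refl \<nu>(2)] refl] split_beta')
      then show ?thesis unfolding h_def by (rule \<nu>.borel_measurable_lebesgue_integral)
    qed
    have "(\<integral>x. indicat_real A x \<partial>\<nu>) = (\<integral>g. h g \<partial>P n)"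
      unfolding h_def
      by (rule stationaryD[OF stationary_P, of _ 1])
        (use A in \<open>auto simp: A_def indicator_def blinfun.scaleR_right\<close>)
    then have "(\<integral>g. h g \<partial>P n) = \<nu>.prob A" by simp
    also have "\<dots> \<le> \<eta> / 2" using scaled[OF b] by (simp add: A_def)
    finally have "(\<integral>g. h g \<partial>P n) \<le> \<eta> / 2" .
    moreover have "(\<integral>g. indicat_real Bad g / 2 \<partial>P n) \<le> (\<integral>g. h g \<partial>P n)"
    proof (rule integral_mono)
      show "integrable (P n) (\<lambda>g. indicat_real Bad g / 2)"
        by (intro integrable_divide integrable_real_indicator Bad) (simp add: Pn.emeasure_eq_measure)
      show "integrable (P n) h"
        by (rule Pn.integrable_const_bound[of _ 1]) (use h01 h_meas in \<open>auto simp: measurable_P_iff\<close>)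
      show "indicat_real Bad g / 2 \<le> h g" for g
        using low[of g] h01(1)[of g] by (cases "g \<in> Bad") (auto simp: h_def)
    qed
    moreover have "(\<integral>g. indicat_real Bad g / 2 \<partial>P n) = measure (P n) Bad / 2"
    proof -
      have "Bad \<inter> GL = Bad" by (auto simp: Bad_def)
      then show ?thesis using Bad by simp
    qed
    ultimately show "measure (P n) {g \<in> GL. norm (b o\<^sub>L g) \<le> \<delta> * \<delta> * norm b * norm g} \<le> \<eta>"
      by (simp add: Bad_def)
  qed
qed

text \<open>A measure of how \<open>b\<close> acts on the range of \<open>a\<close>, blind to
  nonzero scaling of \<open>a\<close>. Points of the kernel of \<open>a\<close> contribute
  \<open>0 / 0 = 0\<close>; they form a null set if \<open>a \<noteq> 0\<close>.\<close>

definition mean_ratio :: "('v \<Rightarrow>\<^sub>L 'v) \<Rightarrow> ('v \<Rightarrow>\<^sub>L 'v) \<Rightarrow> real" where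
  "mean_ratio b a = (\<integral>x. (norm (b (a x)) / norm (a x))\<^sup>2 \<partial>\<nu>)"

lemma ratio_le: "(norm (blinfun_apply b y) / norm y)\<^sup>2 \<le> (norm b)\<^sup>2"
proof (rule power_mono)
  show "norm (blinfun_apply b y) / norm y \<le> norm b"
    using norm_blinfun[of b y] by (cases "y = 0") (auto simp: divide_le_eq)
qed simp

lemma mean_ratio_bounds: "0 \<le> mean_ratio b a" "mean_ratio b a \<le> (norm b)\<^sup>2"
proof -
  show "0 \<le> mean_ratio b a" unfolding mean_ratio_def by (rule integral_nonneg_AE) simp
  have "mean_ratio b a \<le> (\<integral>x. (norm b)\<^sup>2 \<partial>\<nu>)" unfolding mean_ratio_def by (rule integral_mono') (auto simp: ratio_le)
  then show "mean_ratio b a \<le> (norm b)\<^sup>2" by (simp add: \<nu>.prob_space)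
qed

lemma mean_ratio_scale: "t \<noteq> 0 \<Longrightarrow> mean_ratio b (t *\<^sub>R a) = mean_ratio b a"
  unfolding mean_ratio_def by (simp add: blinfun.scaleR_left blinfun.scaleR_right)

text \<open>The integrand is bounded by \<open>(norm b)\<^sup>2\<close> and converges wherever
  \<open>l x \<noteq> 0\<close>, which is almost everywhere, so singular limits are allowed as long
  as they are nonzero.\<close>

lemma tendsto_mean_ratio:
  assumes a: "a \<longlonglongrightarrow> l" and "l \<noteq> 0"
  shows "(\<lambda>n. mean_ratio b (a n)) \<longlonglongrightarrow> mean_ratio b l"
  unfolding mean_ratio_def
proof (rule integral_dominated_convergence[where w="\<lambda>_. (norm b)\<^sup>2"])
  show "AE x in \<nu>. (\<lambda>n. (norm (b (a n x)) / norm (a n x))\<^sup>2) \<longlonglongrightarrow> (norm (b (l x)) / norm (l x))\<^sup>2"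
    using AE_apply_nonzero[OF \<open>l \<noteq> 0\<close>]
    by eventually_elim (intro tendsto_intros blinfun.tendsto a, simp)
  have "(\<lambda>x. (norm (b (c x)) / norm (c x))\<^sup>2) \<in> borel_measurable borel" for c :: "'v \<Rightarrow>\<^sub>L 'v"
    by measurable
  then show "(\<lambda>x. (norm (b (l x)) / norm (l x))\<^sup>2) \<in> borel_measurable \<nu>"
    "(\<lambda>x. (norm (b (a n x)) / norm (a n x))\<^sup>2) \<in> borel_measurable \<nu>" for n
    by (simp_all add: measurable_\<nu>_iff)
qed (auto simp: ratio_le)

lemma continuous_on_mean_ratio: "continuous_on (- {0}) (mean_ratio b)"
  unfolding continuous_on_sequentially o_def by (auto intro: tendsto_mean_ratio)

lemma measurable_mean_ratio: "mean_ratio b \<in> borel_measurable borel_GL"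
  by (rule measurable_GL_continuous_on) (rule continuous_on_subset[OF continuous_on_mean_ratio], use GL_nonzero in auto)

text \<open>If \<open>b o\<^sub>L a\<close> were nonzero, its kernel and that of \<open>a\<close>
  would both be null, so the integrand would be positive almost everywhere.\<close>

lemma mean_ratio_eq_0_imp:
  assumes "a \<noteq> 0" "mean_ratio b a = 0"
  shows "b o\<^sub>L a = 0"
proof (rule ccontr)
  assume "b o\<^sub>L a \<noteq> 0"
  have "(\<lambda>x. (norm (b (a x)) / norm (a x))\<^sup>2) \<in> borel_measurable borel" by measurable
  then have "integrable \<nu> (\<lambda>x. (norm (b (a x)) / norm (a x))\<^sup>2)"
    by (intro \<nu>.integrable_const_bound[of _ "(norm b)\<^sup>2"]) (auto simp: measurable_\<nu>_iff ratio_le)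
  then have "AE x in \<nu>. (norm (b (a x)) / norm (a x))\<^sup>2 = 0"
    using assms(2) unfolding mean_ratio_def by (subst (asm) integral_nonneg_eq_0_iff_AE) auto
  with AE_apply_nonzero[OF assms(1)] AE_apply_nonzero[OF \<open>b o\<^sub>L a \<noteq> 0\<close>]
  have "AE x in \<nu>. False" by eventually_elim simp
  then show False by simp
qed

lemma mean_ratio_0: "b o\<^sub>L a = 0 \<Longrightarrow> mean_ratio b a = 0"
proof -
  assume "b o\<^sub>L a = 0"
  then have "b (a x) = 0" for x by (metis blinfun_apply_blinfun_compose zero_blinfun.rep_eq)
  then show ?thesis by (simp add: mean_ratio_def)
qed

lemma compose_GL_nonzero:
  assumes "a \<noteq> 0" "g \<in> GL"
  shows "a o\<^sub>L g \<noteq> (0 :: 'v \<Rightarrow>\<^sub>L 'v)"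
proof
  assume 0: "a o\<^sub>L g = 0"
  have "a y = 0" for y
  proof -
    obtain x where "y = g x" using assms(2) by (metis GL_def bij_def mem_Collect_eq surjD)
    then show ?thesis using 0 by (metis blinfun_apply_blinfun_compose zero_blinfun.rep_eq)
  qed
  then show False using assms(1) by (auto intro: blinfun_eqI)
qed

lemma mean_ratio_compose_measurable:
  assumes "a \<noteq> 0"
  shows "(\<lambda>g. mean_ratio b (a o\<^sub>L g)) \<in> borel_measurable borel_GL"
proof (rule measurable_GL_continuous_on)
  show "continuous_on GL (\<lambda>g. mean_ratio b (a o\<^sub>L g))"
    by (rule continuous_on_compose2[OF continuous_on_mean_ratio])
      (auto intro!: continuous_intros bounded_bilinear.continuous_on[OF bounded_bilinear_blinfun_compose]
        simp: compose_GL_nonzero[OF assms])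
qed

lemma integrable_P_bounded:
  fixes f :: "_ \<Rightarrow> real"
  assumes "f \<in> borel_measurable borel_GL" "\<And>g. \<bar>f g\<bar> \<le> B"
  shows "integrable (P n) f"
proof -
  interpret prob_space "P n" by (rule prob_space_P)
  show ?thesis
    by (rule integrable_const_bound[of _ B]) (use assms in \<open>auto simp: measurable_P_iff\<close>)
qed

text \<open>The martingale property: stationarity applied to the ratio at \<open>g x\<close>, which
  depends only on the direction of \<open>x\<close>.\<close>

lemma integral_mean_ratio_compose:
  "(\<integral>\<gamma>. mean_ratio b (g o\<^sub>L \<gamma>) \<partial>P k) = mean_ratio b g"
proof -
  have "(\<integral>x. (norm (b (g x)) / norm (g x))\<^sup>2 \<partial>\<nu>)
      = (\<integral>\<gamma>. \<integral>x. (norm (b (g (blinfun_apply \<gamma> x))) / norm (g (blinfun_apply \<gamma> x)))\<^sup>2 \<partial>\<nu> \<partial>P k)"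
    by (rule stationaryD[OF stationary_P, of _ "(norm b)\<^sup>2"]) (auto simp: ratio_le blinfun.scaleR_right)
  then show ?thesis by (simp add: mean_ratio_def)
qed

text \<open>The mean squared jump of the martingale over \<open>k\<close> more factors, given that
  the product so far is \<open>a\<close>. The formula also covers singular \<open>a\<close>, where
  the limits of normalised products may lie.\<close>

definition increment :: "('v \<Rightarrow>\<^sub>L 'v) \<Rightarrow> nat \<Rightarrow> ('v \<Rightarrow>\<^sub>L 'v) \<Rightarrow> real" where
  "increment b k a = (\<integral>\<gamma>. (mean_ratio b (a o\<^sub>L \<gamma>) - mean_ratio b a)\<^sup>2 \<partial>P k)"

lemma mean_ratio_diff_sq_bound: "(mean_ratio b a - mean_ratio b c)\<^sup>2 \<le> norm b ^ 4"
proof -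
  have "\<bar>mean_ratio b a - mean_ratio b c\<bar> \<le> (norm b)\<^sup>2" using mean_ratio_bounds[of b a] mean_ratio_bounds[of b c] by linarith
  then have "\<bar>mean_ratio b a - mean_ratio b c\<bar>\<^sup>2 \<le> ((norm b)\<^sup>2)\<^sup>2" by (intro power_mono) auto
  then show ?thesis by simp
qed

lemma increment_nonneg: "0 \<le> increment b k a"
  unfolding increment_def by (rule integral_nonneg_AE) simp

text \<open>For invertible \<open>g\<close> the map \<open>l o\<^sub>L g\<close> stays nonzero, so
  the jump is continuous at \<open>l\<close> for each \<open>g\<close>; the common bound
  \<open>norm b ^ 4\<close> permits passing to the limit in the mean.\<close>

lemma continuous_on_increment: "continuous_on (- {0}) (increment b k)"
  unfolding continuous_on_sequentially o_def
proof (intro allI ballI impI, elim conjE)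
  interpret prob_space "P k" by (rule prob_space_P)
  fix a and l :: "'v \<Rightarrow>\<^sub>L 'v" assume l: "l \<in> - {0}" and a0: "\<forall>n. a n \<in> - {0}" and a: "a \<longlonglongrightarrow> l"
  show "(\<lambda>n. increment b k (a n)) \<longlonglongrightarrow> increment b k l"
    unfolding increment_def
  proof (rule integral_dominated_convergence[where w="\<lambda>_. norm b ^ 4"])
    show "AE g in P k. (\<lambda>n. (mean_ratio b (a n o\<^sub>L g) - mean_ratio b (a n))\<^sup>2) \<longlonglongrightarrow> (mean_ratio b (l o\<^sub>L g) - mean_ratio b l)\<^sup>2"
    proof (rule AE_I2)
      fix g assume "g \<in> space (P k)"
      then have "l o\<^sub>L g \<noteq> 0" using l by (intro compose_GL_nonzero) auto
      moreover have "(\<lambda>n. a n o\<^sub>L g) \<longlonglongrightarrow> (l o\<^sub>L g)"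
        by (intro bounded_bilinear.tendsto[OF bounded_bilinear_blinfun_compose] a tendsto_const)
      ultimately show "(\<lambda>n. (mean_ratio b (a n o\<^sub>L g) - mean_ratio b (a n))\<^sup>2) \<longlonglongrightarrow> (mean_ratio b (l o\<^sub>L g) - mean_ratio b l)\<^sup>2"
        using l by (intro tendsto_power tendsto_diff tendsto_mean_ratio a) auto
    qed
    show "(\<lambda>g. (mean_ratio b (l o\<^sub>L g) - mean_ratio b l)\<^sup>2) \<in> borel_measurable (P k)"
      "(\<lambda>g. (mean_ratio b (a n o\<^sub>L g) - mean_ratio b (a n))\<^sup>2) \<in> borel_measurable (P k)" for n
      using l a0 mean_ratio_compose_measurable unfolding measurable_P_iff by (auto intro!: borel_measurable_power borel_measurable_diff)
  qed (auto simp: mean_ratio_diff_sq_bound)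
qed

lemma measurable_increment: "increment b k \<in> borel_measurable borel_GL"
  by (rule measurable_GL_continuous_on) (rule continuous_on_subset[OF continuous_on_increment], use GL_nonzero in auto)

lemma increment_scale: "t \<noteq> 0 \<Longrightarrow> increment b k (t *\<^sub>R a) = increment b k a"
  unfolding increment_def by (simp add: mean_ratio_scale bounded_bilinear.scaleR_left[OF bounded_bilinear_blinfun_compose])

lemma increment_bound: "\<bar>increment b k a\<bar> \<le> norm b ^ 4"
proof -
  interpret prob_space "P k" by (rule prob_space_P)
  have "increment b k a \<le> (\<integral>\<gamma>. norm b ^ 4 \<partial>P k)" unfolding increment_def by (rule integral_mono') (auto simp: mean_ratio_diff_sq_bound)
  then show ?thesis using increment_nonneg[of b k a] by (simp add: prob_space)
qed

lemma mean_ratio_sq_bound: "\<bar>(mean_ratio b a)\<^sup>2\<bar> \<le> norm b ^ 4"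
proof -
  have "(mean_ratio b a)\<^sup>2 \<le> ((norm b)\<^sup>2)\<^sup>2" using mean_ratio_bounds[of b a] by (intro power_mono) auto
  then show ?thesis by simp
qed

text \<open>Given \<open>g\<close>, the mean of the later value is the present one, so the mean
  squared jump is a variance.\<close>

lemma increment_eq:
  assumes "g \<in> GL"
  shows "increment b k g = (\<integral>\<gamma>. (mean_ratio b (g o\<^sub>L \<gamma>))\<^sup>2 \<partial>P k) - (mean_ratio b g)\<^sup>2"
proof -
  interpret prob_space "P k" by (rule prob_space_P)
  have m: "(\<lambda>\<gamma>. mean_ratio b (g o\<^sub>L \<gamma>)) \<in> borel_measurable borel_GL"
    by (rule mean_ratio_compose_measurable) (use assms GL_nonzero in auto)
  have int: "integrable (P k) (\<lambda>\<gamma>. mean_ratio b (g o\<^sub>L \<gamma>))" "integrable (P k) (\<lambda>\<gamma>. (mean_ratio b (g o\<^sub>L \<gamma>))\<^sup>2)"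
    using m mean_ratio_bounds mean_ratio_sq_bound by (auto intro!: integrable_P_bounded borel_measurable_power)
  have "increment b k g = (\<integral>\<gamma>. ((mean_ratio b (g o\<^sub>L \<gamma>))\<^sup>2 - 2 * mean_ratio b g * mean_ratio b (g o\<^sub>L \<gamma>)) + (mean_ratio b g)\<^sup>2 \<partial>P k)"
    unfolding increment_def by (simp add: power2_diff algebra_simps)
  also have "\<dots> = (\<integral>\<gamma>. (mean_ratio b (g o\<^sub>L \<gamma>))\<^sup>2 \<partial>P k) - 2 * mean_ratio b g * (\<integral>\<gamma>. mean_ratio b (g o\<^sub>L \<gamma>) \<partial>P k) + (mean_ratio b g)\<^sup>2"
    using int by (simp add: prob_space)
  also have "\<dots> = (\<integral>\<gamma>. (mean_ratio b (g o\<^sub>L \<gamma>))\<^sup>2 \<partial>P k) - (mean_ratio b g)\<^sup>2"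
    unfolding integral_mean_ratio_compose by (simp add: power2_eq_square)
  finally show ?thesis .
qed

text \<open>\<open>mean_ratio b\<close> of the products \<open>X\<^sub>1 \<circ> \<dots> \<circ> X\<^sub>n\<close> is a bounded martingale, so its increments vanish in
  \<open>L\<^sup>2\<close>.\<close>

lemma integral_increment_tendsto_0: "(\<lambda>n. \<integral>g. increment b k g \<partial>P n) \<longlonglongrightarrow> 0"
proof -
  define u where "u n = (\<integral>g. (mean_ratio b g)\<^sup>2 \<partial>P n)" for n
  have msq: "(\<lambda>g. (mean_ratio b g)\<^sup>2) \<in> borel_measurable borel_GL"
    using measurable_mean_ratio by (rule borel_measurable_power)
  \<comment> \<open>By the variance formula the second moments \<open>u\<close> grow exactly by the
    mean increments; being monotone and bounded, they converge, and the differences tend to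
    zero.\<close>
  have eq: "(\<integral>g. increment b j g \<partial>P n) = u (n + j) - u n" for n j
  proof -
    have "u (n + j) = (\<integral>g. \<integral>\<gamma>. (mean_ratio b (g o\<^sub>L \<gamma>))\<^sup>2 \<partial>P j \<partial>P n)"
      unfolding u_def conv_power_add[OF \<mu>]
      by (rule integral_conv[OF GL_prob_P GL_prob_P msq mean_ratio_sq_bound])
    also have "\<dots> = (\<integral>g. increment b j g + (mean_ratio b g)\<^sup>2 \<partial>P n)"
      by (rule Bochner_Integration.integral_cong) (auto simp: increment_eq)
    also have "\<dots> = (\<integral>g. increment b j g \<partial>P n) + u n"
      unfolding u_def
      by (intro Bochner_Integration.integral_add integrable_P_bounded[OF measurable_increment increment_bound] integrable_P_bounded[OF msq mean_ratio_sq_bound])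
    finally show ?thesis by simp
  qed
  have "incseq u"
  proof (rule incseq_SucI)
    show "u n \<le> u (Suc n)" for n
      using eq[of n 1] integral_nonneg_AE[of "increment b 1" "P n"] increment_nonneg by simp
  qed
  moreover have "u n \<le> norm b ^ 4" for n
  proof -
    interpret prob_space "P n" by (rule prob_space_P)
    have "u n \<le> (\<integral>g. norm b ^ 4 \<partial>P n)"
      unfolding u_def by (rule integral_mono') (use mean_ratio_sq_bound in auto)
    then show ?thesis by (simp add: prob_space)
  qed
  ultimately obtain L where "u \<longlonglongrightarrow> L" using incseq_convergent by metis
  then have "(\<lambda>n. u (n + k) - u n) \<longlonglongrightarrow> L - L" by (intro tendsto_diff LIMSEQ_ignore_initial_segment)
  then show ?thesis by (simp add: eq)
qed

lemma increment_large_unlikely: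
  assumes "0 < t"
  shows "(\<lambda>n. measure (P n) {g \<in> GL. t \<le> increment b k g}) \<longlonglongrightarrow> 0"
proof (rule tendsto_sandwich[of "\<lambda>_. 0"])
  show "\<forall>\<^sub>F n in sequentially. measure (P n) {g \<in> GL. t \<le> increment b k g} \<le> (\<integral>g. increment b k g \<partial>P n) / t"
  proof (intro always_eventually allI)
    fix n
    show "measure (P n) {g \<in> GL. t \<le> increment b k g} \<le> (\<integral>g. increment b k g \<partial>P n) / t"
      using integral_Markov_inequality_measure[of "P n" "increment b k" "{}" t]
        integrable_P_bounded[OF measurable_increment increment_bound] increment_nonneg assms by simp
  qed
  show "(\<lambda>n. (\<integral>g. increment b k g \<partial>P n) / t) \<longlonglongrightarrow> 0"
    using tendsto_divide[OF integral_increment_tendsto_0 tendsto_const] assms by fastforce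
qed auto

end

section \<open>Rigid limits of products\<close>

lemma open_Int_GL_sets: "open U \<Longrightarrow> U \<inter> GL \<in> sets borel_GL"
proof -
  assume "open U"
  then have "GL \<inter> U \<in> (\<inter>) GL ` sets borel" by (intro imageI) simp
  then show ?thesis by (simp add: borel_GL_def sets_restrict_space Int_commute)
qed

text \<open>Outside the support every point of \<open>GL\<close> lies in a basic open set whose
  trace on \<open>GL\<close> is null, and there are only countably many of these.\<close>

lemma AE_support_GL:
  fixes p :: "('v::euclidean_space \<Rightarrow>\<^sub>L 'v) measure"
  assumes p: "GL_prob p"
  shows "AE g in p. g \<in> support_GL p"
proof -
  obtain \<B> :: "('v \<Rightarrow>\<^sub>L 'v) set set" where \<B>: "countable \<B>" "topological_basis \<B>"
    using ex_countable_basis by blast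
  define N where "N = {B \<in> \<B>. emeasure p (B \<inter> GL) = 0}"
  have open_sets: "U \<inter> GL \<in> sets p" if "open U" for U
    using open_Int_GL_sets[OF that] GL_probD(2)[OF p] by simp
  have "AE g in p. \<forall>B\<in>N. g \<notin> B"
  proof (subst AE_ball_countable)
    show "countable N" using \<B>(1) by (simp add: N_def)
    show "\<forall>B\<in>N. AE g in p. g \<notin> B"
    proof
      fix B assume "B \<in> N"
      then show "AE g in p. g \<notin> B"
        by (intro AE_I[of _ _ "B \<inter> GL"]) (auto simp: N_def GL_probD(3)[OF p] intro: open_sets topological_basis_open[OF \<B>(2)])
    qed
  qed
  moreover have "AE g in p. g \<in> GL" using GL_probD(3)[OF p] by (intro AE_I2) simp
  ultimately show ?thesis
  proof eventually_elim
    case (elim g)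
    have "0 < emeasure p (U \<inter> GL)" if U: "open U" "g \<in> U" for U
    proof (rule ccontr)
      assume "\<not> 0 < emeasure p (U \<inter> GL)"
      then have 0: "emeasure p (U \<inter> GL) = 0" by (simp add: zero_less_iff_neq_zero)
      obtain B where B: "B \<in> \<B>" "g \<in> B" "B \<subseteq> U" by (rule topological_basisE[OF \<B>(2) U])
      have "emeasure p (B \<inter> GL) \<le> emeasure p (U \<inter> GL)"
        by (rule emeasure_mono) (use B open_sets U in auto)
      then have "B \<in> N" using 0 B by (simp add: N_def)
      then show False using elim B by blast
    qed
    then show ?case using elim by (simp add: support_GL_def)
  qed
qed

text \<open>By continuity of composition a neighbourhood of the product contains all products from
  two smaller neighbourhoods, and these have positive measure jointly by independence.\<close>

lemma support_GL_conv:
  assumes p: "GL_prob p" and q: "GL_prob q" and g: "g \<in> support_GL p" and h: "h \<in> support_GL q"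
  shows "g o\<^sub>L h \<in> support_GL (conv p q)"
proof -
  interpret q: prob_space q using GL_probD[OF q] by simp
  note open_sets = open_Int_GL_sets
  have "0 < emeasure (conv p q) (U \<inter> GL)" if U: "open U" "g o\<^sub>L h \<in> U" for U
  proof -
    have "open ((\<lambda>z. fst z o\<^sub>L snd z) -` U)"
      by (intro open_vimage U bounded_bilinear.continuous_on[OF bounded_bilinear_blinfun_compose] continuous_intros)
    moreover have "(g, h) \<in> (\<lambda>z. fst z o\<^sub>L snd z) -` U" using U by simp
    ultimately obtain A B where AB': "open A" "open B" "(g, h) \<in> A \<times> B"
      "A \<times> B \<subseteq> (\<lambda>z. fst z o\<^sub>L snd z) -` U"
      by (rule open_prod_elim)
    then have AB: "open A" "open B" "g \<in> A" "h \<in> B" "A \<times> B \<subseteq> (\<lambda>z. fst z o\<^sub>L snd z) -` U"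
      by auto
    have "0 < emeasure p (A \<inter> GL) * emeasure q (B \<inter> GL)"
      using g h AB by (auto simp: support_GL_def ennreal_zero_less_mult_iff)
    also have "\<dots> = emeasure (p \<Otimes>\<^sub>M q) ((A \<inter> GL) \<times> (B \<inter> GL))"
      by (rule q.emeasure_pair_measure_Times[symmetric])
        (use open_sets AB GL_probD(2)[OF p] GL_probD(2)[OF q] in auto)
    also have "\<dots> \<le> emeasure (p \<Otimes>\<^sub>M q) ((\<lambda>(g, h). g o\<^sub>L h) -` (U \<inter> GL) \<inter> space (p \<Otimes>\<^sub>M q))"
    proof (rule emeasure_mono)
      show "(A \<inter> GL) \<times> (B \<inter> GL) \<subseteq> (\<lambda>(g, h). g o\<^sub>L h) -` (U \<inter> GL) \<inter> space (p \<Otimes>\<^sub>M q)"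
        using AB GL_probD(3)[OF p] GL_probD(3)[OF q] by (auto simp: space_pair_measure)
      show "(\<lambda>(g, h). g o\<^sub>L h) -` (U \<inter> GL) \<inter> space (p \<Otimes>\<^sub>M q) \<in> sets (p \<Otimes>\<^sub>M q)"
        by (rule measurable_sets[OF measurable_compose_pq[OF p q] open_sets[OF U(1)]])
    qed
    also have "\<dots> = emeasure (conv p q) (U \<inter> GL)"
      unfolding conv_def by (rule emeasure_distr[OF measurable_compose_pq[OF p q] open_sets[OF U(1)], symmetric])
    finally show ?thesis .
  qed
  then show ?thesis using g h by (simp add: support_GL_def)
qed

definition blinfun_power :: "('v::real_normed_vector \<Rightarrow>\<^sub>L 'v) \<Rightarrow> nat \<Rightarrow> 'v \<Rightarrow>\<^sub>L 'v" where
  "blinfun_power a n = ((\<lambda>w. a o\<^sub>L w) ^^ n) id_blinfun"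

lemma blinfun_power_0 [simp]: "blinfun_power a 0 = id_blinfun"
  and blinfun_power_Suc [simp]: "blinfun_power a (Suc n) = a o\<^sub>L blinfun_power a n"
  by (simp_all add: blinfun_power_def)

lemma blinfun_power_apply: "blinfun_power a n x = (blinfun_apply a ^^ n) x"
  by (induction n) simp_all

lemma continuous_on_blinfun_power: "continuous_on A f \<Longrightarrow> continuous_on A (\<lambda>x. blinfun_power (f x) n)"
  by (induction n) (auto intro: bounded_bilinear.continuous_on[OF bounded_bilinear_blinfun_compose])

section \<open>Rigid maps in the cone of the walk\<close>

context stationary_walk
begin

text \<open>Almost all products of length at least one belong to it, as do their normalisations and
  limits, and it is closed under composition. It is built from supports because a property that
  holds almost surely under \<open>P k\<close> extends to the support by continuity and from there
  to limits.\<close>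

definition cone :: "('v \<Rightarrow>\<^sub>L 'v) set" where
  "cone = closure {t *\<^sub>R g |t g. 0 < t \<and> (\<exists>k\<ge>1. g \<in> support_GL (P k))}"

lemma cone_compose:
  assumes "a \<in> cone" "b \<in> cone"
  shows "a o\<^sub>L b \<in> cone"
proof -
  define S where "S = {t *\<^sub>R g |t g. 0 < t \<and> (\<exists>k\<ge>1. g \<in> support_GL (P k))}"
  have S: "x o\<^sub>L y \<in> S" if xy: "x \<in> S" "y \<in> S" for x y
  proof -
    obtain s g k t h l where x: "x = s *\<^sub>R g" "0 < s" "k \<ge> 1" "g \<in> support_GL (P k)"
      and y: "y = t *\<^sub>R h" "0 < t" "l \<ge> 1" "h \<in> support_GL (P l)"
      using xy unfolding S_def by blast
    have "x o\<^sub>L y = (s * t) *\<^sub>R (g o\<^sub>L h)"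
      by (simp add: x y bounded_bilinear.scaleR_left[OF bounded_bilinear_blinfun_compose]
          bounded_bilinear.scaleR_right[OF bounded_bilinear_blinfun_compose])
    moreover have "g o\<^sub>L h \<in> support_GL (P (k + l))"
      unfolding conv_power_add[OF \<mu>] by (rule support_GL_conv[OF GL_prob_P GL_prob_P x(4) y(4)])
    ultimately show ?thesis unfolding S_def using x y
      by (intro CollectI exI[of _ "s * t"] exI[of _ "g o\<^sub>L h"]) (auto intro!: exI[of _ "k + l"])
  qed
  obtain u v where u: "\<And>n. u n \<in> S" "u \<longlonglongrightarrow> a" and v: "\<And>n. v n \<in> S" "v \<longlonglongrightarrow> b"
    using assms unfolding cone_def S_def[symmetric] closure_sequential by blast
  have "(\<lambda>n. u n o\<^sub>L v n) \<longlonglongrightarrow> (a o\<^sub>L b)"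
    by (intro bounded_bilinear.tendsto[OF bounded_bilinear_blinfun_compose] u v)
  then show ?thesis unfolding cone_def S_def[symmetric] closure_sequential
    by (intro exI[of _ "\<lambda>n. u n o\<^sub>L v n"] conjI allI S u v)
qed

lemma cone_scale:
  assumes "a \<in> cone" "0 < s"
  shows "s *\<^sub>R a \<in> cone"
proof -
  obtain u where u: "\<And>n. u n \<in> {t *\<^sub>R g |t g. 0 < t \<and> (\<exists>k\<ge>1. g \<in> support_GL (P k))}" "u \<longlonglongrightarrow> a"
    using assms(1) unfolding cone_def closure_sequential by blast
  have "s *\<^sub>R u n \<in> {t *\<^sub>R g |t g. 0 < t \<and> (\<exists>k\<ge>1. g \<in> support_GL (P k))}" for n
  proof -
    obtain t g k where "u n = t *\<^sub>R g" "0 < t" "k \<ge> 1" "g \<in> support_GL (P k)" using u(1)[of n] by blast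
    then show ?thesis using assms(2) by (intro CollectI exI[of _ "s * t"] exI[of _ g]) auto
  qed
  moreover have "(\<lambda>n. s *\<^sub>R u n) \<longlonglongrightarrow> s *\<^sub>R a" by (intro tendsto_intros u)
  ultimately show ?thesis
    unfolding cone_def closure_sequential by (intro exI[of _ "\<lambda>n. s *\<^sub>R u n"] conjI allI)
qed

lemma AE_cone:
  assumes "n \<ge> 1"
  shows "AE g in P n. g \<in> cone"
  using AE_support_GL[OF GL_prob_P]
proof eventually_elim
  case (elim g)
  then have "g \<in> {t *\<^sub>R g |t g. 0 < t \<and> (\<exists>k\<ge>1. g \<in> support_GL (P k))}"
    using assms by (intro CollectI exI[of _ 1] exI[of _ g]) auto
  then show ?case unfolding cone_def by (rule subsetD[OF closure_subset])
qed

text \<open>The limits at which none of the martingales moves any more, whatever the test map and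
  the number of further factors.\<close>

definition rigid :: "('v \<Rightarrow>\<^sub>L 'v) \<Rightarrow> bool" where
  "rigid a \<longleftrightarrow> a \<noteq> 0 \<and> (\<forall>b k. k \<ge> 1 \<longrightarrow> increment b k a = 0)"

text \<open>A vanishing increment gives equality almost everywhere. If equality failed at
  \<open>g\<close>, it would by continuity fail on a neighbourhood of \<open>g\<close>, which has
  positive measure for \<open>g\<close> in the support.\<close>

lemma rigid_support:
  assumes a: "rigid a" and g: "g \<in> support_GL (P k)" "k \<ge> 1"
  shows "mean_ratio b (a o\<^sub>L g) = mean_ratio b a"
proof (rule ccontr)
  interpret Pk: prob_space "P k" by (rule prob_space_P)
  assume ne: "mean_ratio b (a o\<^sub>L g) \<noteq> mean_ratio b a"
  have a0: "a \<noteq> 0" using a by (simp add: rigid_def)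
  have GL: "g \<in> GL" using g by (simp add: support_GL_def)
  define U where "U = {x. a o\<^sub>L x \<noteq> 0} \<inter> (\<lambda>x. mean_ratio b (a o\<^sub>L x)) -` (- {mean_ratio b a})"
  have cont: "continuous_on UNIV (\<lambda>x. a o\<^sub>L x)"
    by (intro bounded_bilinear.continuous_on[OF bounded_bilinear_blinfun_compose] continuous_intros)
  have "open {x. a o\<^sub>L x \<noteq> 0}"
    using open_vimage[OF _ cont, of "- {0}"] by (simp add: vimage_def open_Compl)
  moreover have "continuous_on {x. a o\<^sub>L x \<noteq> 0} (\<lambda>x. mean_ratio b (a o\<^sub>L x))"
    by (rule continuous_on_compose2[OF continuous_on_mean_ratio continuous_on_subset[OF cont]]) auto
  ultimately have "open U" unfolding U_def by (intro continuous_open_preimage) auto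
  moreover have "g \<in> U" using ne compose_GL_nonzero[OF a0 GL] by (simp add: U_def)
  ultimately have pos: "0 < emeasure (P k) (U \<inter> GL)" using g by (simp add: support_GL_def)
  have meas: "(\<lambda>\<gamma>. (mean_ratio b (a o\<^sub>L \<gamma>) - mean_ratio b a)\<^sup>2) \<in> borel_measurable borel_GL"
    using mean_ratio_compose_measurable[OF a0] by (intro borel_measurable_power borel_measurable_diff) auto
  have "integrable (P k) (\<lambda>\<gamma>. (mean_ratio b (a o\<^sub>L \<gamma>) - mean_ratio b a)\<^sup>2)"
    by (rule integrable_P_bounded[OF meas, of "norm b ^ 4"]) (use mean_ratio_diff_sq_bound in auto)
  moreover have "increment b k a = 0" using a g by (simp add: rigid_def)
  ultimately have "AE \<gamma> in P k. (mean_ratio b (a o\<^sub>L \<gamma>) - mean_ratio b a)\<^sup>2 = 0"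
    unfolding increment_def by (subst (asm) integral_nonneg_eq_0_iff_AE) auto
  then have "AE \<gamma> in P k. \<not> \<gamma> \<in> U" by eventually_elim (simp add: U_def)
  then have "emeasure (P k) {\<gamma> \<in> space (P k). \<gamma> \<in> U} = 0" by (rule emeasure_eq_0_AE)
  moreover have "{\<gamma> \<in> space (P k). \<gamma> \<in> U} = U \<inter> GL" by auto
  ultimately show False using pos by simp
qed

text \<open>For rigid \<open>a\<close> the range of \<open>a o\<^sub>L w\<close> is the range of \<open>a\<close>, unless \<open>a o\<^sub>L w = 0\<close>.\<close>

lemma rigid_cancel:
  fixes b :: "'v \<Rightarrow>\<^sub>L 'v"
  assumes a: "rigid a" and w: "w \<in> cone" and ne: "a o\<^sub>L w \<noteq> 0" and 0: "b o\<^sub>L (a o\<^sub>L w) = 0"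
  shows "b o\<^sub>L a = 0"
proof -
  obtain u where u: "\<And>n. u n \<in> {t *\<^sub>R g |t g. 0 < t \<and> (\<exists>k\<ge>1. g \<in> support_GL (P k))}" "u \<longlonglongrightarrow> w"
    using w unfolding cone_def closure_sequential by blast
  have "mean_ratio b (a o\<^sub>L u n) = mean_ratio b a" for n
  proof -
    obtain t g k where "u n = t *\<^sub>R g" "0 < t" "k \<ge> 1" "g \<in> support_GL (P k)" using u(1)[of n] by blast
    then show ?thesis using rigid_support[OF a] mean_ratio_scale
      by (simp add: bounded_bilinear.scaleR_right[OF bounded_bilinear_blinfun_compose])
  qed
  \<comment> \<open>The assumption \<open>a o\<^sub>L w \<noteq> 0\<close> is what allows the
    passage to the limit, since \<open>mean_ratio\<close> is continuous only away from zero.\<close>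
  moreover have "(\<lambda>n. mean_ratio b (a o\<^sub>L u n)) \<longlonglongrightarrow> mean_ratio b (a o\<^sub>L w)"
    by (intro tendsto_mean_ratio ne bounded_bilinear.tendsto[OF bounded_bilinear_blinfun_compose] u tendsto_const)
  ultimately have "mean_ratio b (a o\<^sub>L w) = mean_ratio b a" by (simp add: LIMSEQ_const_iff)
  then have "mean_ratio b a = 0" using mean_ratio_0[OF 0] by simp
  then show ?thesis using a by (intro mean_ratio_eq_0_imp) (auto simp: rigid_def)
qed

text \<open>The alternating product is built from the right, one letter at a time. If putting
  \<open>b\<close> in front of \<open>a o\<^sub>L v n\<close> gave zero, then cancelling the cone
  element \<open>v n\<close> would give \<open>b o\<^sub>L a = 0\<close>; putting \<open>a\<close>
  in front is symmetric.\<close>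

lemma rigid_product_not_nilpotent:
  assumes a: "rigid a" "a \<in> cone" and b: "rigid b" "b \<in> cone" and ab: "a o\<^sub>L b \<noteq> 0" and ba: "b o\<^sub>L a \<noteq> 0"
  shows "blinfun_power (a o\<^sub>L b) (Suc n) \<noteq> 0"
proof -
  define v where "v n = b o\<^sub>L blinfun_power (a o\<^sub>L b) n" for n
  have step: "blinfun_power (a o\<^sub>L b) (Suc n) = a o\<^sub>L v n" for n
    by (simp add: v_def blinfun_compose_assoc)
  have v_Suc: "v (Suc n) = b o\<^sub>L (a o\<^sub>L v n)" for n unfolding v_def[of "Suc n"] step ..
  have "v n \<in> cone \<and> a o\<^sub>L v n \<noteq> 0" for n
  proof (induction n)
    case 0
    then show ?case using b ab by (simp add: v_def)
  next
    case (Suc n)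
    have av: "a o\<^sub>L v n \<in> cone" using cone_compose[OF a(2)] Suc by simp
    have v: "v (Suc n) \<noteq> 0"
      using rigid_cancel[OF a(1), of "v n" b] Suc ba by (auto simp: v_Suc)
    have "a o\<^sub>L v (Suc n) \<noteq> 0"
      using rigid_cancel[OF b(1) av, of a] v ab unfolding v_Suc by auto
    then show ?case using cone_compose[OF b(2) av] by (simp add: v_Suc)
  qed
  then show ?thesis unfolding step by blast
qed

text \<open>On the compact set of admissible pairs the power and all the increments cannot vanish
  together, since the pair would be rigid with a nilpotent product. The open sets on which the power
  plus one increment is positive cover this set; a finite subcover leaves finitely many increments,
  and the minimum of a continuous positive function is \<open>t\<close>.\<close>

lemma compactness_bound:
  assumes "0 < c"
  obtains I t where "finite I" "0 < t"
    "\<And>a b. a \<in> cone \<Longrightarrow> b \<in> cone \<Longrightarrow> norm a = 1 \<Longrightarrow> norm b = 1 \<Longrightarrow> c \<le> norm (a o\<^sub>L b) \<Longrightarrow> c \<le> norm (b o\<^sub>L a) \<Longrightarrow>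
      t \<le> norm (blinfun_power (a o\<^sub>L b) DIM('v)) + (\<Sum>(f, k)\<in>I. increment f k a + increment f k b)"
proof -
  define S where "S = (cone \<inter> sphere 0 1) \<times> (cone \<inter> sphere 0 1)"
  define Y where "Y = S \<inter> {z. c \<le> norm (fst z o\<^sub>L snd z)} \<inter> {z. c \<le> norm (snd z o\<^sub>L fst z)}"
  note comp_cont = bounded_bilinear.continuous_on[OF bounded_bilinear_blinfun_compose]
  have "compact (cone \<inter> sphere 0 1)"
    using closed_Int_compact[OF _ compact_unit_sphere, of cone] by (simp add: cone_def)
  then have "compact S" unfolding S_def by (intro compact_Times)
  moreover have "closed {z :: ('v \<Rightarrow>\<^sub>L 'v) \<times> ('v \<Rightarrow>\<^sub>L 'v). c \<le> norm (fst z o\<^sub>L snd z)}"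
    "closed {z :: ('v \<Rightarrow>\<^sub>L 'v) \<times> ('v \<Rightarrow>\<^sub>L 'v). c \<le> norm (snd z o\<^sub>L fst z)}"
    by (intro closed_Collect_le continuous_intros comp_cont)+
  ultimately have Y: "compact Y" unfolding Y_def by (intro compact_Int_closed)
  define V where "V = (- {0 :: 'v \<Rightarrow>\<^sub>L 'v}) \<times> (- {0 :: 'v \<Rightarrow>\<^sub>L 'v})"
  have YV: "Y \<subseteq> V" by (auto simp: Y_def S_def V_def)
  have "open V" unfolding V_def by (intro open_Times open_Compl closed_singleton)
  define p where "p z = norm (blinfun_power (fst z o\<^sub>L snd z) DIM('v))" for z :: "('v \<Rightarrow>\<^sub>L 'v) \<times> ('v \<Rightarrow>\<^sub>L 'v)"
  define q where "q = (\<lambda>(f, k) z. increment f k (fst z) + increment f k (snd z))"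
  have q_nonneg: "0 \<le> q i z" for i z by (cases i) (simp add: q_def increment_nonneg)
  have p_cont: "continuous_on V p"
    unfolding p_def by (intro continuous_on_norm continuous_on_blinfun_power comp_cont continuous_intros)
  have q_cont: "continuous_on V (q i)" for i
    unfolding q_def
    by (cases i) (auto intro!: continuous_on_add continuous_on_compose2[OF continuous_on_increment] continuous_intros simp: V_def)
  define O' where "O' i = V \<inter> (\<lambda>z. p z + q i z) -` {0<..}" for i
  have openO: "open (O' i)" for i
    unfolding O'_def by (intro continuous_open_preimage \<open>open V\<close> continuous_on_add p_cont q_cont open_greaterThan)
  have cover: "Y \<subseteq> (\<Union>i\<in>UNIV. O' i)"
  proof
    fix z assume z: "z \<in> Y"
    obtain a b where ab: "z = (a, b)" by (cases z)
    show "z \<in> (\<Union>i\<in>UNIV. O' i)"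
    proof (rule ccontr)
      assume no: "z \<notin> (\<Union>i\<in>UNIV. O' i)"
      have le: "p z + q i z \<le> 0" for i
      proof -
        have "z \<notin> O' i" using no by blast
        then show ?thesis using z YV by (auto simp: O'_def)
      qed
      have "0 \<le> p z" by (simp add: p_def)
      then have q0: "q i z = 0" and "p z = 0" for i using q_nonneg[of i z] le[of i] by linarith+
      have G0: "increment f k a + increment f k b = 0" for f k using q0[of "(f, k)"] by (simp add: q_def ab)
      have "increment f k a = 0" "increment f k b = 0" for f k
        using increment_nonneg[of f k a] increment_nonneg[of f k b] G0[of f k] by linarith+
      then have "rigid a" "rigid b" using z YV by (auto simp: rigid_def ab V_def)
      moreover have "a \<in> cone" "b \<in> cone" "a o\<^sub>L b \<noteq> 0" "b o\<^sub>L a \<noteq> 0" using z \<open>0 < c\<close> by (auto simp: ab Y_def S_def)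
      ultimately have "blinfun_power (a o\<^sub>L b) DIM('v) \<noteq> 0"
        using rigid_product_not_nilpotent[of a b "DIM('v) - 1"] by simp
      then show False using \<open>p z = 0\<close> by (simp add: p_def ab)
    qed
  qed
  obtain I where I: "I \<subseteq> UNIV" "finite I" "Y \<subseteq> (\<Union>i\<in>I. O' i)"
    by (rule compactE_image[OF Y openO cover])
  define \<Phi> where "\<Phi> z = p z + (\<Sum>i\<in>I. q i z)" for z
  have "continuous_on Y \<Phi>"
    unfolding \<Phi>_def
    by (intro continuous_on_add continuous_on_sum continuous_on_subset[OF p_cont YV] continuous_on_subset[OF q_cont YV])
  have pos: "0 < \<Phi> z" if z: "z \<in> Y" for z
  proof -
    obtain i where i: "i \<in> I" "z \<in> O' i" using I(3) z by blast
    have "q i z \<le> (\<Sum>i\<in>I. q i z)" using i I q_nonneg by (intro member_le_sum) auto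
    then show ?thesis using i by (simp add: \<Phi>_def O'_def)
  qed
  obtain t where t: "0 < t" "\<And>z. z \<in> Y \<Longrightarrow> t \<le> \<Phi> z"
  proof (cases "Y = {}")
    case True
    then show ?thesis using that[of 1] by simp
  next
    case False
    then obtain z where "z \<in> Y" "\<forall>y\<in>Y. \<Phi> z \<le> \<Phi> y"
      using continuous_attains_inf[OF Y _ \<open>continuous_on Y \<Phi>\<close>] by blast
    then show ?thesis using that[of "\<Phi> z"] pos by blast
  qed
  show ?thesis
  proof (rule that[OF I(2) t(1)])
    fix a b assume "a \<in> cone" "b \<in> cone" "norm a = 1" "norm b = 1" "c \<le> norm (a o\<^sub>L b)" "c \<le> norm (b o\<^sub>L a)"
    then have "(a, b) \<in> Y" by (simp add: Y_def S_def)
    from t(2)[OF this]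
    show "t \<le> norm (blinfun_power (a o\<^sub>L b) DIM('v)) + (\<Sum>(f, k)\<in>I. increment f k a + increment f k b)"
      by (simp add: \<Phi>_def p_def q_def case_prod_unfold)
  qed
qed

end

section \<open>The spectral radius of long products\<close>

text \<open>Fubini with a bound on each fibre. This version serves \<open>A o\<^sub>L B\<close> with
  \<open>A\<close> held fixed; its mirror image serves \<open>B o\<^sub>L A\<close> with
  \<open>B\<close> held fixed.\<close>

lemma measure_pair_le:
  assumes p: "prob_space p" and q: "prob_space q" and X: "X \<in> sets (p \<Otimes>\<^sub>M q)"
    and le: "\<And>x. x \<in> space p \<Longrightarrow> measure q (Pair x -` X) \<le> \<eta>" and "0 \<le> \<eta>"
  shows "measure (p \<Otimes>\<^sub>M q) X \<le> \<eta>"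
proof -
  interpret p: prob_space p by (rule p)
  interpret q: prob_space q by (rule q)
  interpret pair_prob_space p q ..
  have "emeasure (p \<Otimes>\<^sub>M q) X = (\<integral>\<^sup>+ x. emeasure q (Pair x -` X) \<partial>p)"
    by (rule q.emeasure_pair_measure_alt[OF X])
  also have "\<dots> \<le> (\<integral>\<^sup>+ x. ennreal \<eta> \<partial>p)"
    using le by (intro nn_integral_mono) (simp add: q.emeasure_eq_measure ennreal_leI)
  also have "\<dots> = ennreal \<eta>" by (simp add: p.emeasure_space_1)
  finally show ?thesis using \<open>0 \<le> \<eta>\<close> by (simp add: emeasure_eq_measure)
qed

lemma measure_pair_le':
  assumes p: "prob_space p" and q: "prob_space q" and X: "X \<in> sets (p \<Otimes>\<^sub>M q)"
    and le: "\<And>y. y \<in> space q \<Longrightarrow> measure p ((\<lambda>x. (x, y)) -` X) \<le> \<eta>" and "0 \<le> \<eta>"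
  shows "measure (p \<Otimes>\<^sub>M q) X \<le> \<eta>"
proof -
  interpret p: prob_space p by (rule p)
  interpret q: prob_space q by (rule q)
  interpret pair_prob_space p q ..
  have "emeasure (p \<Otimes>\<^sub>M q) X = (\<integral>\<^sup>+ y. emeasure p ((\<lambda>x. (x, y)) -` X) \<partial>q)"
    by (rule emeasure_pair_measure_alt2[OF X])
  also have "\<dots> \<le> (\<integral>\<^sup>+ y. ennreal \<eta> \<partial>q)"
    using le by (intro nn_integral_mono) (simp add: p.emeasure_eq_measure ennreal_leI)
  also have "\<dots> = ennreal \<eta>" by (simp add: q.emeasure_space_1)
  finally show ?thesis using \<open>0 \<le> \<eta>\<close> by (simp add: emeasure_eq_measure)
qed

section \<open>Powers of a normalised product and its spectral radius\<close>

lemma linear_blinfun: "linear (blinfun_apply g)"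
  by (simp add: blinfun.bounded_linear_right bounded_linear.linear)

lemma measurable_spectral_radius: "(\<lambda>g :: 'v::euclidean_space \<Rightarrow>\<^sub>L 'v. spectral_radius (blinfun_apply g)) \<in> borel_measurable borel"
  by (rule borel_measurableI_ge) (use borel_closed[OF closed_spectral_radius_ge] in simp)

text \<open>Division by \<open>s\<close> makes \<open>g\<close> a contraction with eigenvalues of
  modulus at most \<open>\<epsilon>\<close>. The number \<open>s\<close> is free because the product
  \<open>A o\<^sub>L B\<close> will be divided by \<open>norm A * norm B\<close>, which can exceed
  its norm.\<close>

lemma norm_blinfun_power_le:
  fixes g :: "'v::euclidean_space \<Rightarrow>\<^sub>L 'v"
  assumes s: "0 < s" "norm g \<le> s" and \<epsilon>: "0 \<le> \<epsilon>" "\<epsilon> \<le> 1" and \<rho>: "spectral_radius (blinfun_apply g) \<le> \<epsilon> * s"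
  shows "norm (blinfun_power (g /\<^sub>R s) DIM('v)) \<le> 2 ^ DIM('v) * \<epsilon>"
proof (rule norm_blinfun_bound)
  fix x
  have eq: "blinfun_apply (g /\<^sub>R s) = (\<lambda>x. inverse s *\<^sub>R g x)" by (rule ext) (simp add: blinfun.scaleR_left)
  show "norm (blinfun_power (g /\<^sub>R s) DIM('v) x) \<le> 2 ^ DIM('v) * \<epsilon> * norm x"
    unfolding blinfun_power_apply
  proof (rule norm_power_le_of_small_eigenvalues[OF linear_blinfun])
    show "norm ((g /\<^sub>R s) y) \<le> norm y" for y
    proof -
      have "norm ((g /\<^sub>R s) y) \<le> norm (g /\<^sub>R s) * norm y" by (rule norm_blinfun)
      also have "\<dots> \<le> 1 * norm y" using s by (intro mult_right_mono) (auto simp: field_simps)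
      finally show ?thesis by simp
    qed
    fix c assume "complex_eigenvalue (blinfun_apply (g /\<^sub>R s)) c"
    then have "complex_eigenvalue (blinfun_apply g) (c / of_real (inverse s))"
      unfolding eq using s by (intro complex_eigenvalue_scale) auto
    then have "cmod (c / of_real (inverse s)) \<le> spectral_radius (blinfun_apply g)"
      using spectral_radius_ge_iff[OF linear_blinfun] by blast
    moreover have "cmod (c / of_real (inverse s)) = cmod c * s"
      using s by (simp add: norm_divide norm_inverse divide_inverse norm_mult)
    ultimately have "cmod c * s \<le> \<epsilon> * s" using \<rho> by linarith
    then show "cmod c \<le> \<epsilon>" using s by simp
  qed (use \<epsilon> in auto)
qed (use \<epsilon> in simp)

context stationary_walk
begin

text \<open>The exceptional probability \<open>\<eta>\<close> is spent as follows:
  \<open>\<eta> / 4\<close> each on \<open>A o\<^sub>L B\<close> and \<open>B o\<^sub>L A\<close>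
  being small, and \<open>\<eta> / 4\<close> on each half still having a large increment.\<close>

lemma small_spectral_radius_unlikely:
  assumes "0 < \<eta>"
  obtains \<epsilon> N where "0 < \<epsilon>"
    "\<And>n. n \<ge> N \<Longrightarrow> measure (P n) {g \<in> GL. spectral_radius (blinfun_apply g) \<le> \<epsilon> * norm g} \<le> \<eta>"
proof -
  obtain c where c: "0 < c"
    "\<And>n (b :: 'v \<Rightarrow>\<^sub>L 'v). b \<noteq> 0 \<Longrightarrow> measure (P n) {g \<in> GL. norm (b o\<^sub>L g) \<le> c * norm b * norm g} \<le> \<eta> / 4"
    using small_product_unlikely[of "\<eta> / 4"] assms by auto
  obtain I t where I: "finite I" "0 < t"
    and bound: "\<And>a b. a \<in> cone \<Longrightarrow> b \<in> cone \<Longrightarrow> norm a = 1 \<Longrightarrow> norm b = 1 \<Longrightarrow> c \<le> norm (a o\<^sub>L b) \<Longrightarrow> c \<le> norm (b o\<^sub>L a) \<Longrightarrow>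
      t \<le> norm (blinfun_power (a o\<^sub>L b) DIM('v)) + (\<Sum>(f, k)\<in>I. increment f k a + increment f k b)"
    using compactness_bound[OF c(1)] by blast
  \<comment> \<open>Chosen so that the increments of both halves, summed over \<open>I\<close>, stay
    below \<open>t / 2\<close>; adding one to the cardinality keeps this strict and covers empty
    \<open>I\<close>.\<close>
  define \<tau> where "\<tau> = t / (4 * (real (card I) + 1))"
  have \<tau>: "0 < \<tau>" using I by (simp add: \<tau>_def add_nonneg_pos)
  define \<epsilon> where "\<epsilon> = min 1 (t / (2 * 2 ^ DIM('v)))"
  have \<epsilon>: "0 < \<epsilon>" "\<epsilon> \<le> 1" "2 ^ DIM('v) * \<epsilon> \<le> t / 2"
  proof -
    show "0 < \<epsilon>" "\<epsilon> \<le> 1" using I by (auto simp: \<epsilon>_def)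
    have "2 ^ DIM('v) * \<epsilon> \<le> 2 ^ DIM('v) * (t / (2 * 2 ^ DIM('v)))" by (intro mult_left_mono) (auto simp: \<epsilon>_def)
    then show "2 ^ DIM('v) * \<epsilon> \<le> t / 2" by simp
  qed
  define L where "L = (\<lambda>(f, k). {g \<in> GL. \<tau> \<le> increment f k g})"
  define u where "u n = (\<Sum>i\<in>I. measure (P n) (L i))" for n
  have "u \<longlonglongrightarrow> (\<Sum>i\<in>I. 0)"
    unfolding u_def L_def using increment_large_unlikely[OF \<tau>] by (intro tendsto_sum) (simp add: split_beta')
  then have "\<forall>\<^sub>F n in sequentially. u n < \<eta> / 4" using assms by (intro order_tendstoD) auto
  then obtain N where N: "\<And>n. n \<ge> N \<Longrightarrow> u n < \<eta> / 4" unfolding eventually_sequentially by blast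
  have L_sets: "L i \<in> sets borel_GL" for i
  proof -
    obtain f k where i: "i = (f, k)" by (cases i)
    have "{g \<in> space borel_GL. \<tau> \<le> increment f k g} \<in> sets borel_GL"
      using measurable_increment[of f k] by measurable
    then show ?thesis by (simp add: L_def i)
  qed
  \<comment> \<open>The deterministic part: off the exceptional events the power contributes at most
    \<open>t / 2\<close> and the increments less than \<open>t / 2\<close>, against the lower bound
    \<open>t\<close>.\<close>
  have main: False
    if A: "A \<in> GL" "A \<in> cone" and B: "B \<in> GL" "B \<in> cone"
      and AB: "c * norm A * norm B < norm (A o\<^sub>L B)" and BA: "c * norm B * norm A < norm (B o\<^sub>L A)"
      and L: "\<And>i. i \<in> I \<Longrightarrow> A \<notin> L i" "\<And>i. i \<in> I \<Longrightarrow> B \<notin> L i"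
      and \<rho>: "spectral_radius (blinfun_apply (A o\<^sub>L B)) \<le> \<epsilon> * norm (A o\<^sub>L B)" for A B
  proof -
    define a where "a = A /\<^sub>R norm A"
    define b where "b = B /\<^sub>R norm B"
    define s where "s = norm A * norm B"
    have nz: "A \<noteq> 0" "B \<noteq> 0" using A B GL_nonzero by auto
    then have s: "0 < s" "norm (A o\<^sub>L B) \<le> s" by (simp_all add: s_def norm_blinfun_compose)
    have ab: "a o\<^sub>L b = (A o\<^sub>L B) /\<^sub>R s" and ba: "b o\<^sub>L a = (B o\<^sub>L A) /\<^sub>R s"
      by (simp_all add: a_def b_def s_def bounded_bilinear.scaleR_left[OF bounded_bilinear_blinfun_compose]
          bounded_bilinear.scaleR_right[OF bounded_bilinear_blinfun_compose] mult.commute)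
    have "c \<le> norm (a o\<^sub>L b)" "c \<le> norm (b o\<^sub>L a)"
      using AB BA s nz unfolding ab ba by (simp_all add: s_def field_simps)
    then have "t \<le> norm (blinfun_power (a o\<^sub>L b) DIM('v)) + (\<Sum>(f, k)\<in>I. increment f k a + increment f k b)"
      using nz cone_scale A B by (intro bound) (simp_all add: a_def b_def)
    moreover have "norm (blinfun_power (a o\<^sub>L b) DIM('v)) \<le> t / 2"
    proof -
      have "\<epsilon> * norm (A o\<^sub>L B) \<le> \<epsilon> * s" using s \<epsilon> by (intro mult_left_mono) auto
      with \<rho> have "spectral_radius (blinfun_apply (A o\<^sub>L B)) \<le> \<epsilon> * s" by (rule order_trans)
      then have "norm (blinfun_power (a o\<^sub>L b) DIM('v)) \<le> 2 ^ DIM('v) * \<epsilon>"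
        unfolding ab using s \<epsilon> by (intro norm_blinfun_power_le) auto
      then show ?thesis using \<epsilon> by linarith
    qed
    moreover have "(\<Sum>(f, k)\<in>I. increment f k a + increment f k b) \<le> (\<Sum>i\<in>I. 2 * \<tau>)"
    proof (rule sum_mono, clarify)
      fix f k assume i: "(f, k) \<in> I"
      have "increment f k a = increment f k A" "increment f k b = increment f k B" using nz by (simp_all add: a_def b_def increment_scale)
      then show "increment f k a + increment f k b \<le> 2 * \<tau>" using L[OF i] A B by (simp add: L_def)
    qed
    moreover have "(\<Sum>i\<in>I. 2 * \<tau>) < t / 2"
    proof -
      have "real (card I) * (2 * \<tau>) < (real (card I) + 1) * (2 * \<tau>)" using \<tau> by simp
      also have "\<dots> = t / 2" by (simp add: \<tau>_def field_simps)
      finally show ?thesis by simp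
    qed
    ultimately show False by linarith
  qed
  show ?thesis
  proof (rule that[OF \<epsilon>(1), of "2 * N + 2"])
    fix n assume n: "2 * N + 2 \<le> n"
    \<comment> \<open>As \<open>n \<ge> 2 * N + 2\<close>, both lengths are at least
      \<open>N\<close>, where increments are small, and at least one, where the cone carries the
      law.\<close>
    define m where "m = n div 2"
    define k where "k = n - m"
    have mk: "n = m + k" "m \<ge> 1" "k \<ge> 1" "m \<ge> N" "k \<ge> N" using n by (auto simp: m_def k_def)
    interpret Pm: prob_space "P m" by (rule prob_space_P)
    interpret Pk: prob_space "P k" by (rule prob_space_P)
    interpret Q: pair_prob_space "P m" "P k" ..
    let ?Q = "P m \<Otimes>\<^sub>M P k"
    have Qsets: "sets ?Q = sets (borel_GL \<Otimes>\<^sub>M borel_GL)" by (intro sets_pair_measure_cong sets_P)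
    have Qspace: "space ?Q = GL \<times> GL" by (simp add: space_pair_measure)
    have fstm: "fst \<in> measurable (borel_GL \<Otimes>\<^sub>M borel_GL) (borel :: ('v \<Rightarrow>\<^sub>L 'v) measure)"
      and sndm: "snd \<in> measurable (borel_GL \<Otimes>\<^sub>M borel_GL) (borel :: ('v \<Rightarrow>\<^sub>L 'v) measure)"
      using measurable_compose[OF measurable_fst measurable_GL_id]
        measurable_compose[OF measurable_snd measurable_GL_id] by auto
    note [measurable] = fstm sndm measurable_spectral_radius
    define E :: "('v \<Rightarrow>\<^sub>L 'v) set" where "E = {g \<in> GL. spectral_radius (blinfun_apply g) \<le> \<epsilon> * norm g}"
    define E0 :: "(('v \<Rightarrow>\<^sub>L 'v) \<times> ('v \<Rightarrow>\<^sub>L 'v)) set" where "E0 = {z \<in> GL \<times> GL. fst z o\<^sub>L snd z \<in> E}"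
    define E1 :: "(('v \<Rightarrow>\<^sub>L 'v) \<times> ('v \<Rightarrow>\<^sub>L 'v)) set" where "E1 = {z \<in> GL \<times> GL. norm (fst z o\<^sub>L snd z) \<le> c * norm (fst z) * norm (snd z)}"
    define E2 :: "(('v \<Rightarrow>\<^sub>L 'v) \<times> ('v \<Rightarrow>\<^sub>L 'v)) set" where "E2 = {z \<in> GL \<times> GL. norm (snd z o\<^sub>L fst z) \<le> c * norm (snd z) * norm (fst z)}"
    have E: "E \<in> sets borel_GL"
    proof -
      have "{g \<in> space borel_GL. spectral_radius (blinfun_apply g) \<le> \<epsilon> * norm g} \<in> sets borel_GL"
        using measurable_borel_GL_imp[OF measurable_spectral_radius] by measurable
      then show ?thesis by (simp add: E_def)
    qed
    have normm: "(\<lambda>z. norm (f z)) \<in> borel_measurable (borel_GL \<Otimes>\<^sub>M borel_GL)"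
      if "f \<in> borel_measurable (borel_GL \<Otimes>\<^sub>M borel_GL)" for f :: "('v \<Rightarrow>\<^sub>L 'v) \<times> ('v \<Rightarrow>\<^sub>L 'v) \<Rightarrow> 'v \<Rightarrow>\<^sub>L 'v"
      using measurable_compose[OF that borel_measurable_norm] .
    have GL2: "{z \<in> space (borel_GL \<Otimes>\<^sub>M borel_GL). Q z} = {z \<in> GL \<times> GL. Q z}" for Q :: "('v \<Rightarrow>\<^sub>L 'v) \<times> ('v \<Rightarrow>\<^sub>L 'v) \<Rightarrow> bool"
      by (simp add: space_pair_measure)
    have E12: "E1 \<in> sets ?Q" "E2 \<in> sets ?Q"
      unfolding E1_def E2_def Qsets GL2[symmetric]
      by (intro borel_measurable_le borel_measurable_times borel_measurable_const normm
          borel_measurable_compose_blinfun fstm sndm)+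
    have rect: "L i \<times> GL \<in> sets ?Q" "GL \<times> L i \<in> sets ?Q" for i
      using L_sets[of i] sets_P sets.top[of "P m"] sets.top[of "P k"] by (auto intro!: pair_measureI)
    define R where "R = (\<Union>i\<in>I. L i \<times> GL) \<union> (\<Union>i\<in>I. GL \<times> L i)"
    have R: "R \<in> sets ?Q" unfolding R_def using rect I by (intro sets.Un sets.finite_UN) auto
    have mR: "measure ?Q R \<le> \<eta> / 2"
    proof -
      have "measure ?Q R \<le> measure ?Q (\<Union>i\<in>I. L i \<times> GL) + measure ?Q (\<Union>i\<in>I. GL \<times> L i)"
        unfolding R_def using rect I by (intro measure_Un_le sets.finite_UN) auto
      also have "\<dots> \<le> (\<Sum>i\<in>I. measure ?Q (L i \<times> GL)) + (\<Sum>i\<in>I. measure ?Q (GL \<times> L i))"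
        using rect I by (intro add_mono Q.finite_measure_subadditive_finite) auto
      also have "\<dots> = u m + u k"
      proof -
        have "measure ?Q (L i \<times> GL) = measure (P m) (L i)" "measure ?Q (GL \<times> L i) = measure (P k) (L i)" for i
          using L_sets[of i] sets_P sets.top[of "P m"] sets.top[of "P k"]
          by (auto simp: measure_def Pk.emeasure_pair_measure_Times Pm.emeasure_space_1[simplified] Pk.emeasure_space_1[simplified])
        then show ?thesis by (simp add: u_def)
      qed
      also have "\<dots> \<le> \<eta> / 2" using N[OF mk(4)] N[OF mk(5)] by simp
      finally show ?thesis .
    qed
    have mE1: "measure ?Q E1 \<le> \<eta> / 4"
    proof (rule measure_pair_le[OF prob_space_P prob_space_P E12(1)])
      fix A assume "A \<in> space (P m)"
      then have "Pair A -` E1 = {g \<in> GL. norm (A o\<^sub>L g) \<le> c * norm A * norm g}" "A \<noteq> 0"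
        using GL_nonzero by (auto simp: E1_def)
      then show "measure (P k) (Pair A -` E1) \<le> \<eta> / 4" using c(2) by simp
    qed (use assms in simp)
    have mE2: "measure ?Q E2 \<le> \<eta> / 4"
    proof (rule measure_pair_le'[OF prob_space_P prob_space_P E12(2)])
      fix B assume "B \<in> space (P k)"
      then have "(\<lambda>x. (x, B)) -` E2 = {g \<in> GL. norm (B o\<^sub>L g) \<le> c * norm B * norm g}" "B \<noteq> 0"
        using GL_nonzero by (auto simp: E2_def)
      then show "measure (P m) ((\<lambda>x. (x, B)) -` E2) \<le> \<eta> / 4" using c(2) by simp
    qed (use assms in simp)
    have "AE z in ?Q. z \<in> cone \<times> cone"
    proof -
      have Cc: "cone \<in> sets borel" by (simp add: cone_def)
      have "{z \<in> space ?Q. z \<in> cone \<times> cone} \<in> sets ?Q"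
      proof -
        have "{z \<in> space (borel_GL \<Otimes>\<^sub>M borel_GL). fst z \<in> cone \<and> snd z \<in> cone} \<in> sets (borel_GL \<Otimes>\<^sub>M borel_GL)"
          using Cc by measurable
        moreover have "{z \<in> space (borel_GL \<Otimes>\<^sub>M borel_GL). fst z \<in> cone \<and> snd z \<in> cone} = {z \<in> space ?Q. z \<in> cone \<times> cone}"
          by (auto simp: space_pair_measure)
        ultimately show ?thesis by (simp add: Qsets)
      qed
      then show ?thesis
      proof (rule Q.AE_pair_measure)
        show "AE x in P m. AE y in P k. (x, y) \<in> cone \<times> cone"
          using AE_cone[OF mk(2)]
        proof eventually_elim
          case (elim x)
          show ?case using AE_cone[OF mk(3)] by eventually_elim (use elim in simp)
        qed
      qed
    qed
    then have "AE z in ?Q. z \<in> E0 \<longrightarrow> z \<in> E1 \<union> E2 \<union> R"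
    proof eventually_elim
      case (elim z)
      obtain A B where z: "z = (A, B)" by (cases z)
      show ?case
      proof (rule impI, rule ccontr)
        assume "z \<in> E0" "z \<notin> E1 \<union> E2 \<union> R"
        then show False using elim
          by (intro main[of A B]) (auto simp: z E0_def E1_def E2_def E_def R_def)
      qed
    qed
    then have "measure ?Q E0 \<le> measure ?Q (E1 \<union> E2 \<union> R)"
      using E12 R by (intro Q.finite_measure_mono_AE) auto
    also have "\<dots> \<le> measure ?Q E1 + measure ?Q E2 + measure ?Q R"
      using E12 R by (intro order_trans[OF measure_Un_le] add_mono measure_Un_le order_refl) auto
    also have "\<dots> \<le> \<eta>" using mE1 mE2 mR by simp
    finally have "measure ?Q E0 \<le> \<eta>" .
    moreover have "measure (P n) E = measure ?Q E0"
    proof -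
      have "measure (P n) E = measure (conv (P m) (P k)) E" by (simp add: mk(1) conv_power_add[OF \<mu>])
      also have "\<dots> = measure ?Q ((\<lambda>(g, h). g o\<^sub>L h) -` E \<inter> space ?Q)"
        unfolding conv_def by (rule measure_distr[OF measurable_compose_pq[OF GL_prob_P GL_prob_P] E])
      also have "(\<lambda>(g, h). g o\<^sub>L h) -` E \<inter> space ?Q = E0" by (auto simp: E0_def Qspace)
      finally show ?thesis .
    qed
    ultimately show "measure (P n) {g \<in> GL. spectral_radius (blinfun_apply g) \<le> \<epsilon> * norm g} \<le> \<eta>"
      by (simp add: E_def)
  qed
qed

end

section \<open>Comparison of an arbitrary norm with the Euclidean one\<close>

lemma vector_norm_equivalent:
  fixes N :: "'v::euclidean_space \<Rightarrow> real"
  assumes N: "vector_norm N"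
  obtains K where "1 \<le> K" "\<And>x. N x \<le> K * norm x" "\<And>x. norm x \<le> K * N x"
proof -
  have N0: "N x = 0 \<longleftrightarrow> x = 0" and Nscale: "N (r *\<^sub>R x) = \<bar>r\<bar> * N x" and Nadd: "N (x + y) \<le> N x + N y" for x y r
    using N by (auto simp: vector_norm_def)
  have Nz: "N 0 = 0" by (simp add: N0)
  have Nminus: "N (- x) = N x" for x using Nscale[of "-1" x] by simp
  have Nnonneg: "0 \<le> N x" for x using Nadd[of x "- x"] Nz Nminus[of x] by simp
  have Nsum: "N (\<Sum>i\<in>S. h i) \<le> (\<Sum>i\<in>S. N (h i))" if "finite S" for S and h :: "'v \<Rightarrow> 'v"
    using that by (induction S rule: finite_induct) (auto simp: Nz intro: order_trans[OF Nadd])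
  define K1 where "K1 = (\<Sum>b\<in>Basis. N (b :: 'v))"
  have up: "N x \<le> K1 * norm x" for x
  proof -
    have "N x = N (\<Sum>b\<in>Basis. (x \<bullet> b) *\<^sub>R b)" by (simp add: euclidean_representation)
    also have "\<dots> \<le> (\<Sum>b\<in>Basis. N ((x \<bullet> b) *\<^sub>R b))" by (rule Nsum) simp
    also have "\<dots> \<le> (\<Sum>b\<in>Basis. norm x * N b)"
      by (intro sum_mono) (simp add: Nscale mult_right_mono Basis_le_norm Nnonneg)
    also have "\<dots> = K1 * norm x" by (simp add: K1_def sum_distrib_left mult.commute)
    finally show ?thesis .
  qed
  have diff: "\<bar>N x - N y\<bar> \<le> K1 * norm (x - y)" for x y
    using Nadd[of "x - y" y] Nadd[of "y - x" x] up[of "x - y"] up[of "y - x"]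
    by (simp add: norm_minus_commute abs_le_iff)
  have "continuous_on UNIV N"
  proof -
    have K1: "0 \<le> K1" unfolding K1_def by (intro sum_nonneg Nnonneg)
    have "(K1)-lipschitz_on UNIV N"
      by (rule lipschitz_onI) (use diff K1 in \<open>auto simp: dist_norm\<close>)
    then show ?thesis by (rule lipschitz_on_continuous_on)
  qed
  then have cont: "continuous_on (sphere 0 1) N" by (rule continuous_on_subset) simp
  obtain e :: 'v where "norm e = 1" using vector_choose_size[of 1] by auto
  then have "sphere (0 :: 'v) 1 \<noteq> {}" by auto
  from continuous_attains_inf[OF compact_sphere this cont]
  obtain x0 :: 'v where x0: "norm x0 = 1" "\<And>x. norm x = 1 \<Longrightarrow> N x0 \<le> N x" by auto
  have pos: "0 < N x0" using x0(1) N0[of x0] Nnonneg[of x0] by (auto simp: less_le)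
  have low: "norm x \<le> 1 / N x0 * N x" for x
  proof (cases "x = 0")
    case False
    then have "N x0 \<le> N (x /\<^sub>R norm x)" by (intro x0(2)) simp
    then show ?thesis using False pos by (simp add: Nscale field_simps)
  qed (simp add: Nz)
  define K where "K = max 1 (max K1 (1 / N x0))"
  show ?thesis
  proof (rule that[of K])
    show "1 \<le> K" by (simp add: K_def)
    show "N x \<le> K * norm x" for x
      by (rule order_trans[OF up]) (intro mult_right_mono, auto simp: K_def)
    show "norm x \<le> K * N x" for x
      by (rule order_trans[OF low]) (intro mult_right_mono Nnonneg, simp add: K_def)
  qed
qed

text \<open>The upper bound makes a small ratio for \<open>N\<close> a small ratio for the Euclidean
  norm, positivity clears the denominator, and continuity gives measurability. Boundedness of the
  quotients comes before all of these, since otherwise the supremum in \<open>op_norm\<close> would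
  carry no information.\<close>

lemma op_norm_properties:
  fixes N :: "'v::euclidean_space \<Rightarrow> real"
  assumes N: "vector_norm N"
  obtains K where "0 < K" "\<And>g :: 'v \<Rightarrow>\<^sub>L 'v. op_norm N (blinfun_apply g) \<le> K * norm g"
    "\<And>g :: 'v \<Rightarrow>\<^sub>L 'v. g \<noteq> 0 \<Longrightarrow> 0 < op_norm N (blinfun_apply g)"
    "continuous_on UNIV (\<lambda>g :: 'v \<Rightarrow>\<^sub>L 'v. op_norm N (blinfun_apply g))"
proof -
  obtain K where K: "1 \<le> K" "\<And>x. N x \<le> K * norm x" "\<And>x. norm x \<le> K * N x"
    by (rule vector_norm_equivalent[OF N]) blast
  have N0: "N x = 0 \<longleftrightarrow> x = 0" and Nadd: "N (x + y) \<le> N x + N y" for x y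
    using N by (auto simp: vector_norm_def)
  have Nnonneg: "0 \<le> N x" for x
  proof -
    have "0 \<le> K * N x" using K(3)[of x] norm_ge_zero order_trans by blast
    then show ?thesis using K(1) by (simp add: zero_le_mult_iff)
  qed
  have quot: "N (blinfun_apply g x) / N x \<le> K * K * norm g" for g :: "'v \<Rightarrow>\<^sub>L 'v" and x
  proof (cases "x = 0")
    case True
    then show ?thesis using K by (simp add: N0 blinfun.zero_right)
  next
    case False
    then have "0 < N x" using N0[of x] Nnonneg[of x] by (auto simp: less_le)
    have "N (g x) \<le> K * norm (g x)" by (rule K)
    also have "\<dots> \<le> K * (norm g * norm x)" using K by (intro mult_left_mono norm_blinfun) auto
    also have "\<dots> \<le> K * (norm g * (K * N x))" using K by (intro mult_left_mono) auto
    finally show ?thesis using \<open>0 < N x\<close> by (simp add: divide_le_eq ac_simps)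
  qed
  have bdd: "bdd_above (range (\<lambda>x. N (blinfun_apply g x) / N x))" for g :: "'v \<Rightarrow>\<^sub>L 'v"
    using quot by (intro bdd_aboveI2)
  have up: "op_norm N (blinfun_apply g) \<le> K * K * norm g" for g :: "'v \<Rightarrow>\<^sub>L 'v"
    unfolding op_norm_def by (rule cSUP_least) (use quot in auto)
  have ge: "N (blinfun_apply g x) / N x \<le> op_norm N (blinfun_apply g)" for g :: "'v \<Rightarrow>\<^sub>L 'v" and x
    unfolding op_norm_def by (rule cSUP_upper[OF _ bdd]) simp
  have add: "op_norm N (blinfun_apply g) \<le> op_norm N (blinfun_apply h) + op_norm N (blinfun_apply (g - h))" for g h :: "'v \<Rightarrow>\<^sub>L 'v"
    unfolding op_norm_def[of N "blinfun_apply g"]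
  proof (rule cSUP_least)
    fix x
    have "N (g x) \<le> N (h x) + N ((g - h) x)" using Nadd[of "h x" "(g - h) x"] by (simp add: blinfun.diff_left)
    then have "N (g x) / N x \<le> N (h x) / N x + N ((g - h) x) / N x"
      using Nnonneg[of x] by (simp add: add_divide_distrib[symmetric] divide_right_mono)
    also have "\<dots> \<le> op_norm N h + op_norm N (g - h)" by (intro add_mono ge)
    finally show "N (g x) / N x \<le> op_norm N h + op_norm N (g - h)" .
  qed simp
  show ?thesis
  proof (rule that[of "K * K"])
    show "0 < K * K" using K(1) by simp
    show "op_norm N (blinfun_apply g) \<le> K * K * norm g" for g :: "'v \<Rightarrow>\<^sub>L 'v" by (rule up)
    show "0 < op_norm N (blinfun_apply g)" if g: "g \<noteq> 0" for g :: "'v \<Rightarrow>\<^sub>L 'v"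
    proof -
      have "\<exists>x. g x \<noteq> 0" using g by (metis blinfun_eqI zero_blinfun.rep_eq)
      then obtain x where x: "g x \<noteq> 0" ..
      then have "x \<noteq> 0" by (auto simp: blinfun.zero_right)
      then have "0 < N (g x) / N x" using x N0 Nnonneg by (auto simp: less_le zero_le_divide_iff)
      then show ?thesis using ge[of g x] by linarith
    qed
    have "(K * K)-lipschitz_on UNIV (\<lambda>g :: 'v \<Rightarrow>\<^sub>L 'v. op_norm N (blinfun_apply g))"
    proof (rule lipschitz_onI)
      fix g h :: "'v \<Rightarrow>\<^sub>L 'v"
      show "dist (op_norm N g) (op_norm N h) \<le> K * K * dist g h"
        using add[of g h] add[of h g] up[of "g - h"] up[of "h - g"]
        by (simp add: dist_norm norm_minus_commute abs_le_iff)
    qed (use K(1) in simp)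
    then show "continuous_on UNIV (\<lambda>g :: 'v \<Rightarrow>\<^sub>L 'v. op_norm N (blinfun_apply g))"
      by (rule lipschitz_on_continuous_on)
  qed
qed

theorem theorem1p4:
  fixes N :: "'v::euclidean_space \<Rightarrow> real"
    and \<mu> :: "('v \<Rightarrow>\<^sub>L 'v) measure"
    and M :: "'w measure"
    and X :: "nat \<Rightarrow> 'w \<Rightarrow> 'v \<Rightarrow>\<^sub>L 'v"
  assumes "vector_norm N"
    and "prob_space \<mu>"
    and "sets \<mu> = sets borel_GL"
    and "has_moment N \<mu> 1"
    and "strongly_irreducible (generated_semigroup (support_GL \<mu>))"
    and "prob_space M"
    and "prob_space.indep_vars M (\<lambda>_. \<mu>) X {1..}"
    and "\<And>i. i \<ge> 1 \<Longrightarrow> distr M \<mu> (X i) = \<mu>"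
  defines "P \<equiv> \<lambda>n \<epsilon>. measure M {\<omega> \<in> space M. spectral_ratio N (left_walk X n \<omega>) \<le> \<epsilon>}"
  shows "mono_on {0<..} (\<lambda>\<epsilon>::real. limsup (\<lambda>n. ereal (P n \<epsilon>))) \<and>
         ((\<lambda>\<epsilon>::real. limsup (\<lambda>n. ereal (P n \<epsilon>))) \<longlongrightarrow> 0) (at_right 0) \<and>
         (\<forall>\<epsilon>. \<epsilon> \<longlonglongrightarrow> 0 \<longrightarrow> (\<lambda>n. P n (\<epsilon> n)) \<longlonglongrightarrow> 0)"
proof -
  interpret M: prob_space M by fact
  have \<mu>: "GL_prob \<mu>" using assms by (simp add: GL_prob_def)
  obtain \<nu> where \<nu>: "prob_space \<nu>" "sets \<nu> = sets borel" "AE x in \<nu>. norm x = 1" "stationary \<mu> \<nu>"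
    by (rule stationary_exists[OF \<mu>])
  interpret W: stationary_walk \<mu> \<nu>
    by (intro stationary_walk.intro \<mu> \<nu> stationary_null_subspace[OF \<mu> \<nu> assms(5)])
  obtain K where K: "0 < K" "\<And>g :: 'v \<Rightarrow>\<^sub>L 'v. op_norm N (blinfun_apply g) \<le> K * norm g"
    "\<And>g :: 'v \<Rightarrow>\<^sub>L 'v. g \<noteq> 0 \<Longrightarrow> 0 < op_norm N (blinfun_apply g)"
    "continuous_on UNIV (\<lambda>g :: 'v \<Rightarrow>\<^sub>L 'v. op_norm N (blinfun_apply g))"
    by (rule op_norm_properties[OF assms(1)]) blast
  have ratio_meas: "spectral_ratio N \<in> borel_measurable borel_GL"
    unfolding spectral_ratio_def[abs_def]
    by (intro borel_measurable_divide measurable_borel_GL_imp measurable_spectral_radius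
        borel_measurable_continuous_onI K(4))
  have ratio_sets: "{g \<in> GL. spectral_ratio N g \<le> \<epsilon>} \<in> sets borel_GL" for \<epsilon>
  proof -
    have "{g \<in> space borel_GL. spectral_ratio N g \<le> \<epsilon>} \<in> sets borel_GL"
      using ratio_meas by measurable
    then show ?thesis by simp
  qed
  have walk: "left_walk X n \<in> measurable M borel_GL" "distr M borel_GL (left_walk X n) = conv_power \<mu> n" for n
    using distr_left_walk[OF assms(6) \<mu> assms(7,8), of n] by auto
  have P_eq: "P n \<epsilon> = measure (conv_power \<mu> n) {g \<in> GL. spectral_ratio N g \<le> \<epsilon>}" for n \<epsilon>
  proof -
    have "measure (conv_power \<mu> n) {g \<in> GL. spectral_ratio N g \<le> \<epsilon>}
        = measure M (left_walk X n -` {g \<in> GL. spectral_ratio N g \<le> \<epsilon>} \<inter> space M)"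
      unfolding walk(2)[symmetric] by (rule measure_distr[OF walk(1) ratio_sets])
    also have "left_walk X n -` {g \<in> GL. spectral_ratio N g \<le> \<epsilon>} \<inter> space M
        = {\<omega> \<in> space M. spectral_ratio N (left_walk X n \<omega>) \<le> \<epsilon>}"
      using measurable_space[OF walk(1)] by auto
    finally show ?thesis by (simp add: P_def)
  qed
  have P_nonneg: "0 \<le> P n \<epsilon>" for n \<epsilon> by (simp add: P_def)
  have P_mono: "P n \<epsilon> \<le> P n \<epsilon>'" if "\<epsilon> \<le> \<epsilon>'" for n \<epsilon> \<epsilon>'
  proof -
    interpret Pn: prob_space "conv_power \<mu> n" by (rule W.prob_space_P)
    show ?thesis unfolding P_eq
      by (rule Pn.finite_measure_mono) (use that ratio_sets W.sets_P in auto)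
  qed
  \<comment> \<open>Both forms of the conclusion follow from this bound, uniform in
    \<open>n \<ge> N0\<close>, because \<open>P n\<close> is monotone in the threshold.\<close>
  have small: "\<exists>\<epsilon>>0. \<exists>N0. \<forall>n\<ge>N0. P n \<epsilon> \<le> \<eta>" if \<eta>: "0 < \<eta>" for \<eta>
  proof -
    obtain \<epsilon> N0 where \<epsilon>: "0 < \<epsilon>" "\<And>n. n \<ge> N0 \<Longrightarrow>
        measure (conv_power \<mu> n) {g \<in> GL. spectral_radius (blinfun_apply g) \<le> \<epsilon> * norm g} \<le> \<eta>"
      by (rule W.small_spectral_radius_unlikely[OF \<eta>]) blast
    \<comment> \<open>The division by \<open>K\<close> makes up for \<open>op_norm N\<close> being
      as large as \<open>K * norm g\<close>.\<close>
    have "P n (\<epsilon> / K) \<le> \<eta>" if n: "n \<ge> N0" for n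
    proof -
      interpret Pn: prob_space "conv_power \<mu> n" by (rule W.prob_space_P)
      have "P n (\<epsilon> / K) \<le> measure (conv_power \<mu> n) {g \<in> GL. spectral_radius (blinfun_apply g) \<le> \<epsilon> * norm g}"
        unfolding P_eq
      proof (rule Pn.finite_measure_mono)
        show "{g \<in> GL. spectral_ratio N g \<le> \<epsilon> / K} \<subseteq> {g \<in> GL. spectral_radius (blinfun_apply g) \<le> \<epsilon> * norm g}"
        proof clarify
          fix g :: "'v \<Rightarrow>\<^sub>L 'v" assume g: "g \<in> GL" "spectral_ratio N g \<le> \<epsilon> / K"
          have "0 < op_norm N (blinfun_apply g)" using K(3) GL_nonzero[OF g(1)] by blast
          then have "spectral_radius (blinfun_apply g) \<le> \<epsilon> / K * op_norm N (blinfun_apply g)"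
            using g(2) by (simp add: spectral_ratio_def pos_divide_le_eq)
          also have "\<dots> \<le> \<epsilon> / K * (K * norm g)" using K(1,2) \<epsilon>(1) by (intro mult_left_mono) auto
          finally show "spectral_radius (blinfun_apply g) \<le> \<epsilon> * norm g" using K(1) by simp
        qed
        have "{g \<in> space borel_GL. spectral_radius (blinfun_apply g) \<le> \<epsilon> * norm g} \<in> sets borel_GL"
          using measurable_borel_GL_imp[OF measurable_spectral_radius] by measurable
        then show "{g \<in> GL. spectral_radius (blinfun_apply g) \<le> \<epsilon> * norm g} \<in> Pn.events"
          by (simp add: W.sets_P)
      qed
      then show ?thesis using \<epsilon>(2)[OF n] by linarith
    qed
    then show ?thesis using \<epsilon>(1) K(1) by (intro exI[of _ "\<epsilon> / K"]) auto
  qed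
  have "mono_on {0<..} (\<lambda>\<epsilon>::real. limsup (\<lambda>n. ereal (P n \<epsilon>)))"
    by (intro mono_onI Limsup_mono always_eventually allI) (simp add: P_mono)
  moreover have "((\<lambda>\<epsilon>::real. limsup (\<lambda>n. ereal (P n \<epsilon>))) \<longlongrightarrow> 0) (at_right 0)"
  proof (rule order_tendstoI)
    fix a :: ereal assume "a < 0"
    moreover have "0 \<le> limsup (\<lambda>n. ereal (P n \<epsilon>))" for \<epsilon>
      by (rule le_Limsup) (auto simp: P_nonneg)
    ultimately show "\<forall>\<^sub>F \<epsilon> in at_right 0. a < limsup (\<lambda>n. ereal (P n \<epsilon>))"
      by (intro always_eventually allI) (rule less_le_trans)
  next
    fix a :: ereal assume "0 < a"
    then obtain \<eta> where \<eta>: "0 < \<eta>" "ereal \<eta> < a" using ereal_dense2[of 0 a] by auto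
    obtain \<epsilon>0 N0 where \<epsilon>0: "0 < \<epsilon>0" "\<And>n. n \<ge> N0 \<Longrightarrow> P n \<epsilon>0 \<le> \<eta>" using small[OF \<eta>(1)] by blast
    have "limsup (\<lambda>n. ereal (P n \<epsilon>)) < a" if "\<epsilon> < \<epsilon>0" for \<epsilon>
    proof -
      have "\<forall>\<^sub>F n in sequentially. ereal (P n \<epsilon>) \<le> ereal \<eta>"
        unfolding eventually_sequentially
      proof (intro exI[of _ N0] allI impI)
        fix n assume "N0 \<le> n"
        then show "ereal (P n \<epsilon>) \<le> ereal \<eta>"
          using \<epsilon>0(2)[of n] P_mono[of \<epsilon> \<epsilon>0 n] that by simp
      qed
      then have "limsup (\<lambda>n. ereal (P n \<epsilon>)) \<le> ereal \<eta>" by (rule Limsup_bounded)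
      then show ?thesis using \<eta>(2) by (rule le_less_trans)
    qed
    then show "\<forall>\<^sub>F \<epsilon> in at_right 0. limsup (\<lambda>n. ereal (P n \<epsilon>)) < a"
      using eventually_at_right_less[of 0] \<epsilon>0(1) unfolding eventually_at_right_field by blast
  qed
  moreover have "(\<lambda>n. P n (\<epsilon> n)) \<longlonglongrightarrow> 0" if \<epsilon>: "\<epsilon> \<longlonglongrightarrow> 0" for \<epsilon>
  proof (rule order_tendstoI)
    fix a :: real assume "a < 0"
    then show "\<forall>\<^sub>F n in sequentially. a < P n (\<epsilon> n)"
      by (intro always_eventually allI less_le_trans[OF _ P_nonneg])
  next
    fix a :: real assume "0 < a"
    then obtain \<epsilon>0 N0 where \<epsilon>0: "0 < \<epsilon>0" "\<And>n. n \<ge> N0 \<Longrightarrow> P n \<epsilon>0 \<le> a / 2"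
      using small[of "a / 2"] by auto
    have "\<forall>\<^sub>F n in sequentially. \<epsilon> n < \<epsilon>0" using order_tendstoD(2)[OF \<epsilon> \<epsilon>0(1)] .
    moreover have "\<forall>\<^sub>F n in sequentially. n \<ge> N0" by (rule eventually_ge_at_top)
    ultimately show "\<forall>\<^sub>F n in sequentially. P n (\<epsilon> n) < a"
    proof eventually_elim
      case (elim n)
      then show ?case using \<epsilon>0(2)[of n] P_mono[of "\<epsilon> n" \<epsilon>0 n] \<open>0 < a\<close> by simp
    qed
  qed
  ultimately show ?thesis by blast
qed

end
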